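(* Let $d\in\mathbb{N}$, $d\geq 2$, and let $\beta\in(1,2)$ be the $d$-Bonacci number. Then the family of Rauzy fractals $\{\mathcal{R}(x)\}_{x\in\mathbb{Z}[\beta]\cap X_S}$ associated with the symmetric $\beta$-transformation $T_S$ is a multiple tiling of $\mathbb{R}^{d-1}$ with covering degree equal to $d-1$.
   Context: The $d$-Bonacci number is the Pisot number $\beta\in(1,2)$ satisfying $\beta^d=\beta^{d-1}+\beta^{d-2}+\dots+\beta+1$; it is an algebraic unit of degree $d$. Let $X_S=[-\tfrac12,\tfrac\beta2-1)\cup[1-\tfrac\beta2,\tfrac12)$ and define the symmetric $\beta$-transformation $T_S\colon X_S\to X_S$, $T_S(x)=\beta x-\lfloor \beta x-\tfrac12\rfloor$. Suppose $\beta$ has $2e$ non-real Galois conjugates $\beta_{(1)},\dots,\beta_{(e)},\overline{\beta_{(1)}},\dots,\overline{\beta_{(e)}}$ and $d-2e-1$ real Galois conjugates $\beta_{(e+1)},\dots,\beta_{(d-e-1)}$ other than $\beta$; let $\sigma_{(j)}\colon\mathbb{Q}(\beta)\to\mathbb{Q}(\beta_{(j)})$ be the corresponding field isomorphisms, and define $\Phi\colon\mathbb{Q}(\beta)\to\mathbb{C}^e\times\mathbb{R}^{d-2e-1}\cong\mathbb{R}^{d-1}$, $\Phi(x)=(\sigma_{(1)}(x),\dots,\sigma_{(d-e-1)}(x))$. For $x\in\mathbb{Z}[\beta]\cap X_S$ the Rauzy fractal ($\beta$-tile) is the Hausdorff limit $\mathcal{R}(x)=\lim_{n\to\infty}\Phi(\beta^nT_S^{-n}(x))\subset\mathbb{R}^{d-1}$,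 where $T_S^{-n}(x)$ is the set of preimages of $x$ in $X_S$. A family $\mathcal{T}$ of subsets of $\mathbb{R}^{d-1}$ is a multiple tiling if: its members take only finitely many shapes up to translation; it is locally finite (every bounded set meets only finitely many members); it covers $\mathbb{R}^{d-1}$; every member is the closure of its interior; and there is an integer $m\geq1$ such that almost every point of $\mathbb{R}^{d-1}$ lies in exactly $m$ members. This $m$ is the covering degree; a multiple tiling with $m=1$ is a tiling.
   Formalization: The symmetric transformation is taken as T_S(x) = βx − ⌊βx + 1/2⌋; the printed βx − ⌊βx − 1/2⌋ has values in [1/2, 3/2), disjoint from X_S, so it does not map X_S to X_S and leaves the Rauzy fractals undefined. *)

theory Defs
  imports
    "HOL-Analysis.Analysis"
    "HOL-Computational_Algebra.Polynomial_Factorial"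
begin

section \<open>Algebraic numbers, conjugates and field isomorphisms\<close>

definition subfield_of :: "'a::field set \<Rightarrow> bool" where
  "subfield_of K \<longleftrightarrow> 1 \<in> K \<and>
     (\<forall>x\<in>K. \<forall>y\<in>K. x - y \<in> K \<and> x * y \<in> K) \<and> (\<forall>x\<in>K. inverse x \<in> K)"

text \<open>The fields in question have characteristic 0, so the subfield generated by \<open>a\<close> is
  the extension of the rationals by \<open>a\<close>.\<close>

definition rat_adjoin :: "'a::field_char_0 \<Rightarrow> 'a set" where
  "rat_adjoin a = subfield_of hull {a}"

definition int_adjoin :: "'a::comm_ring_1 \<Rightarrow> 'a set" where
  "int_adjoin a = range (\<lambda>p :: int poly. poly (map_poly of_int p) a)"

definition field_iso_on :: "('a::field \<Rightarrow> 'b::field) \<Rightarrow> 'a set \<Rightarrow> 'b set \<Rightarrow> bool" where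
  "field_iso_on f K L \<longleftrightarrow> bij_betw f K L \<and> f 1 = 1 \<and>
     (\<forall>x\<in>K. \<forall>y\<in>K. f (x + y) = f x + f y \<and> f (x * y) = f x * f y)"

text \<open>This is only meaningful for algebraic \<open>a\<close>.\<close>

definition min_poly :: "'a::field_char_0 \<Rightarrow> rat poly" where
  "min_poly a = (THE p. lead_coeff p = 1 \<and> irreducible p \<and> poly (map_poly of_rat p) a = 0)"

text \<open>The number itself counts as one of its conjugates.\<close>

definition galois_conjugates :: "real \<Rightarrow> complex set" where
  "galois_conjugates a = {z. poly (map_poly of_rat (min_poly a)) z = 0}"


section \<open>Hausdorff limits\<close>

text \<open>For nonempty bounded sets.\<close>

definition hausdorff_dist :: "'a::metric_space set \<Rightarrow> 'a set \<Rightarrow> real" where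
  "hausdorff_dist A B = max (SUP x\<in>A. infdist x B) (SUP y\<in>B. infdist y A)"

definition hausdorff_lim :: "(nat \<Rightarrow> 'a::metric_space set) \<Rightarrow> 'a set" where
  "hausdorff_lim S =
     (THE K. compact K \<and> K \<noteq> {} \<and> (\<lambda>n. hausdorff_dist (S n) K) \<longlonglongrightarrow> 0)"


section \<open>Multiple tilings\<close>

text \<open>Families are indexed, so that equal sets at different indices are counted separately.
  In the covering degree \<open>m \<ge> 1\<close> rules out points that lie in infinitely many members, for
  which \<open>card\<close> is 0.\<close>

definition has_covering_degree ::
    "'i set \<Rightarrow> ('i \<Rightarrow> 'a::euclidean_space set) \<Rightarrow> nat \<Rightarrow> bool" where
  "has_covering_degree I R m \<longleftrightarrow>
     m \<ge> 1 \<and> (AE z in lebesgue. card {i\<in>I. z \<in> R i} = m)"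

definition multiple_tiling :: "'i set \<Rightarrow> ('i \<Rightarrow> 'a::euclidean_space set) \<Rightarrow> bool" where
  "multiple_tiling I R \<longleftrightarrow>
     (\<exists>F. finite F \<and> (\<forall>i\<in>I. \<exists>S\<in>F. \<exists>v. R i = (\<lambda>z. v + z) ` S)) \<and>
     (\<forall>B. bounded B \<longrightarrow> finite {i\<in>I. R i \<inter> B \<noteq> {}}) \<and>
     (\<Union>i\<in>I. R i) = UNIV \<and>
     (\<forall>i\<in>I. closure (interior (R i)) = R i) \<and>
     (\<exists>m. has_covering_degree I R m)"


section \<open>The symmetric beta-transformation and its Rauzy fractals\<close>

definition X_S :: "real \<Rightarrow> real set" where
  "X_S \<beta> = {-(1/2)..<\<beta>/2 - 1} \<union> {1 - \<beta>/2..<1/2}"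

text \<open>The integer subtracted is the one that brings the result into \<open>[-1/2, 1/2)\<close>.\<close>

definition T_S :: "real \<Rightarrow> real \<Rightarrow> real" where
  "T_S \<beta> x = \<beta> * x - of_int \<lfloor>\<beta> * x + 1/2\<rfloor>"

lemma T_S_maps_X_S:
  assumes "1 < \<beta>" "\<beta> < 2" "x \<in> X_S \<beta>"
  shows "T_S \<beta> x \<in> X_S \<beta>"
proof -
  have gap: "0 \<le> (\<beta> - 1) * (2 - \<beta>)" using assms by simp
  consider "-(1/2) \<le> x" "x < \<beta>/2 - 1" | "1 - \<beta>/2 \<le> x" "x < 1/2"
    using assms(3) by (auto simp: X_S_def)
  then show ?thesis
  proof cases
    case 1
    have l: "- \<beta> / 2 \<le> \<beta> * x"
      using mult_left_mono[of "-(1/2)" x \<beta>] 1 assms by simp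
    have "\<beta> * x < \<beta> * (\<beta>/2 - 1)" using 1 assms by simp
    also have "\<dots> \<le> \<beta>/2 - 1" using gap by (simp add: algebra_simps)
    finally have u: "\<beta> * x < \<beta>/2 - 1" .
    show ?thesis
    proof (cases "\<beta> * x < -(1/2)")
      case True
      then have "\<lfloor>\<beta> * x + 1/2\<rfloor> = -1"
        unfolding floor_eq_iff using l assms(1,2) by auto
      then show ?thesis using l True assms by (simp add: T_S_def X_S_def)
    next
      case False
      then have "\<lfloor>\<beta> * x + 1/2\<rfloor> = 0"
        unfolding floor_eq_iff using u assms(1,2) by auto
      then show ?thesis using u False by (simp add: T_S_def X_S_def)
    qed
  next
    case 2
    have "\<beta> * x < \<beta> / 2" using 2 assms by simp
    then have u1: "\<beta> * x < 1" and u: "\<beta> * x - 1 < \<beta>/2 - 1"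
      using assms(2) by linarith+
    have "1 - \<beta>/2 \<le> \<beta> * (1 - \<beta>/2)" using gap by (simp add: algebra_simps)
    also have "\<dots> \<le> \<beta> * x" using 2 assms by (intro mult_left_mono) auto
    finally have l: "1 - \<beta>/2 \<le> \<beta> * x" .
    show ?thesis
    proof (cases "\<beta> * x < 1/2")
      case True
      then have "\<lfloor>\<beta> * x + 1/2\<rfloor> = 0"
        unfolding floor_eq_iff using l assms(1,2) by auto
      then show ?thesis using l True by (simp add: T_S_def X_S_def)
    next
      case False
      then have "\<lfloor>\<beta> * x + 1/2\<rfloor> = 1"
        unfolding floor_eq_iff using u1 assms(1,2) by auto
      then show ?thesis using u False by (simp add: T_S_def X_S_def)
    qed
  qed
qed

definition T_S_preimages :: "real \<Rightarrow> nat \<Rightarrow> real \<Rightarrow> real set" where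
  "T_S_preimages \<beta> n x = {y \<in> X_S \<beta>. (T_S \<beta> ^^ n) y = x}"

text \<open>The embeddings \<open>\<sigma> j\<close> for \<open>1 \<le> j \<le> e\<close> are the non-real ones (one per conjugate pair), and
  those for \<open>e < j \<le> d - e - 1\<close> are the real ones. The space
  \<open>complex^e \<times> real^(d - 2 e - 1)\<close> is identified with \<open>real^(d - 1)\<close> by splitting each complex
  coordinate into its real and imaginary part: the coordinates numbered \<open>1, \<dots>, d - e - 1\<close> are the
  real parts (the whole value, for real embeddings) and those numbered \<open>d - e, \<dots>, d - 1\<close> are the
  imaginary parts. The numbering \<open>\<iota>\<close> of the index type \<open>'n\<close> by \<open>1, \<dots>, d - 1\<close> is arbitrary.\<close>

definition Phi ::
    "nat \<Rightarrow> nat \<Rightarrow> (nat \<Rightarrow> real \<Rightarrow> complex) \<Rightarrow> ('n::finite \<Rightarrow> nat) \<Rightarrow> real \<Rightarrow> real ^ 'n" where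
  "Phi d e \<sigma> \<iota> x =
     (\<chi> i. if \<iota> i \<le> d - e - 1 then Re (\<sigma> (\<iota> i) x) else Im (\<sigma> (\<iota> i - (d - e - 1)) x))"

definition rauzy_fractal ::
    "real \<Rightarrow> (real \<Rightarrow> 'a::metric_space) \<Rightarrow> real \<Rightarrow> 'a set" where
  "rauzy_fractal \<beta> \<Phi> x =
     hausdorff_lim (\<lambda>n. \<Phi> ` (\<lambda>y. \<beta> ^ n * y) ` T_S_preimages \<beta> n x)"

end

(* The map x |-> (x + [x < 0]) / (beta - 1) conjugates T_S to T u = beta u - [u >= c] on the
   interval X of length 1 centred at c = 1 / (2 (beta - 1)), and Z[beta] to L = Z[beta] / (beta - 1),
   which is the union of d - 1 cosets of Z[beta]. Each coset is invariant under T, and its tiles form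
   a tiling of degree 1; this gives the covering degree d - 1.

   For a coset and a point z let C z be the set of the points of the coset whose tile contains z. If
   M is the contraction conjugate to multiplication by beta, then C (M z) is the image of C z under
   T, and C (z + phi v) = C z + v for small v >= 0 in Z[beta]. At a point where card (C z) is minimal
   it is 1: two points u1, u2 of C z have small translates u1 + v, u2 + v with a common T-orbit.
   Such a v is found by writing a difference of two orbit points as a finite sum of terms
   e_i beta^-(i+1) with e_i in {-1, 0, 1} and by splitting e as the difference of two digit strings
   without runs of length d + 1, which are exactly the ones that T admits.

   The points with card (C z) = 1 contain a relatively dense family of balls of fixed radius and
   are invariant under M, so they occupy a fixed proportion of every ball and have null complement. *)

theory Submission
  imports Defs "HOL-Library.Multiset"
begin

section \<open>Finite expansions\<close>

text \<open>The obstacle is the splitting of \<open>e\<close>. Two points of \<open>X\<close> may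
  differ by almost 1, and an expansion of such a difference may begin with \<open>d\<close> equal
  signs, which leaves no freedom to join the two digit strings to the orbits followed so far.
  Therefore one orbit is first steered onto the 2-cycle \<open>c + h\<close>, \<open>c - h\<close>.
  No point of \<open>X\<close> is farther from this cycle than
  \<open>1 / 2 + 1 / (2 * (\<beta> + 1))\<close>, and below that bound suitable expansions exist:
  for \<open>d \<ge> 3\<close> one of minimal support, justified by numerical estimates; for
  \<open>d = 2\<close> these estimates fail, but \<open>1 - q = q ^ 2\<close> permits a direct
  construction. That there are finite expansions at all rests on a carry procedure, whose
  termination is the purpose of \<open>mset_lenlex\<close>. Translations are restricted to
  \<open>v \<ge> 0\<close> because all intervals are closed on the left only, so that digits are
  continuous from the right. The number \<open>d - 1\<close> of cosets is, up to sign, the value of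
  the defining polynomial at 1: modulo \<open>\<beta> - 1\<close> the number \<beta> becomes
  1.\<close>

definition mset_lenlex :: "(nat multiset \<times> nat multiset) set" where
  "mset_lenlex = {(A, B). size A < size B \<or> size A = size B \<and>
     (\<exists>p. (\<forall>i<p. count A i = count B i) \<and> count A p > count B p)}"

text \<open>Pass to sorted lists. Of two multisets of equal size, the one with more copies of the
  first index at which the counts differ has the lexicographically smaller list, so the order embeds
  into \<open>lenlex\<close>.\<close>

lemma wf_mset_lenlex: "wf mset_lenlex"
proof (rule wf_subset)
  show "wf (inv_image (lenlex less_than) (sorted_list_of_multiset :: nat multiset \<Rightarrow> nat list))"
    by (intro wf_inv_image wf_lenlex wf_less_than)
  have "(xs, ys) \<in> lex less_than"
    if srt: "sorted xs" "sorted ys" and len: "length xs = length ys"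
      and p: "\<forall>i<p. count (mset xs) i = count (mset ys) i" "count (mset xs) p > count (mset ys) p"
    for xs ys :: "nat list" and p
  proof (rule ccontr)
    assume "(xs, ys) \<notin> lex less_than"
    moreover have "xs \<noteq> ys" using p by auto
    moreover have "total (lenlex less_than)" by (rule total_lenlex) simp
    ultimately have "(xs, ys) \<in> lenlex less_than \<or> (ys, xs) \<in> lenlex less_than"
      by (simp add: total_on_def)
    then have "(ys, xs) \<in> lex less_than"
      using len \<open>(xs, ys) \<notin> lex less_than\<close> by (simp add: lenlex_conv)
    then obtain w x xs' y ys' where eq: "ys = w @ y # ys'" "xs = w @ x # xs'" "y < x"
      by (auto simp: lex_conv)
    have ge: "\<And>t. t \<in> set ys' \<Longrightarrow> y \<le> t" "\<And>t. t \<in> set xs' \<Longrightarrow> x \<le> t"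
      using srt eq by (auto simp: sorted_append)
    have c0: "count (mset xs') i = 0" if "i < x" for i
      using ge(2)[of i] that by (auto simp: not_in_iff[symmetric])
    have c1: "count (mset ys') i = 0" if "i < y" for i
      using ge(1)[of i] that by (auto simp: not_in_iff[symmetric])
    \<comment> \<open>\<open>y\<close> is the smaller of the two entries at the first difference of
      the lists, so \<open>ys\<close> contains it more often than \<open>xs\<close>. Wherever
      \<open>y\<close> lies relative to \<open>p\<close>, this conflicts with the counts.\<close>
    consider "y < p" | "y = p" | "p < y" by linarith
    then show False
    proof cases
      case 1 then show ?thesis using p(1)[rule_format, of y] eq c0[of y] by auto
    next
      case 2
      have "count (mset xs) y = count (mset w) y" using eq(3) c0[of y] by (auto simp add: eq(1,2))
      then show ?thesis using p(2) 2 by (simp add: eq)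
    next
      case 3 then show ?thesis using p(2) eq c0[of p] c1[of p] by auto
    qed
  qed
  note lex = this[OF sorted_sorted_list_of_multiset sorted_sorted_list_of_multiset,
    unfolded mset_sorted_list_of_multiset]
  have "length (sorted_list_of_multiset A) = size A" for A :: "nat multiset"
    by (metis mset_sorted_list_of_multiset size_mset)
  then show "mset_lenlex \<subseteq> inv_image (lenlex less_than) sorted_list_of_multiset"
    using lex by (auto simp: mset_lenlex_def lenlex_conv)
qed

section \<open>The ring generated by one element\<close>

lemma int_adjoin_0 [simp]: "0 \<in> int_adjoin a"
  unfolding int_adjoin_def by (rule image_eqI[of _ _ 0]) auto

lemma int_adjoin_1 [simp]: "1 \<in> int_adjoin a"
  unfolding int_adjoin_def by (rule image_eqI[of _ _ 1]) auto

lemma map_poly_of_int_add: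
  "map_poly (of_int :: int \<Rightarrow> 'a::comm_ring_1) (p + q) = map_poly of_int p + map_poly of_int q"
  by (rule poly_eqI) (simp add: coeff_map_poly)

lemma map_poly_of_int_mult:
  "map_poly (of_int :: int \<Rightarrow> 'a::comm_ring_1) (p * q) = map_poly of_int p * map_poly of_int q"
  by (rule poly_eqI) (simp add: coeff_map_poly coeff_mult)

lemma int_adjoin_add [simp]: "x \<in> int_adjoin a \<Longrightarrow> y \<in> int_adjoin a \<Longrightarrow> x + y \<in> int_adjoin a"
  unfolding int_adjoin_def
  by (clarsimp simp: image_iff) (metis map_poly_of_int_add poly_add)

lemma int_adjoin_mult [simp]: "x \<in> int_adjoin a \<Longrightarrow> y \<in> int_adjoin a \<Longrightarrow> x * y \<in> int_adjoin a"
  unfolding int_adjoin_def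
  by (clarsimp simp: image_iff) (metis map_poly_of_int_mult poly_mult)

lemma int_adjoin_of_int [simp]: "of_int k \<in> int_adjoin a"
  unfolding int_adjoin_def by (rule image_eqI[of _ _ "[:k:]"]) (auto simp: map_poly_pCons)

lemma int_adjoin_uminus [simp]: "x \<in> int_adjoin a \<Longrightarrow> - x \<in> int_adjoin a"
  using int_adjoin_mult[OF int_adjoin_of_int[of "-1"]] by simp

lemma int_adjoin_diff [simp]: "x \<in> int_adjoin a \<Longrightarrow> y \<in> int_adjoin a \<Longrightarrow> x - y \<in> int_adjoin a"
  using int_adjoin_add[of x a "- y"] by simp

lemma int_adjoin_self [simp]: "a \<in> int_adjoin a"
  unfolding int_adjoin_def by (rule image_eqI[of _ _ "[:0, 1:]"]) (auto simp: map_poly_pCons)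

lemma int_adjoin_power [simp]: "x \<in> int_adjoin a \<Longrightarrow> x ^ n \<in> int_adjoin a"
  by (induction n) auto

lemma int_adjoin_sum [simp]: "(\<And>i. i \<in> A \<Longrightarrow> f i \<in> int_adjoin a) \<Longrightarrow> sum f A \<in> int_adjoin a"
  by (induction A rule: infinite_finite_induct) auto

lemma int_adjoin_of_nat [simp]: "of_nat k \<in> int_adjoin a"
  using int_adjoin_of_int[of "int k"] by simp

text \<open>Horner's scheme, turned into an induction principle.\<close>

lemma int_adjoin_induct [consumes 1, case_names zero step]:
  assumes "x \<in> int_adjoin a" and "P 0"
    and "\<And>y k. y \<in> int_adjoin a \<Longrightarrow> P y \<Longrightarrow> P (of_int k + a * y)"
  shows "P x"
proof -
  obtain p where p: "x = poly (map_poly of_int p) a"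
    using assms(1) by (auto simp: int_adjoin_def)
  have "P (poly (map_poly of_int p) a)"
  proof (induction p)
    case 0
    then show ?case using assms(2) by simp
  next
    case (pCons k p)
    then show ?case using assms(3)[of "poly (map_poly of_int p) a" k]
      by (auto simp: map_poly_pCons int_adjoin_def)
  qed
  then show ?thesis by (simp add: p)
qed

section \<open>Carries and runs among the powers of \<open>q = 1 / \<beta>\<close>\<close>

locale dbonacci =
  fixes d :: nat and \<beta> :: real
  assumes d2: "d \<ge> 2" and b1: "1 < \<beta>" and b2: "\<beta> < 2"
    and bd: "\<beta> ^ d = (\<Sum>i<d. \<beta> ^ i)"
begin

definition q :: real where "q = 1 / \<beta>"

lemma q_pos: "0 < q" and q_lt1: "q < 1" and q_gt: "1 / 2 < q" and q_beta [simp]: "q * \<beta> = 1"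
  and beta_q [simp]: "\<beta> * q = 1"
  using b1 b2 by (auto simp: q_def field_simps)

lemma q_pow_pos: "0 < q ^ n"
  using q_pos by simp

lemma beta_pow_q: "\<beta> ^ n * q ^ n = 1"
  by (simp add: power_mult_distrib[symmetric])

lemma q_sum: "(\<Sum>i<d. q ^ (i+1)) = 1"
proof -
  have "(\<Sum>i<d. q ^ (i+1)) = (\<Sum>i<d. q ^ d * \<beta> ^ i)"
  proof (rule sum.reindex_bij_witness[of _ "\<lambda>i. d - 1 - i" "\<lambda>i. d - 1 - i"])
    fix i assume "i \<in> {..<d}"
    then have "d = (i + 1) + (d - 1 - i)" by auto
    then have "q ^ d * \<beta> ^ (d - 1 - i) = q ^ (i+1) * (q ^ (d-1-i) * \<beta> ^ (d - 1 - i))"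
      by (metis mult.assoc power_add)
    then show "q ^ d * \<beta> ^ (d - 1 - i) = q ^ (i+1)" using beta_pow_q by (simp add: mult.commute)
  qed auto
  also have "\<dots> = q ^ d * \<beta> ^ d" by (simp add: bd sum_distrib_left)
  finally show ?thesis using beta_pow_q by (simp add: mult.commute)
qed

lemma q_sum_Suc: "(\<Sum>i=1..d. q ^ (k + i)) = q ^ k"
proof -
  have "(\<Sum>i=1..d. q ^ (k + i)) = (\<Sum>i<d. q ^ k * q ^ (i+1))"
    by (rule sum.reindex_bij_witness[of _ "\<lambda>i. i + 1" "\<lambda>i. i - 1"]) (auto simp: power_add)
  then show ?thesis by (simp only: sum_distrib_left[symmetric] q_sum mult_1_right)
qed

text \<open>Two neighbouring instances of the defining relation overlap in all but their end terms.
  This is the carry that removes a repeated power.\<close>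

lemma q_carry: "2 * q ^ (k + 1) = q ^ k + q ^ (k + 1 + d)"
proof -
  have "q ^ k + q ^ (k + 1 + d) = (\<Sum>i=1..d. q ^ (k + i)) + q ^ (k + 1 + d)" by (simp only: q_sum_Suc)
  also have "\<dots> = (\<Sum>i=1..Suc d. q ^ (k + i))" by simp
  also have "\<dots> = q ^ (k + 1) + (\<Sum>i=2..Suc d. q ^ (k + i))"
    by (subst sum.atLeast_Suc_atMost) (auto simp: numeral_2_eq_2)
  also have "(\<Sum>i=2..Suc d. q ^ (k + i)) = (\<Sum>i=1..d. q ^ (k + 1 + i))"
    by (rule sum.reindex_bij_witness[of _ "\<lambda>i. i + 1" "\<lambda>i. i - 1"]) auto
  finally show ?thesis by (simp only: q_sum_Suc)
qed

text \<open>The parameter \<open>k\<close> counts the entries -1 that may still follow before an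
  entry 1 is forced; it makes the induction on the length possible. After a leading -1 the tail is
  treated with \<open>k - 1\<close>. After any other entry the count restarts at \<open>d\<close>,
  where the bound for the tail is -1 by \<open>q_sum\<close>.\<close>

lemma sgn_string_gt:
  fixes e :: "nat \<Rightarrow> int"
  assumes "\<And>i. i \<ge> N \<Longrightarrow> e i = 0" "\<And>i. e i \<in> {-1,0,1}"
    and "\<And>j. (\<forall>i<d. e (j + i) = -1) \<Longrightarrow> e (j + d) = 1"
    and "k \<le> d" "(\<forall>i<k. e i = -1) \<Longrightarrow> e k = 1"
  shows "(\<Sum>i<N. e i * q ^ (i+1)) > - (\<Sum>i<k. q ^ (i+1))"
  using assms
proof (induction N arbitrary: e k)
  case 0
  have "k \<noteq> 0" using 0(1)[of 0] 0(5) by (metis less_nat_zero_code zero_le zero_neq_one)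
  then have "0 < (\<Sum>i<k. q ^ (i+1))" by (intro sum_pos) (auto simp: q_pos)
  then show ?case by simp
next
  case (Suc N)
  define e' where "e' = (\<lambda>i. e (Suc i))"
  have rec: "(\<Sum>i<Suc N. e i * q ^ (i+1)) = q * (e 0 + (\<Sum>i<N. e' i * q ^ (i+1)))"
    by (subst sum.lessThan_Suc_shift) (simp add: e'_def sum_distrib_left algebra_simps)
  have e': "\<And>i. i \<ge> N \<Longrightarrow> e' i = 0" "\<And>i. e' i \<in> {-1,0,1}"
    "\<And>j. (\<forall>i<d. e' (j + i) = -1) \<Longrightarrow> e' (j + d) = 1"
    using Suc.prems(1,2) Suc.prems(3)[of "Suc _"] by (auto simp: e'_def)
  have m1: "(\<Sum>i<N. e' i * q ^ (i+1)) > - 1"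
    using Suc.IH[of e' d] e' e'(3)[of 0] q_sum by simp
  have s_Suc: "(\<Sum>i<Suc m. q ^ (i+1)) = q * (1 + (\<Sum>i<m. q ^ (i+1)))" for m
    by (subst sum.lessThan_Suc_shift) (simp add: sum_distrib_left algebra_simps)
  show ?case
  proof (cases "e 0 = -1")
    case True
    then obtain m where k: "k = Suc m" using Suc.prems(5) by (cases k) auto
    have "e' m = 1" if "\<forall>i<m. e' i = -1"
      using Suc.prems(5) that True k by (auto simp: e'_def less_Suc_eq_0_disj)
    then have "(\<Sum>i<N. e' i * q ^ (i+1)) > - (\<Sum>i<m. q ^ (i+1))"
      using Suc.IH[of e' m] e' Suc.prems(4) k by auto
    then show ?thesis using q_pos unfolding rec k s_Suc True
      by (simp add: mult_less_cancel_left_pos flip: mult_minus_right)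
  next
    case False
    show ?thesis
    proof (cases k)
      case 0
      then have "e 0 = 1" using Suc.prems(5) by auto
      then show ?thesis using m1 q_pos unfolding rec 0 by simp
    next
      case (Suc m)
      have "real_of_int (e 0) \<ge> 0" using False Suc.prems(2)[of 0] by auto
      then have "q * (e 0 + (\<Sum>i<N. e' i * q ^ (i+1))) > q * (- 1)"
        using m1 q_pos by (intro mult_strict_left_mono) auto
      moreover have "q * (1 + (\<Sum>i<m. q ^ (i+1))) \<ge> q * 1"
        using q_pos by (intro mult_left_mono) (auto intro: sum_nonneg)
      ultimately show ?thesis unfolding rec Suc s_Suc by linarith
    qed
  qed
qed

definition mval :: "nat multiset \<Rightarrow> real" where
  "mval A = (\<Sum>i\<in>#A. q ^ (i + 1))"

lemma mval_simps [simp]: "mval {#} = 0" "mval (add_mset i A) = q ^ (i + 1) + mval A"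
  "mval (A + B) = mval A + mval B"
  by (auto simp: mval_def)

lemma mval_mset_set: "mval (mset_set S) = (\<Sum>i\<in>S. q ^ (i + 1))"
  by (simp add: mval_def sum_unfold_sum_mset)

text \<open>Two rewriting rules decrease \<open>mset_lenlex\<close>: the carry
  \<open>q_carry\<close> for a repeated exponent and the defining relation for a run of
  \<open>d\<close> exponents. A normal form is a set without such runs, and
  \<open>sgn_string_gt\<close> puts its value below 1. The terms \<open>q ^ 0\<close> that arise on
  the way are collected in the integer \<open>n\<close>.\<close>

lemma finite_01_expansion_frac:
  "\<exists>S n. finite S \<and> mval A = real n + (\<Sum>i\<in>S. q ^ (i+1)) \<and> (\<Sum>i\<in>S. q ^ (i+1)) < 1"
proof (induction A rule: wf_induct_rule[OF wf_mset_lenlex])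
  case (1 A)
  have red: ?case if less: "(B, A) \<in> mset_lenlex" and v: "mval A = real m + mval B" for B m
  proof -
    obtain S n where "finite S" "mval B = real n + (\<Sum>i\<in>S. q ^ (i+1))" "(\<Sum>i\<in>S. q ^ (i+1)) < 1"
      using "1"[OF less] by metis
    then show ?thesis using v by (intro exI[of _ S] exI[of _ "m + n"]) auto
  qed
  have dup: ?case if "count A i \<ge> 2" for i
  proof -
    have "{#i, i#} \<subseteq># A" using that by (auto simp: subseteq_mset_def)
    then obtain A0 where A: "A = add_mset i (add_mset i A0)" by (auto simp: mset_subset_eq_exists_conv)
    show ?thesis
    proof (cases i)
      case 0
      \<comment> \<open>Index 0 stands for \<open>q ^ 1\<close>, so here the carry produces the
        integer 1, which leaves the multiset and makes it smaller. In the other case the size is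
        kept, and the new index \<open>j\<close> is smaller than both removed ones.\<close>
      have "(add_mset d A0, A) \<in> mset_lenlex" by (simp add: mset_lenlex_def A)
      then show ?thesis using q_carry[of 0] by (intro red[of _ 1]) (auto simp: A 0)
    next
      case (Suc j)
      have "(add_mset j (add_mset (i + d) A0), A) \<in> mset_lenlex"
        by (auto simp: mset_lenlex_def A Suc intro!: exI[of _ j])
      then show ?thesis using q_carry[of "j+1"] by (intro red[of _ 0]) (auto simp: A Suc)
    qed
  qed
  have run: ?case if "mset_set {j..<j+d} \<subseteq># A" for j
  proof -
    define A0 where "A0 = A - mset_set {j..<j+d}"
    have A: "A = A0 + mset_set {j..<j+d}"
      unfolding A0_def using subset_mset.diff_add[OF that] by simp
    have "mval (mset_set {j..<j+d}) = (\<Sum>i\<in>{0..<d}. q ^ (i + j + 1))"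
      unfolding mval_mset_set using sum.shift_bounds_nat_ivl[of "\<lambda>i. q ^ (i+1)" 0 j d]
      by (simp add: add.commute)
    also have "\<dots> = q ^ j * (\<Sum>i<d. q ^ (i+1))"
      unfolding sum_distrib_left lessThan_atLeast0
      by (rule sum.cong) (simp_all add: power_add)
    finally have v: "mval (mset_set {j..<j+d}) = q ^ j" by (simp only: q_sum mult_1_right)
    show ?thesis
    proof (cases j)
      case 0
      have "(A0, A) \<in> mset_lenlex" using d2 by (simp add: mset_lenlex_def A)
      then show ?thesis using v by (intro red[of _ 1]) (auto simp: A 0)
    next
      case (Suc k)
      have "(add_mset k A0, A) \<in> mset_lenlex" using d2 by (simp add: mset_lenlex_def A)
      then show ?thesis using v by (intro red[of _ 0]) (auto simp: A Suc)
    qed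
  qed
  show ?case
  proof (cases "(\<exists>i. count A i \<ge> 2) \<or> (\<exists>j. mset_set {j..<j+d} \<subseteq># A)")
    case True
    then show ?thesis using dup run by blast
  next
    case False
    define S where "S = set_mset A"
    have c: "count A i = (if i \<in> S then 1 else 0)" for i
    proof -
      have "\<not> count A i \<ge> 2" using False by blast
      moreover have "count A i = 0 \<longleftrightarrow> i \<notin> S" by (simp add: S_def count_eq_zero_iff)
      ultimately have "count A i = 1" if "i \<in> S" using that by linarith
      then show ?thesis using \<open>count A i = 0 \<longleftrightarrow> i \<notin> S\<close> by simp
    qed
    then have A: "A = mset_set S" by (intro multiset_eqI) (auto simp: c count_mset_set' S_def)
    have fin: "finite S" by (simp add: S_def)
    then obtain N where N: "S \<subseteq> {..<N}" using finite_nat_bounded by blast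
    \<comment> \<open>With the sign reversed, a lower bound -1 for the string is the wanted upper
      bound 1 for the set.\<close>
    define e where "e = (\<lambda>i. if i \<in> S then -1 else (0::int))"
    have nr: "\<not> {j..<j+d} \<subseteq> S" for j
    proof
      assume "{j..<j+d} \<subseteq> S"
      then have "mset_set {j..<j+d} \<subseteq># A" using fin by (simp add: A subset_imp_msubset_mset_set)
      then show False using False by blast
    qed
    have "\<not> (\<forall>i<d. e (j + i) = -1)" for j
    proof
      assume *: "\<forall>i<d. e (j + i) = -1"
      have "t \<in> S" if "t \<in> {j..<j+d}" for t
      proof -
        have "t - j < d" "j + (t - j) = t" using that by auto
        then have "e t = -1" using * by metis
        then show ?thesis by (auto simp: e_def split: if_splits)
      qed
      then show False using nr[of j] by blast
    qed
    note nr_e = this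
    have "(\<Sum>i<N. e i * q ^ (i+1)) > - (\<Sum>i<d. q ^ (i+1))"
    proof (rule sgn_string_gt)
      show "e i = 0" if "i \<ge> N" for i using N that by (auto simp: e_def)
      show "e i \<in> {-1,0,1}" for i by (simp add: e_def)
      show "e (j + d) = 1" if "\<forall>i<d. e (j + i) = -1" for j using nr_e that by blast
      show "e d = 1" if "\<forall>i<d. e i = -1" using nr_e[of 0] that by simp
    qed simp
    moreover have "(\<Sum>i<N. e i * q ^ (i+1)) = - (\<Sum>i\<in>S. q ^ (i+1))"
    proof -
      have "(\<Sum>i\<in>S. q ^ (i+1)) = (\<Sum>i<N. (if i \<in> S then q ^ (i+1) else 0))"
        using N by (simp add: sum.If_cases Int_absorb1)
      also have "\<dots> = - (\<Sum>i<N. e i * q ^ (i+1))"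
        unfolding sum_negf[symmetric] by (rule sum.cong) (auto simp: e_def)
      finally show ?thesis by simp
    qed
    ultimately have "(\<Sum>i\<in>S. q ^ (i+1)) < 1" using q_sum by simp
    then show ?thesis using fin by (intro exI[of _ S] exI[of _ 0]) (auto simp: A mval_mset_set)
  qed
qed

text \<open>\<beta> is a unit because the constant coefficient of its polynomial is -1.\<close>

lemma q_in_Zb [simp]: "q \<in> int_adjoin \<beta>"
proof -
  obtain m where d: "d = Suc m" using d2 by (cases d) auto
  have "1 = \<beta> * (\<beta> ^ m - (\<Sum>i<m. \<beta> ^ i))"
    using bd unfolding d by (subst (asm) sum.lessThan_Suc_shift) (simp add: algebra_simps sum_distrib_left)
  then have "q = \<beta> ^ m - (\<Sum>i<m. \<beta> ^ i)"
    using b1 by (simp add: q_def field_simps)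
  then show ?thesis by simp
qed

text \<open>The point is to confine subtraction to integers. Since
  \<open>q ^ k - q ^ (k + 1)\<close> is a sum of later powers by the defining relation, so is
  \<open>1 - q ^ i\<close> by telescoping. Hence \<open>- (q ^ i)\<close> is such a sum minus 1, and
  \<open>- \<beta>\<close> is the sum of these numbers over \<open>i < d\<close>.\<close>

lemma Zb_diff_mval:
  assumes "x \<in> int_adjoin \<beta>"
  shows "\<exists>A n. x = mval A - real n"
proof -
  define P where "P x \<longleftrightarrow> (\<exists>A n. x = mval A - real n)" for x
  define V where "V = range mval"
  have V_add: "x + y \<in> V" if "x \<in> V" "y \<in> V" for x y
    using that by (auto simp: V_def) (metis mval_simps(3) rangeI)
  have V0: "0 \<in> V" by (auto simp: V_def intro!: image_eqI[of _ _ "{#}"])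
  have V_sum: "(\<Sum>i\<in>S. f i) \<in> V" if "\<And>i. i \<in> S \<Longrightarrow> f i \<in> V" for f and S :: "nat set"
    using that by (induction S rule: infinite_finite_induct) (auto intro: V0 V_add)
  have V_pow1: "q ^ (i+1) \<in> V" for i by (auto simp: V_def intro!: image_eqI[of _ _ "{#i#}"])
  have V_1: "1 \<in> V" using V_sum[of "{..<d}" "\<lambda>i. q ^ (i+1)"] V_pow1 by (simp add: q_sum[simplified])
  have V_pow: "q ^ i \<in> V" for i using V_1 V_pow1[of "i - 1"] by (cases i) auto
  have V_1q: "q ^ k * (1 - q) \<in> V" for k
  proof -
    have "q ^ k * (1 - q) = q ^ k - q ^ (k+1)" by (simp add: algebra_simps)
    also have "\<dots> = (\<Sum>i=1..d. q ^ (k + i)) - q ^ (k+1)" by (simp only: q_sum_Suc)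
    also have "\<dots> = (\<Sum>i=2..d. q ^ (k + i))"
      using d2 by (subst sum.atLeast_Suc_atMost) (auto simp: numeral_2_eq_2)
    finally show ?thesis using V_sum[of "{2..d}" "\<lambda>i. q ^ (k + i)"] V_pow by metis
  qed
  have V_1pow: "1 - q ^ i \<in> V" for i
  proof (induction i)
    case 0 then show ?case using V0 by simp
  next
    case (Suc i)
    then show ?case using V_add[OF Suc V_1q[of i]] by (simp add: algebra_simps)
  qed
  have PV: "P (x - real n)" if "x \<in> V" for x n using that by (auto simp: P_def V_def)
  have P_add: "P (x + y)" if "P x" "P y" for x y
  proof -
    obtain A n B m where *: "x = mval A - real n" "y = mval B - real m" using \<open>P x\<close> \<open>P y\<close> P_def by auto
    show ?thesis unfolding P_def * by (intro exI[of _ "A + B"] exI[of _ "n + m"]) simp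
  qed
  have P0: "P 0" using PV[OF V0, of 0] by simp
  have P_sum: "P (\<Sum>i\<in>S. f i)" if "\<And>i. i \<in> S \<Longrightarrow> P (f i)" for f and S :: "nat set"
    using that by (induction S rule: infinite_finite_induct) (auto intro: P0 P_add)
  have P_neg: "P (- (q ^ i))" for i using PV[OF V_1pow[of i], of 1] by simp
  have P_beta: "P (- \<beta>)"
  proof -
    have "(\<Sum>i<d. q ^ i) = \<beta> * (\<Sum>i<d. q ^ (i+1))"
      unfolding sum_distrib_left by (rule sum.cong) (auto simp: algebra_simps)
    then have "(\<Sum>i<d. - (q ^ i)) = - \<beta>" by (simp only: q_sum sum_negf mult_1_right)
    then show ?thesis using P_sum[of "{..<d}" "\<lambda>i. - (q ^ i)"] P_neg by auto
  qed
  have P_nat: "P (- \<beta> * real n)" for n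
  proof (induction n)
    case 0 then show ?case using P0 by simp
  next
    case (Suc n)
    have "- \<beta> * real (Suc n) = - \<beta> + - \<beta> * real n" by (simp add: algebra_simps)
    then show ?case using P_add[OF P_beta Suc] by simp
  qed
  have V_beta: "\<beta> * mval A \<in> V" for A
  proof (induction A)
    case empty then show ?case using V0 by simp
  next
    case (add i A)
    then show ?case using V_add[OF V_pow[of i] add] by (simp add: algebra_simps mult.assoc[symmetric])
  qed
  have P_int: "P (real_of_int k)" for k
  proof (cases "k \<ge> 0")
    case True
    have "real n \<in> V" for n by (induction n) (use V0 V_1 V_add in auto)
    from PV[OF this[of "nat k"], of 0] show ?thesis using True by simp
  next
    case False
    then show ?thesis using PV[OF V0, of "nat (- k)"] by simp
  qed
  from assms have "P x"
  proof (induction rule: int_adjoin_induct)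
    case zero show ?case by (rule P0)
  next
    case (step y k)
    then obtain A n where y: "y = mval A - real n" by (auto simp: P_def)
    have "real_of_int k + \<beta> * y = real_of_int k + ((\<beta> * mval A - real 0) + (- \<beta> * real n))"
      by (simp add: y algebra_simps)
    then show ?case using P_add[OF P_int P_add[OF PV[OF V_beta] P_nat]] by metis
  qed
  then show ?thesis by (simp add: P_def)
qed

text \<open>A form of the finiteness property (F) of Frougny and Solomyak. The fractional part
  produced by \<open>finite_01_expansion_frac\<close> lies in \<open>[0, 1)\<close>, just as
  \<open>x\<close> does, so the integers \<open>m\<close> and \<open>n\<close> have to
  cancel.\<close>

lemma Zb_finite_01_expansion:
  assumes "x \<in> int_adjoin \<beta>" "0 \<le> x" "x < 1"
  obtains S where "finite S" "x = (\<Sum>i\<in>S. q ^ (i+1))"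
proof -
  obtain A n where x: "x = mval A - real n" using Zb_diff_mval assms(1) by blast
  obtain S m where S: "finite S" "mval A = real m + (\<Sum>i\<in>S. q ^ (i+1))" "(\<Sum>i\<in>S. q ^ (i+1)) < 1"
    using finite_01_expansion_frac[of A] by blast
  have "0 \<le> (\<Sum>i\<in>S. q ^ (i+1))" by (intro sum_nonneg) (simp add: q_pos less_imp_le)
  then have "m = n" using S(2,3) x assms(2,3) by linarith
  then show ?thesis using that[of S] S x by simp
qed


section \<open>Sign strings\<close>

text \<open>In no window of length \<open>d + 1\<close> are all entries equal to \<open>t \<noteq> 0\<close> up to at most one zero. Hence
  filling the zeros alternately by 0 and 1 produces digit strings without runs of length \<open>d + 1\<close>.\<close>

definition sparse_runs :: "(nat \<Rightarrow> int) \<Rightarrow> bool" where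
  "sparse_runs e \<longleftrightarrow> (\<forall>j t k. t \<noteq> 0 \<longrightarrow> k \<le> d \<longrightarrow>
     (\<forall>i\<le>d. i \<noteq> k \<longrightarrow> e (j + i) = t) \<longrightarrow> e (j + k) = - t)"

definition string_of :: "real \<Rightarrow> nat \<Rightarrow> (nat \<Rightarrow> int) \<Rightarrow> bool" where
  "string_of x N e \<longleftrightarrow> (\<forall>i\<ge>N. e i = 0) \<and> (\<forall>i. e i \<in> {-1, 0, 1}) \<and>
     x = (\<Sum>i<N. e i * q ^ (i + 1))"

lemma string_of_extend:
  assumes "string_of x N e" "N \<le> M"
  shows "string_of x M e"
proof -
  have "(\<Sum>i<M. e i * q ^ (i + 1)) = (\<Sum>i<N. e i * q ^ (i + 1))"
    by (rule sum.mono_neutral_right) (use assms in \<open>auto simp: string_of_def\<close>)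
  then show ?thesis using assms by (auto simp: string_of_def)
qed

lemma string_of_uminus: "string_of x N e \<Longrightarrow> string_of (- x) N (\<lambda>i. - e i)"
  by (auto simp: string_of_def sum_negf)

lemma sparse_runs_uminus: "sparse_runs e \<Longrightarrow> sparse_runs (\<lambda>i. - e i)"
  unfolding sparse_runs_def by (metis add.inverse_inverse neg_equal_0_iff_equal)

text \<open>In a sparse string \<open>d\<close> entries -1 in a row are followed by 1, so
  \<open>sgn_string_gt\<close> bounds everything after the leading 1 by less than the weight of that
  1.\<close>

lemma string_leading:
  assumes "string_of x N e" "sparse_runs e" "e 0 = 1"
  shows "x > 0"
proof -
  define e' where "e' = (\<lambda>i. e (Suc i))"
  have *: "string_of x (Suc N) e" using string_of_extend[OF assms(1)] by simp
  have "(\<Sum>i<N. e' i * q ^ (i+1)) > - (\<Sum>i<d. q ^ (i+1))"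
  proof (rule sgn_string_gt)
    have sp: "e (Suc j + d) = 1" if "\<forall>i<d. e (Suc j + i) = -1" for j
      using assms(2)[unfolded sparse_runs_def, rule_format, of "-1" d "Suc j"] that by auto
    show "e' (j + d) = 1" if "\<forall>i<d. e' (j + i) = -1" for j
      using sp[of j] that by (simp add: e'_def)
    show "e' d = 1" if "\<forall>i<d. e' i = -1" using sp[of 0] that by (simp add: e'_def)
  qed (use assms(1) in \<open>auto simp: string_of_def e'_def\<close>)
  moreover have "x = q * (1 + (\<Sum>i<N. e' i * q ^ (i+1)))"
    using * assms(3) unfolding string_of_def
    by (subst (asm) sum.lessThan_Suc_shift) (simp add: e'_def sum_distrib_left algebra_simps)
  ultimately show ?thesis using q_pos q_sum by simp
qed

lemma string_shift:
  assumes "string_of x N e" "e 0 = 0"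
  shows "string_of (\<beta> * x) N (\<lambda>i. e (Suc i))"
proof -
  have *: "string_of x (Suc N) e" using string_of_extend[OF assms(1)] by simp
  have "x = q * (\<Sum>i<N. e (Suc i) * q ^ (i+1))"
    using * assms(2) unfolding string_of_def
    by (subst (asm) sum.lessThan_Suc_shift) (simp add: sum_distrib_left algebra_simps)
  then have "\<beta> * x = (\<beta> * q) * (\<Sum>i<N. e (Suc i) * q ^ (i+1))"
    by (simp only: mult.assoc)
  then show ?thesis using assms(1) by (simp add: string_of_def)
qed

lemma sparse_runs_shift: "sparse_runs e \<Longrightarrow> sparse_runs (\<lambda>i. e (Suc i))"
  unfolding sparse_runs_def by (metis add_Suc)

text \<open>Needed for the sign-dependent clause of \<open>coupling_digit_strings\<close>, where the
  first two entries decide how a digit string starts.\<close>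

lemma string_leading_neg:
  assumes "string_of x N e" "sparse_runs e" "x > 0"
  shows "e 0 \<noteq> -1" and "e 0 = 0 \<Longrightarrow> e 1 \<noteq> -1"
proof -
  have neg: "x < 0" if "string_of x N e" "sparse_runs e" "e 0 = -1" for x e
    using string_leading[OF string_of_uminus[OF that(1)] sparse_runs_uminus[OF that(2)]] that(3) by simp
  show "e 0 \<noteq> -1" using neg[OF assms(1,2)] assms(3) by auto
  assume 0: "e 0 = 0"
  have "\<beta> * x > 0" using assms(3) b1 by simp
  then show "e 1 \<noteq> -1"
    using neg[OF string_shift[OF assms(1) 0] sparse_runs_shift[OF assms(2)]] by auto
qed

section \<open>Strings of minimal support for \<open>d \<ge> 3\<close>\<close>

lemma beta_inverse: "1 / (\<beta> + 1) = q / (1 + q)"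
  using b1 by (simp add: q_def field_simps)

lemma q_geometric_tail: "(\<Sum>i=m..<N. q ^ (i + 1)) \<le> q ^ (m + 1) / (1 - q)"
proof (cases "m \<le> N")
  case True
  have "(\<Sum>i=m..<N. q ^ (i + 1)) = q * (\<Sum>i=m..<N. q ^ i)"
    by (simp add: sum_distrib_left)
  also have "(\<Sum>i=m..<N. q ^ i) = (q ^ m - q ^ N) / (1 - q)"
  proof -
    have "(1 - q) * (\<Sum>i=m..<N. q ^ i) = q ^ m - q ^ N"
      using True
    proof (induction rule: dec_induct)
      case (step n)
      then show ?case by (simp add: distrib_left left_diff_distrib)
    qed simp
    then show ?thesis using q_lt1 by (simp add: field_simps)
  qed
  also have "q * \<dots> \<le> q ^ (m + 1) / (1 - q)"
    using q_pos q_lt1 q_pow_pos[of N] by (simp add: field_simps)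
  finally show ?thesis .
qed (use q_pos q_lt1 in \<open>simp add: less_imp_le\<close>)

text \<open>For \<open>d = 3\<close> the number \<open>q\<close> is the reciprocal 0.5437 of the
  Tribonacci constant, and larger \<open>d\<close> makes it smaller. The value 0.547 leaves just
  enough room for \<open>coupling_bound_d3\<close>.\<close>

lemma q_le_of_d3:
  assumes "d \<ge> 3"
  shows "q < 547 / 1000"
proof (rule ccontr)
  assume "\<not> ?thesis"
  then have q: "q \<ge> 547 / 1000" by simp
  have "(\<Sum>i<3. q ^ (i+1)) \<le> (\<Sum>i<d. q ^ (i+1))"
    by (rule sum_mono2) (use assms q_pos in auto)
  then have "q + q ^ 2 + q ^ 3 \<le> 1" unfolding q_sum by (simp add: numeral_3_eq_3 numeral_2_eq_2)
  moreover have "q ^ 2 \<ge> (547 / 1000) ^ 2" "q ^ 3 \<ge> (547 / 1000) ^ 3"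
    using q by (intro power_mono; simp)+
  ultimately show False using q by (simp add: power2_eq_square power3_eq_cube)
qed

lemma q_pow_Suc_d: "q ^ (d + 1) = 2 * q - 1"
  using q_carry[of 0] by (simp add: add.commute)

lemma string_head_lower:
  fixes t :: int
  assumes "string_of x N e" "M \<le> N" "t \<in> {-1, 1}"
  shows "of_int t * x \<ge> (\<Sum>i<M. of_int (t * e i) * q ^ (i+1)) - q ^ (M + 1) / (1 - q)"
proof -
  have "x = (\<Sum>i<M. e i * q ^ (i+1)) + (\<Sum>i=M..<N. e i * q ^ (i+1))"
    using assms(1,2) unfolding string_of_def
    by (simp add: lessThan_atLeast0 sum.atLeastLessThan_concat)
  then have "of_int t * x = (\<Sum>i<M. of_int (t * e i) * q ^ (i+1)) + (\<Sum>i=M..<N. of_int (t * e i) * q ^ (i+1))"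
    by (simp add: algebra_simps sum_distrib_left)
  moreover have "(\<Sum>i=M..<N. of_int (t * e i) * q ^ (i+1)) \<ge> (\<Sum>i=M..<N. - (q ^ (i+1)))"
  proof (rule sum_mono)
    fix i
    have "e i \<in> {-1, 0, 1}" using assms(1) by (simp add: string_of_def)
    then have "t * e i \<ge> -1" using assms(3) by auto
    then have "real_of_int (t * e i) \<ge> -1" by linarith
    then show "- (q ^ (i+1)) \<le> of_int (t * e i) * q ^ (i+1)"
      using q_pow_pos[of "i+1"] mult_right_mono[of "-1" "real_of_int (t * e i)" "q ^ (i+1)"] by simp
  qed
  ultimately show ?thesis using q_geometric_tail[of M N] by (simp add: sum_negf)
qed

text \<open>Both patterns would make \<open>\<bar>x\<bar>\<close> too large. The assumed bound is
  below 0.677, whereas \<open>d\<close> equal leading signs give at least 0.79. A window with an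
  exceptional place \<open>k \<ge> 1\<close> loses at most \<open>q ^ 2\<close> there and still
  gives at least 0.681. For \<open>k = 0\<close> the loss would be \<open>q\<close>, which is too
  much.\<close>

lemma coupling_bound_d3:
  fixes t :: int
  assumes "d \<ge> 3" "string_of x N e" "\<bar>x\<bar> \<le> 1 / 2 + 1 / (2 * (\<beta> + 1))" "t \<in> {-1, 1}"
  shows "\<not> (\<forall>i<d. e i = t)"
    and "1 \<le> k \<Longrightarrow> k \<le> d \<Longrightarrow> \<forall>i\<le>d. i \<noteq> k \<longrightarrow> e i = t \<Longrightarrow> e k = - t"
proof -
  have q: "q < 547 / 1000" by (rule q_le_of_d3[OF assms(1)])
  have "1 / (2 * (\<beta> + 1)) = q / (1 + q) / 2" using beta_inverse by (metis divide_divide_eq_left mult.commute)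
  also have "q / (1 + q) < 354 / 1000" using q q_pos by (simp add: field_simps)
  finally have x: "\<bar>x\<bar> < 677 / 1000" using assms(3) by simp
  then have tx: "of_int t * x < 677 / 1000" using assms(4) by auto
  have ext: "string_of x (N + d + 1) e" using string_of_extend[OF assms(2)] by simp
  have qd: "q ^ d * q = 2 * q - 1" using q_pow_Suc_d by (simp add: mult.commute)
  have q1: "1 / (1 - q) \<le> 1000 / 453" using q by (simp add: field_simps)
  show "\<not> (\<forall>i<d. e i = t)"
  proof
    assume "\<forall>i<d. e i = t"
    then have "(\<Sum>i<d. of_int (t * e i) * q ^ (i+1)) = (\<Sum>i<d. q ^ (i+1))"
      using assms(4) by (intro sum.cong) auto
    then have "of_int t * x \<ge> 1 - q ^ (d + 1) / (1 - q)"
      using string_head_lower[OF ext _ assms(4), of d] q_sum by simp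
    moreover have "q ^ (d + 1) * (1 / (1 - q)) \<le> (94 / 1000) * (1000 / 453)"
      unfolding q_pow_Suc_d using q q1 q_lt1 q_gt by (intro mult_mono) auto
    ultimately show False using tx by simp
  qed
  assume k: "1 \<le> k" "k \<le> d" "\<forall>i\<le>d. i \<noteq> k \<longrightarrow> e i = t"
  show "e k = - t"
  proof (rule ccontr)
    assume "e k \<noteq> - t"
    moreover have "e k \<in> {-1, 0, 1}" using assms(2) by (simp add: string_of_def)
    ultimately have ek: "t * e k \<ge> 0" using assms(4) by auto
    have "(\<Sum>i<d + 1. of_int (t * e i) * q ^ (i+1)) \<ge> (\<Sum>i<d+1. q ^ (i+1) - (if i = k then q ^ (k+1) else 0))"
    proof (rule sum_mono)
      fix i assume "i \<in> {..<d+1}"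
      then show "q ^ (i+1) - (if i = k then q ^ (k+1) else 0) \<le> of_int (t * e i) * q ^ (i+1)"
        using k ek assms(4) q_pow_pos[of "k+1"] by (cases "i = k") (auto simp flip: of_int_mult)
    qed
    also have "(\<Sum>i<d+1. q ^ (i+1) - (if i = k then q ^ (k+1) else 0)) = 1 + q ^ (d + 1) - q ^ (k + 1)"
      using k q_sum by (simp add: sum_subtractf)
    finally have "of_int t * x \<ge> 1 + q ^ (d + 1) - q ^ (k + 1) - q ^ (d + 2) / (1 - q)"
      using string_head_lower[OF ext _ assms(4), of "d + 1"] by simp
    moreover have "q ^ (k + 1) \<le> q ^ 2" using k q_pos q_lt1 by (intro power_decreasing) auto
    moreover have "q ^ 2 \<le> (547 / 1000) ^ 2" using q q_pos by (intro power_mono) auto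
    \<comment> \<open>By \<open>q_pow_Suc_d\<close> the entry at place \<open>d\<close> almost
      balances the largest possible tail; only a term quadratic in \<open>2 * q - 1\<close> is
      lost.\<close>
    moreover have "q ^ (d + 1) - q ^ (d + 2) / (1 - q) = - ((2 * q - 1)\<^sup>2 * (1 / (1 - q)))"
    proof -
      have "q ^ (d + 2) = (2 * q - 1) * q" using q_pow_Suc_d by simp
      moreover have "s - s * q / (1 - q) = - (s\<^sup>2 * (1 / (1 - q)))" if "s = 2 * q - 1" for s
      proof -
        have "s < 1" "q = (s + 1) / 2" using that q_lt1 by auto
        then show ?thesis by (simp add: field_simps power2_eq_square)
      qed
      ultimately show ?thesis by (simp only: q_pow_Suc_d)
    qed
    moreover have "(2 * q - 1)\<^sup>2 * (1 / (1 - q)) \<le> (94 / 1000)\<^sup>2 * (1000 / 453)"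
      using q q1 q_lt1 q_gt by (intro mult_mono power_mono) auto
    ultimately have "of_int t * x \<ge> 1 - (547 / 1000)\<^sup>2 - (94 / 1000)\<^sup>2 * (1000 / 453)" by linarith
    then show False using tx by (simp add: power2_eq_square)
  qed
qed

text \<open>The defining relation as a string of value 0 that starts at place \<open>m\<close>.
  Adding a multiple of it changes a string but not the number represented.\<close>

definition rel_string :: "nat \<Rightarrow> nat \<Rightarrow> int" where
  "rel_string m i = (if i = m then 1 else if m < i \<and> i \<le> m + d then -1 else 0)"

lemma rel_string_sum:
  assumes "m + d < N"
  shows "(\<Sum>i<N. rel_string m i * q ^ (i + 1)) = 0"
proof -
  have "(\<Sum>i<N. rel_string m i * q ^ (i + 1)) = (\<Sum>i\<in>{m..m+d}. rel_string m i * q ^ (i + 1))"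
    by (rule sum.mono_neutral_right) (use assms in \<open>auto simp: rel_string_def\<close>)
  also have "\<dots> = q ^ (m + 1) + (\<Sum>i=m+1..m+d. rel_string m i * q ^ (i + 1))"
    by (subst sum.atLeast_Suc_atMost) (auto simp: rel_string_def)
  also have "(\<Sum>i=m+1..m+d. rel_string m i * q ^ (i + 1)) = - (\<Sum>i=m+1..m+d. q ^ (i + 1))"
    unfolding sum_negf[symmetric] by (rule sum.cong) (auto simp: rel_string_def)
  also have "(\<Sum>i=m+1..m+d. q ^ (i + 1)) = (\<Sum>i=1..d. q ^ (m + 1 + i))"
    by (rule sum.reindex_bij_witness[of _ "\<lambda>i. m + i" "\<lambda>i. i - m"]) auto
  finally show ?thesis by (simp only: q_sum_Suc)
qed

lemma string_of_add_rel:
  assumes "string_of x N e" "\<And>i. e' i = e i + t * rel_string m i" "\<And>i. e' i \<in> {-1, 0, 1}"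
  shows "string_of x (N + m + d + 1) e'"
proof -
  have *: "string_of x (N + m + d + 1) e" using string_of_extend[OF assms(1)] by simp
  have "(\<Sum>i<N + m + d + 1. e' i * q ^ (i + 1)) = (\<Sum>i<N + m + d + 1. e i * q ^ (i + 1))
      + t * (\<Sum>i<N + m + d + 1. rel_string m i * q ^ (i + 1))"
    by (simp add: assms(2) algebra_simps sum.distrib sum_distrib_left)
  then show ?thesis using * assms(3) rel_string_sum[of m "N + m + d + 1"]
    by (auto simp: string_of_def assms(2)[of "_ :: nat"] rel_string_def)
qed


lemma mset_set_lenlexI:
  assumes "finite A" "finite B" "card A < card B \<or> card A = card B \<and> p \<in> A \<and> p \<notin> B \<and>
    (\<forall>i<p. i \<in> A \<longleftrightarrow> i \<in> B)"
  shows "(mset_set A, mset_set B) \<in> mset_lenlex"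
  using assms by (auto simp: mset_lenlex_def count_mset_set' intro!: exI[of _ p])

text \<open>A window that violates sparseness can be shortened by adding a multiple of \<open>rel_string\<close>, unless
  it is the first one; then the string represents too large a number.\<close>

lemma minimal_string_sparse:
  assumes d3: "d \<ge> 3" and bound: "\<bar>x\<bar> \<le> 1 / 2 + 1 / (2 * (\<beta> + 1))"
    and e: "string_of x N e"
    and min: "\<And>M e'. string_of x M e' \<Longrightarrow> (mset_set {i. e' i \<noteq> 0}, mset_set {i. e i \<noteq> 0}) \<notin> mset_lenlex"
  shows "sparse_runs e"
proof (rule ccontr)
  define viol where "viol j k t \<longleftrightarrow> t \<noteq> 0 \<and> k \<le> d \<and>
     (\<forall>i\<le>d. i \<noteq> k \<longrightarrow> e (j + i) = t) \<and> e (j + k) \<noteq> - t" for j k and t :: int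
  assume "\<not> sparse_runs e"
  then have "\<exists>j k t. viol j k t" by (auto simp: sparse_runs_def viol_def)
  define j where "j = (LEAST j. \<exists>k t. viol j k t)"
  obtain k t where viol: "viol j k t"
    using LeastI_ex[OF \<open>\<exists>j k t. viol j k t\<close>] by (auto simp: j_def)
  have least: "\<not> viol j' k' t'" if "j' < j" for j' k' t'
    using not_less_Least[of j' "\<lambda>j. \<exists>k t. viol j k t"] that by (auto simp: j_def)
  have vals: "e i \<in> {-1, 0, 1}" for i using e by (simp add: string_of_def)
  have fin: "finite {i. e i \<noteq> 0}"
    by (rule finite_subset[of _ "{..<N}"]) (use e in \<open>auto simp: string_of_def not_less[symmetric]\<close>)
  have t0: "t \<noteq> 0" and k: "k \<le> d" and run: "\<And>i. i \<le> d \<Longrightarrow> i \<noteq> k \<Longrightarrow> e (j + i) = t"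
    and ek: "e (j + k) \<noteq> - t" using viol by (auto simp: viol_def)
  have t: "t \<in> {-1, 1}"
  proof -
    have "0 \<noteq> k \<or> 1 \<noteq> k" by auto
    then show ?thesis using run[of 0] run[of 1] d2 vals[of j] vals[of "j+1"] t0 by auto
  qed
  define S where "S = {i. e i \<noteq> 0}"
  \<comment> \<open>A change that clears the places in \<open>W\<close> and creates nonzero entries
    only in a smaller set \<open>A\<close> contradicts minimality already by the size of the
    support.\<close>
  have no_better: False
    if e': "string_of x M e'" and sub: "{i. e' i \<noteq> 0} \<subseteq> (S - W) \<union> A" and fw: "W \<subseteq> S"
      "finite A" "card A < card W" for e' M A W
  proof -
    have fS: "finite S" using fin S_def by simp
    then have "card {i. e' i \<noteq> 0} \<le> card ((S - W) \<union> A)" using sub \<open>finite A\<close> by (intro card_mono) auto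
    also have "\<dots> \<le> card (S - W) + card A" by (rule card_Un_le)
    also have "card (S - W) = card S - card W" using fw(1) fS finite_subset by (blast intro: card_Diff_subset)
    finally have "card {i. e' i \<noteq> 0} < card S"
      using fw card_mono[OF fS fw(1)] by linarith
    moreover have "finite {i. e' i \<noteq> 0}" using sub fS \<open>finite A\<close> finite_subset by blast
    ultimately show False using min[OF e'] mset_set_lenlexI[of "{i. e' i \<noteq> 0}" "{i. e i \<noteq> 0}" 0] fin
      by (simp add: S_def)
  qed
  \<comment> \<open>The relation started at \<open>j - 1\<close> clears \<open>d\<close> entries and
    alters only the one before them, which stays within {-1, 0, 1} because it differs from
    \<open>t\<close>.\<close>
  have full: False if "j \<noteq> 0" "e (j - 1) \<noteq> t" "\<forall>i<d. e (j + i) = t"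
  proof (rule no_better)
    define e' where "e' i = e i + t * rel_string (j - 1) i" for i
    have e'_eq: "e' i = (if i = j - 1 then e i + t else if j \<le> i \<and> i < j + d then 0 else e i)" for i
    proof (cases "j \<le> i \<and> i < j + d")
      case True
      then have "e i = t" using that(3)[rule_format, of "i - j"] by auto
      then show ?thesis using True that(1) by (auto simp: e'_def rel_string_def)
    qed (use that(1) in \<open>auto simp: e'_def rel_string_def\<close>)
    have v: "e (j - 1) + t \<in> {-1, 0, 1}" using vals[of "j - 1"] that(2) t by auto
    show "string_of x (N + (j - 1) + d + 1) e'"
    proof (rule string_of_add_rel[OF e e'_def])
      show "e' i \<in> {-1, 0, 1}" for i unfolding e'_eq using v vals[of i] by auto
    qed
    show "{i. e' i \<noteq> 0} \<subseteq> (S - {j..<j+d}) \<union> {j - 1}" by (auto simp: e'_eq S_def split: if_splits)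
    show "{j..<j+d} \<subseteq> S"
    proof
      fix i assume "i \<in> {j..<j+d}"
      then have "e (j + (i - j)) = t" using that(3)[rule_format, of "i - j"] by auto
      then show "i \<in> S" using t0 \<open>i \<in> {j..<j+d}\<close> by (auto simp: S_def)
    qed
  qed (use d2 in auto)
  show False
  proof (cases "k = 0 \<and> e j = 0")
    case True
    show ?thesis
    proof (rule no_better)
      define e' where "e' i = e i + t * rel_string j i" for i
      have e'_eq: "e' i = (if i = j then t else if j < i \<and> i \<le> j + d then 0 else e i)" for i
      proof (cases "j < i \<and> i \<le> j + d")
        case T: True
        then have "e i = t" using run[of "i - j"] True by auto
        then show ?thesis using T by (auto simp: e'_def rel_string_def)
      qed (use True in \<open>auto simp: e'_def rel_string_def\<close>)
      show "string_of x (N + j + d + 1) e'"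
      proof (rule string_of_add_rel[OF e e'_def])
        show "e' i \<in> {-1, 0, 1}" for i unfolding e'_eq using t vals[of i] by auto
      qed
      show "{i. e' i \<noteq> 0} \<subseteq> (S - {j<..j+d}) \<union> {j}" by (auto simp: e'_eq S_def split: if_splits)
      show "{j<..j+d} \<subseteq> S"
      proof
        fix i assume "i \<in> {j<..j+d}"
        then have "e (j + (i - j)) = t" using run[of "i - j"] True by auto
        then show "i \<in> S" using t0 \<open>i \<in> {j<..j+d}\<close> by (auto simp: S_def)
      qed
    qed (use d2 in auto)
  next
    case False
    \<comment> \<open>The exceptional place can be taken positive: it is the zero of the window or,
      if all entries equal \<open>t\<close>, the last place \<open>d\<close>.\<close>
    obtain k' where k': "1 \<le> k'" "k' \<le> d" "\<And>i. i \<le> d \<Longrightarrow> i \<noteq> k' \<Longrightarrow> e (j + i) = t"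
      "e (j + k') = 0 \<or> k' = d" "e (j + k') \<noteq> - t"
    proof (cases "e (j + k) = 0")
      case True
      have "k \<noteq> 0"
      proof
        assume "k = 0"
        then show False using True False by simp
      qed
      then show ?thesis by (intro that[of k]) (use True k run ek in auto)
    next
      case nz: False
      then have "e (j + k) = t" using ek t vals[of "j + k"] by auto
      then have all: "e (j + i) = t" if "i \<le> d" for i using run[OF that] by (cases "i = k") auto
      show ?thesis by (rule that[of d]) (use all d2 t0 in auto)
    qed
    \<comment> \<open>No relation can start to the left of place 0. There the numerical bound
      excludes the window.\<close>
    have j0: "j \<noteq> 0"
    proof
      assume "j = 0"
      then show False
        using coupling_bound_d3(2)[OF d3 e bound t, of k'] k' by auto
    qed
    \<comment> \<open>Otherwise the window shifted by one place to the left would violate sparseness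
      as well, against the choice of \<open>j\<close>.\<close>
    have prev: "e (j - 1) \<noteq> t"
    proof
      assume p: "e (j - 1) = t"
      show False
      proof (cases "k' = d")
        case True
        have "viol (j - 1) d t"
          unfolding viol_def
        proof (intro conjI allI impI)
          show "e (j - 1 + i) = t" if "i \<le> d" "i \<noteq> d" for i
            using that p k'(3)[of "i - 1"] True j0 by (cases i) auto
          have "e (j + (d - 1)) = t" using k'(3)[of "d - 1"] True d2 by auto
          then show "e (j - 1 + d) \<noteq> - t" using t0 j0 d2 by (simp add: algebra_simps)
        qed (use t0 in auto)
        then show ?thesis using least[of "j - 1"] j0 by auto
      next
        case False
        then have ek': "e (j + k') = 0" using k'(4) by simp
        have "viol (j - 1) (k' + 1) t"
          unfolding viol_def
        proof (intro conjI allI impI)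
          show "e (j - 1 + i) = t" if "i \<le> d" "i \<noteq> k' + 1" for i
            using that p k'(3)[of "i - 1"] j0 by (cases i) auto
          show "e (j - 1 + (k' + 1)) \<noteq> - t" using ek' t0 j0 by simp
        qed (use t0 k'(2) False in auto)
        then show ?thesis using least[of "j - 1"] j0 by auto
      qed
    qed
    show ?thesis
    proof (cases "k' = d")
      case True
      then show ?thesis using full[OF j0 prev] k'(3) by auto
    next
      case kd: False
      then have ek': "e (j + k') = 0" and kd': "k' < d" using k'(2,4) by auto
      define e' where "e' i = e i + t * rel_string (j - 1) i" for i
      have e'_eq: "e' i = (if i = j - 1 then e i + t else if i = j + k' then - t
          else if j \<le> i \<and> i < j + d then 0 else e i)" for i
      proof -
        have r: "rel_string (j - 1) i = (if i = j - 1 then 1 else if j \<le> i \<and> i < j + d then -1 else 0)"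
          using j0 by (auto simp: rel_string_def)
        consider "i = j - 1" | "i = j + k'" | "j \<le> i" "i < j + d" "i \<noteq> j + k'" | "i < j - 1 \<or> j + d \<le> i"
          by linarith
        then show ?thesis
        proof cases
          case 1
          then show ?thesis unfolding e'_def r by simp
        next
          case 2
          then show ?thesis unfolding e'_def r using j0 ek' kd' by simp
        next
          case 3
          then have "e i = t" using k'(3)[of "i - j"] by auto
          then show ?thesis unfolding e'_def r using 3 j0 by auto
        next
          case 4
          then show ?thesis unfolding e'_def r using kd' j0 by auto
        qed
      qed
      have v: "e (j - 1) + t \<in> {-1, 0, 1}" using vals[of "j - 1"] prev t by auto
      have e'_str: "string_of x (N + (j - 1) + d + 1) e'"
      proof (rule string_of_add_rel[OF e e'_def])
        show "e' i \<in> {-1, 0, 1}" for i unfolding e'_eq using v t vals[of i] by auto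
      qed
      define W where "W = {j..<j+d} - {j + k'}"
      have WS: "W \<subseteq> S"
      proof
        fix i assume i: "i \<in> W"
        then have "e (j + (i - j)) = t" using k'(3)[of "i - j"] by (auto simp: W_def)
        then show "i \<in> S" using t0 i by (auto simp: S_def W_def)
      qed
      have cW: "card W = d - 1" using kd' by (simp add: W_def)
      have fW: "finite W" by (simp add: W_def)
      show ?thesis
      proof (cases "e (j - 1) = 0")
        case prev0: False
        then have pt: "e (j - 1) = - t" using vals[of "j - 1"] t prev by auto
        show ?thesis
        proof (rule no_better[OF e'_str])
          show "{i. e' i \<noteq> 0} \<subseteq> (S - insert (j - 1) W) \<union> {j + k'}"
            using pt j0 by (auto simp: e'_eq S_def W_def split: if_splits)
          show "insert (j - 1) W \<subseteq> S" using WS prev0 by (auto simp: S_def)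
          have "j - 1 \<notin> W" using j0 by (auto simp: W_def)
          then show "card {j + k'} < card (insert (j - 1) W)" using cW fW d2 by simp
        qed simp
      next
        \<comment> \<open>Here \<open>d - 1\<close> entries disappear and two appear, at
          \<open>j - 1\<close> and at the former zero \<open>j + k'\<close>. As
          \<open>d \<ge> 3\<close>, the size does not grow, and in case of a tie the new entry at
          \<open>j - 1\<close> decides the lexicographic comparison.\<close>
        case prev0: True
        have supp: "{i. e' i \<noteq> 0} = (S - W) \<union> {j - 1, j + k'}"
          using t0 j0 prev0 by (auto simp: e'_eq S_def W_def split: if_splits)
        have "card ((S - W) \<union> {j - 1, j + k'}) \<le> card (S - W) + 2"
          by (rule order_trans[OF card_Un_le]) (simp add: card_insert_if)
        moreover have "card (S - W) = card S - card W" by (rule card_Diff_subset[OF fW WS])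
        moreover have "card W \<le> card S" using WS fin by (intro card_mono) (auto simp: S_def)
        ultimately have "card {i. e' i \<noteq> 0} \<le> card S" using d3 cW unfolding supp by linarith
        moreover have "finite {i. e' i \<noteq> 0}" unfolding supp using fin by (simp add: S_def)
        moreover have "i \<in> {i. e' i \<noteq> 0} \<longleftrightarrow> i \<in> S" if "i < j - 1" for i
          using that by (auto simp: e'_eq S_def)
        moreover have "e' (j - 1) \<noteq> 0" "j - 1 \<notin> S" using prev0 t0 by (auto simp: e'_eq S_def)
        ultimately have "(mset_set {i. e' i \<noteq> 0}, mset_set S) \<in> mset_lenlex"
          using fin by (intro mset_set_lenlexI[of _ _ "j - 1"]) (auto simp: S_def)
        then show ?thesis using min[OF e'_str] by (simp add: S_def)
      qed
    qed
  qed
qed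

lemma string_of_01:
  assumes "finite S"
  obtains N where "string_of (\<Sum>i\<in>S. q ^ (i+1)) N (\<lambda>i. of_bool (i \<in> S))"
proof -
  obtain N where N: "S \<subseteq> {..<N}" using assms finite_nat_bounded by blast
  have "(\<Sum>i\<in>S. q ^ (i+1)) = (\<Sum>i<N. of_int (of_bool (i \<in> S)) * q ^ (i+1))"
  proof -
    have "(\<Sum>i<N. of_int (of_bool (i \<in> S)) * q ^ (i+1)) = (\<Sum>i<N. if i \<in> S then q ^ (i+1) else 0)"
      by (rule sum.cong) auto
    then show ?thesis using N by (simp add: sum.If_cases Int_absorb1)
  qed
  then show ?thesis using N by (intro that[of N]) (auto simp: string_of_def)
qed

text \<open>Among all strings of \<open>x\<close>, of which there is one by
  \<open>Zb_finite_01_expansion\<close>, take one whose support is minimal for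
  \<open>mset_lenlex\<close>. The condition on the first \<open>d\<close> entries is again a matter
  of size.\<close>

lemma sparse_string_d3:
  assumes d3: "d \<ge> 3" and bound: "\<bar>x\<bar> \<le> 1 / 2 + 1 / (2 * (\<beta> + 1))" and "x \<in> int_adjoin \<beta>" "0 \<le> x"
  shows "\<exists>N e. string_of x N e \<and> sparse_runs e \<and> (\<forall>t. t \<noteq> 0 \<longrightarrow> \<not> (\<forall>i<d. e i = t))"
proof -
  have "1 / (2 * (\<beta> + 1)) < 1 / 2" using b1 by (simp add: field_simps)
  then have "x < 1" using bound by linarith
  then obtain S where S: "finite S" "x = (\<Sum>i\<in>S. q ^ (i+1))"
    by (rule Zb_finite_01_expansion[OF assms(3,4)])
  define Q where "Q = {mset_set {i. e i \<noteq> 0} | e M. string_of x M e}"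
  obtain N where "string_of x N (\<lambda>i. of_bool (i \<in> S))"
    unfolding S(2) by (rule string_of_01[OF S(1)])
  then have "\<exists>A. A \<in> Q" unfolding Q_def by blast
  then obtain A where A: "A \<in> Q" "\<And>B. (B, A) \<in> mset_lenlex \<Longrightarrow> B \<notin> Q"
    using wfE_min[OF wf_mset_lenlex] by metis
  obtain e N where e: "string_of x N e" "A = mset_set {i. e i \<noteq> 0}" using A(1) by (auto simp: Q_def)
  have "sparse_runs e"
    using A(2) by (intro minimal_string_sparse[OF d3 bound e(1)]) (auto simp: Q_def e(2))
  moreover have "\<not> (\<forall>i<d. e i = t)" if "t \<noteq> 0" for t
  proof
    assume *: "\<forall>i<d. e i = t"
    then have "t \<in> {-1, 1}" using that e(1) d2 by (auto simp: string_of_def)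
      (metis less_le_trans zero_less_numeral)
    then show False using coupling_bound_d3(1)[OF d3 e(1) bound] * by blast
  qed
  ultimately show ?thesis using e(1) by blast
qed


section \<open>The golden case \<open>d = 2\<close>\<close>

lemma of_bool_shift_sum:
  assumes "S \<subseteq> {..<N}"
  shows "(\<Sum>i<Suc N. (of_bool (i \<in> S) - of_bool (i \<noteq> 0 \<and> i - 1 \<in> S)) * q ^ (i+1))
    = (1 - q) * (\<Sum>i\<in>S. q ^ (i+1))"
proof -
  have S: "(\<Sum>i\<in>S. q ^ (i+1)) = (\<Sum>i<N. of_bool (i \<in> S) * q ^ (i+1))"
  proof -
    have "(\<Sum>i<N. of_bool (i \<in> S) * q ^ (i+1)) = (\<Sum>i<N. if i \<in> S then q ^ (i+1) else 0)"
      by (rule sum.cong) auto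
    then show ?thesis using assms by (simp add: sum.If_cases Int_absorb1)
  qed
  have "N \<notin> S" using assms by auto
  then have 1: "(\<Sum>i<Suc N. of_bool (i \<in> S) * q ^ (i+1)) = (\<Sum>i\<in>S. q ^ (i+1))"
    unfolding S by simp
  have 2: "(\<Sum>i<Suc N. of_bool (i \<noteq> 0 \<and> i - 1 \<in> S) * q ^ (i+1)) = q * (\<Sum>i\<in>S. q ^ (i+1))"
    unfolding S by (subst sum.lessThan_Suc_shift) (simp add: sum_distrib_left mult_ac)
  show ?thesis
    using 1 2 by (simp only: left_diff_distrib sum_subtractf mult_1_left)
qed

text \<open>For \<open>d = 2\<close> a string whose nonzero entries alternate in sign is sparse; such a string is
  the sequence of increments of a 0/1-sequence \<open>s\<close>.\<close>

lemma sparse_runs_increments: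
  assumes d: "d = 2" and s: "\<And>i. s i \<in> {0, 1::int}" and e: "\<And>i. i \<ge> m \<Longrightarrow> e i = s (i + 1) - s i"
    and m: "m = 0 \<or> m = 1 \<and> e 1 = 0 \<and> e 2 = 0"
  shows "sparse_runs e \<and> (\<forall>t. t \<noteq> 0 \<longrightarrow> \<not> (\<forall>i<d. e i = t))"
proof -
  have no2: False if "i \<ge> m" "e i = t" "e (i + 1) = t" "t \<noteq> 0" for i t
    using that e[of i] e[of "i+1"] s[of i] s[of "i+1"] s[of "i+2"] by auto
  have no3: False if "i \<ge> m" "e i = t" "e (i + 2) = t" "t \<noteq> 0" "e (i + 1) \<noteq> - t" for i t
    using that e[of i] e[of "i+1"] e[of "i+2"] s[of i] s[of "i+1"] s[of "i+2"] s[of "i+3"]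
    by (auto simp: numeral_3_eq_3)
  have key: "e (j + k) = - t" if t: "t \<noteq> 0" and k: "k \<le> 2" and r: "\<forall>i\<le>2. i \<noteq> k \<longrightarrow> e (j + i) = t" for j k t
  proof (rule ccontr)
    assume nk: "e (j + k) \<noteq> - t"
    consider "k = 0" | "k = 1" | "k = 2" using k by linarith
    note k_cases = this
    show False
    proof (cases "j \<ge> m")
      case True
      from k_cases show False
      proof cases
        case 1
        then show ?thesis using no2[of "j+1" t] r[rule_format, of 1] r[rule_format, of 2] t True by auto
      next
        case 2
        then show ?thesis using no3[of j t] r[rule_format, of 0] r[rule_format, of 2] t True nk by auto
      next
        case 3
        then show ?thesis using no2[of j t] r[rule_format, of 0] r[rule_format, of 1] t True by auto
      qed
    next
      case False
      \<comment> \<open>Only the window at 0 contains the entry \<open>e 0\<close>, which need not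
        be an increment. Of the other two entries, both 0, at least one would have to equal
        \<open>t\<close>.\<close>
      then have "j = 0" "e 1 = 0" "e 2 = 0" using m by auto
      with k_cases show False
        using r[rule_format, of 1] r[rule_format, of 2] t by cases (auto simp: numeral_2_eq_2)
    qed
  qed
  have "sparse_runs e"
    unfolding sparse_runs_def
  proof (intro allI impI)
    show "e (j + k) = - t" if "t \<noteq> 0" "k \<le> d" "\<forall>i\<le>d. i \<noteq> k \<longrightarrow> e (j + i) = t" for j k t
      using key[of t k j] that d by simp
  qed
  moreover have "\<not> (\<forall>i<d. e i = t)" if t: "t \<noteq> 0" for t
  proof
    assume "\<forall>i<d. e i = t"
    from this[rule_format, of 0] this[rule_format, of 1] have "e 0 = t" "e 1 = t"
      using d by simp_all
    then show False using m no2[of 0 t] t by (metis add_0 le_refl)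
  qed
  ultimately show ?thesis by blast
qed

lemma golden: "d = 2 \<Longrightarrow> q ^ 2 = 1 - q"
  using q_sum by (simp add: numeral_2_eq_2)

lemma golden_bounds:
  assumes "d = 2" shows "q > 618 / 1000" "q < 6181 / 10000"
proof -
  have g: "q * q = 1 - q" using golden[OF assms] by (simp add: power2_eq_square)
  show "q > 618 / 1000"
  proof (rule ccontr)
    assume "\<not> ?thesis"
    then have "q * q \<le> (618 / 1000) * (618 / 1000)" using q_pos by (intro mult_mono) auto
    then show False using g \<open>\<not> q > 618 / 1000\<close> by simp
  qed
  show "q < 6181 / 10000"
  proof (rule ccontr)
    assume "\<not> ?thesis"
    then have "q * q \<ge> (6181 / 10000) * (6181 / 10000)" using q_pos by (intro mult_mono) auto
    then show False using g \<open>\<not> q < 6181 / 10000\<close> by simp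
  qed
qed

text \<open>If \<open>y < 1 - q = q ^ 2\<close>, then \<open>\<beta> ^ 2 * y\<close> has a 0/1
  expansion, and multiplying it by \<open>1 - q\<close> subtracts its own shift. So \<open>y\<close>
  is represented by the increments of a 0/1 sequence, which is sparse by
  \<open>sparse_runs_increments\<close>. Larger \<open>x\<close> are reduced to this by the single
  digit \<open>q\<close>.\<close>

lemma sparse_string_d2:
  assumes d: "d = 2" and bound: "\<bar>x\<bar> \<le> 1 / 2 + 1 / (2 * (\<beta> + 1))" and "x \<in> int_adjoin \<beta>" "0 \<le> x"
  shows "\<exists>N e. string_of x N e \<and> sparse_runs e \<and> (\<forall>t. t \<noteq> 0 \<longrightarrow> \<not> (\<forall>i<d. e i = t))"
proof -
  note g = golden_bounds[OF d]
  have qq: "q * q = 1 - q" using golden[OF d] by (simp add: power2_eq_square)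

  have "1 / (2 * (\<beta> + 1)) = q / (1 + q) / 2" using beta_inverse by (metis divide_divide_eq_left mult.commute)
  also have "q / (1 + q) < 383 / 1000" using g by (simp add: field_simps)
  finally have x: "x < 692 / 1000" using bound by simp
  have Zb: "\<beta> ^ 2 * y \<in> int_adjoin \<beta>" if "y \<in> int_adjoin \<beta>" for y using that by simp
  have b2: "\<beta> ^ 2 * (1 - q) = 1" using beta_pow_q[of 2] golden[OF d] by simp
  have scale: "y < c \<longleftrightarrow> \<beta> ^ 2 * y < \<beta> ^ 2 * c" for y c using b1 by simp
  have expand: "\<exists>S. finite S \<and> y = (1 - q) * (\<Sum>i\<in>S. q ^ (i+1))"
    if y: "y \<in> int_adjoin \<beta>" "0 \<le> y" "y < 1 - q" for y
  proof -
    have "\<beta> ^ 2 * y < 1" using y(3) b2 scale[of y "1 - q"] by simp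
    then obtain S where "finite S" "\<beta> ^ 2 * y = (\<Sum>i\<in>S. q ^ (i+1))"
      using Zb_finite_01_expansion[OF Zb[OF y(1)]] y(2) by (metis mult_nonneg_nonneg zero_le_power2)
    moreover have "y = (1 - q) * (\<beta> ^ 2 * y)" using b2 by (simp add: mult_ac)
    ultimately show ?thesis by metis
  qed
  have notin: "k \<notin> S" if "finite S" "y = (1 - q) * (\<Sum>i\<in>S. q ^ (i+1))" "y < (1 - q) * q ^ (k+1)" for S k y
  proof
    assume "k \<in> S"
    then have "q ^ (k+1) \<le> (\<Sum>i\<in>S. q ^ (i+1))" using that(1) q_pos by (intro member_le_sum) auto
    then have "(1 - q) * q ^ (k+1) \<le> y" using that(2) q_lt1 by (simp only: that(2)) (intro mult_left_mono; simp)
    then show False using that(3) by simp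
  qed
  define a :: "nat set \<Rightarrow> nat \<Rightarrow> int" where
    "a S i = of_bool (i \<in> S) - of_bool (i \<noteq> 0 \<and> i - 1 \<in> S)" for S i
  have a_str: "\<exists>N. (\<forall>i\<ge>Suc N. a S i = 0) \<and> (1 - q) * (\<Sum>i\<in>S. q ^ (i+1)) = (\<Sum>i<Suc N. a S i * q ^ (i + 1))"
    if fS: "finite S" for S
  proof -
    obtain N where N: "S \<subseteq> {..<N}" using fS finite_nat_bounded by blast
    show ?thesis
      using N of_bool_shift_sum[OF N] by (intro exI[of _ N]) (auto simp: a_def)
  qed
  have a_val: "a S i \<in> {-1, 0, 1}" for S i by (auto simp: a_def)
  \<comment> \<open>These are the ranges in which \<open>x\<close> itself, the digit
    \<open>q ^ 2\<close>, \<open>q - x\<close> and \<open>x - q\<close> can be used. In the last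
    two, \<open>S\<close> must omit its first indices so that the digit for \<open>q\<close> fits in
    front.\<close>
  consider "x < 1 - q" | "x = 1 - q" | "1 - q < x" "x < q" | "q \<le> x" by linarith
  then show ?thesis
  proof cases
    case 1
    then obtain S where S: "finite S" "x = (1 - q) * (\<Sum>i\<in>S. q ^ (i+1))"
      using expand assms(3,4) by blast
    obtain N where N: "\<forall>i\<ge>Suc N. a S i = 0" "x = (\<Sum>i<Suc N. a S i * q ^ (i + 1))"
      using a_str[OF S(1)] S(2) by metis
    have "string_of x (Suc N) (a S)" using N a_val by (simp add: string_of_def)
    moreover have "sparse_runs (a S) \<and> (\<forall>t. t \<noteq> 0 \<longrightarrow> \<not> (\<forall>i<d. a S i = t))"
      by (rule sparse_runs_increments[OF d, of "\<lambda>i. of_bool (i \<noteq> 0 \<and> i - 1 \<in> S)" 0]) (auto simp: a_def)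
    ultimately show ?thesis by blast
  next
    case 2
    define e where "e = (\<lambda>i::nat. of_bool (i = 1) :: int)"
    have "string_of x 2 e" using golden[OF d] by (auto simp: string_of_def e_def 2 numeral_2_eq_2)
    moreover have "sparse_runs e \<and> (\<forall>t. t \<noteq> 0 \<longrightarrow> \<not> (\<forall>i<d. e i = t))"
      by (rule sparse_runs_increments[OF d, of "\<lambda>i. of_bool (i \<ge> 2)" 0]) (auto simp: e_def)
    ultimately show ?thesis by blast
  next
    case 3
    have "q - x < 1 - q" "0 \<le> q - x" using 3 g by auto
    then obtain S where S: "finite S" "q - x = (1 - q) * (\<Sum>i\<in>S. q ^ (i+1))"
      using expand[of "q - x"] assms(3) by auto
    have "(1 - q) * q ^ (0 + 1) = q - (1 - q)" using qq by (simp add: algebra_simps)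
    then have S0: "0 \<notin> S" using notin[OF S, of 0] 3(1) by linarith
    obtain N where N: "\<forall>i\<ge>Suc N. a S i = 0" "q - x = (\<Sum>i<Suc N. a S i * q ^ (i + 1))"
      using a_str[OF S(1)] S(2) by metis
    define e where "e i = of_bool (i = 0) - a S i" for i
    have "(\<Sum>i<Suc N. e i * q ^ (i + 1)) = (\<Sum>i<Suc N. of_bool (i = 0) * q ^ (i + 1)) - (q - x)"
      unfolding N(2) e_def sum_subtractf[symmetric] by (rule sum.cong) (auto simp: algebra_simps)
    also have "(\<Sum>i<Suc N. of_bool (i = 0) * q ^ (i + 1)) = q"
      by (subst sum.lessThan_Suc_shift) simp
    finally have "string_of x (Suc N) e" using N(1) a_val S0
      by (auto simp: string_of_def e_def a_def)
    moreover have "sparse_runs e \<and> (\<forall>t. t \<noteq> 0 \<longrightarrow> \<not> (\<forall>i<d. e i = t))"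
      by (rule sparse_runs_increments[OF d, of "\<lambda>i. of_bool (i \<noteq> 0 \<and> i - 1 \<notin> S)" 0])
        (use S0 in \<open>auto simp: e_def a_def\<close>)
    ultimately show ?thesis by blast
  next
    case 4
    have r: "x - q < 74 / 1000" using x g by linarith
    then have "x - q < 1 - q" "0 \<le> x - q" using 4 g by auto
    then obtain S where S: "finite S" "x - q = (1 - q) * (\<Sum>i\<in>S. q ^ (i+1))"
      using expand[of "x - q"] assms(3) by auto
    \<comment> \<open>0.074 is the bound 0.692 for \<open>x\<close> minus the bound 0.618 for
      \<open>q\<close>. Thus \<open>S\<close> omits 0, 1 and 2, which yields the two zeros after the
      leading 1 that \<open>sparse_runs_increments\<close> wants for \<open>m = 1\<close>.\<close>
    have small: "74 / 1000 < (1 - q) * q ^ (k + 1)" if "k \<le> 2" for k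
    proof -
      have "(1 - q) * q ^ 3 \<le> (1 - q) * q ^ (k + 1)"
        using that q_pos q_lt1 by (intro mult_left_mono power_decreasing) auto
      moreover have "(381 / 1000) * (618 / 1000) ^ 3 \<le> (1 - q) * q ^ 3"
        using g by (intro mult_mono power_mono) auto
      ultimately show ?thesis by (simp add: power3_eq_cube)
    qed
    have S012: "k \<notin> S" if "k \<le> 2" for k using notin[OF S, of k] small[OF that] r by linarith
    obtain N where N: "\<forall>i\<ge>Suc N. a S i = 0" "x - q = (\<Sum>i<Suc N. a S i * q ^ (i + 1))"
      using a_str[OF S(1)] S(2) by metis
    define e where "e i = of_bool (i = 0) + a S i" for i
    have "(\<Sum>i<Suc N. e i * q ^ (i + 1)) = (\<Sum>i<Suc N. of_bool (i = 0) * q ^ (i + 1)) + (x - q)"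
      unfolding N(2) e_def sum.distrib[symmetric] by (rule sum.cong) (auto simp: algebra_simps)
    also have "(\<Sum>i<Suc N. of_bool (i = 0) * q ^ (i + 1)) = q"
      by (subst sum.lessThan_Suc_shift) simp
    finally have "string_of x (Suc N) e" using N(1) a_val S012[of 0]
      by (auto simp: string_of_def e_def a_def)
    moreover have "sparse_runs e \<and> (\<forall>t. t \<noteq> 0 \<longrightarrow> \<not> (\<forall>i<d. e i = t))"
      by (rule sparse_runs_increments[OF d, of "\<lambda>i. of_bool (i \<noteq> 0 \<and> i - 1 \<in> S)" 1])
        (use S012[of 0] S012[of 1] S012[of 2] in \<open>auto simp: e_def a_def\<close>)
    ultimately show ?thesis by blast
  qed
qed

lemma sparse_string_exists:
  assumes bound: "\<bar>x\<bar> \<le> 1 / 2 + 1 / (2 * (\<beta> + 1))" and Z: "x \<in> int_adjoin \<beta>"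
  shows "\<exists>N e. string_of x N e \<and> sparse_runs e \<and> (\<forall>t. t \<noteq> 0 \<longrightarrow> \<not> (\<forall>i<d. e i = t))"
proof -
  have pos: "\<exists>N e. string_of y N e \<and> sparse_runs e \<and> (\<forall>t. t \<noteq> 0 \<longrightarrow> \<not> (\<forall>i<d. e i = t))"
    if y: "\<bar>y\<bar> \<le> 1 / 2 + 1 / (2 * (\<beta> + 1))" "y \<in> int_adjoin \<beta>" "0 \<le> y" for y
  proof (cases "d = 2")
    case True
    then show ?thesis using sparse_string_d2 y by blast
  next
    case False
    then have "d \<ge> 3" using d2 by simp
    then show ?thesis using sparse_string_d3[OF _ y] by blast
  qed
  show ?thesis
  proof (cases "0 \<le> x")
    case True
    then show ?thesis using pos bound Z by blast
  next
    case False
    then obtain N e where "string_of (- x) N e" "sparse_runs e" "\<forall>t. t \<noteq> 0 \<longrightarrow> \<not> (\<forall>i<d. e i = t)"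
      using pos[of "- x"] bound Z by auto
    then show ?thesis
      using string_of_uminus[of "- x" N e] sparse_runs_uminus[of e]
      by (intro exI[of _ N] exI[of _ "\<lambda>i. - e i"]) (auto, metis minus_equation_iff neg_0_equal_iff_equal)
  qed
qed


text \<open>The zeros of a sparse string are filled alternately with \<open>x\<close> and \<open>\<not> x\<close>; \<open>s\<close> is the sign
  at which a nonzero entry is turned into the digit 1.\<close>

lemma alternating_fill_runs:
  fixes e :: "nat \<Rightarrow> int" and b :: "nat \<Rightarrow> bool"
  assumes sp: "sparse_runs e" and vals: "\<And>i. e i \<in> {-1, 0, 1}" and s: "s \<in> {-1, 1}"
    and start: "\<And>t. t \<noteq> 0 \<Longrightarrow> \<not> (\<forall>i<d. e i = t)"
    and b0: "\<And>i. e i = 0 \<Longrightarrow> b i = (x \<noteq> odd (card {k. k < i \<and> e k = 0}))"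
    and b1: "\<And>i. e i \<noteq> 0 \<Longrightarrow> b i = (e i = s)"
  shows "\<exists>i\<le>d. b (j + i) \<noteq> a" and "\<exists>i<d. b i = x"
proof -
  define z where "z i = card {k. k < i \<and> e k = 0}" for i
  have et: "e i = (if b i then s else - s)" if "e i \<noteq> 0" for i
    using b1[OF that] vals[of i] s that by auto
  show "\<exists>i\<le>d. b (j + i) \<noteq> a"
  proof (rule ccontr)
    assume "\<not> ?thesis"
    then have all: "b (j + i) = a" if "i \<le> d" for i using that by blast
    define t where "t = (if a then s else - s)"
    have t0: "t \<noteq> 0" using s by (auto simp: t_def)
    have et': "e (j + i) = t" if "i \<le> d" "e (j + i) \<noteq> 0" for i
      using et[OF that(2)] all[OF that(1)] by (simp add: t_def)
    \<comment> \<open>Consecutive zeros are filled with different digits, so a constant window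
      contains at most one zero. Sparseness then forces the entry \<open>- t\<close> at that place,
      which is neither 0 nor \<open>t\<close>.\<close>
    have uniq: False if i: "i1 < i2" "i2 \<le> d" "e (j + i1) = 0" "e (j + i2) = 0" for i1 i2
    proof -
      define k where "k = (LEAST k. k > i1 \<and> e (j + k) = 0)"
      have k: "k > i1" "e (j + k) = 0" "k \<le> i2"
        using LeastI[of "\<lambda>k. k > i1 \<and> e (j + k) = 0" i2] Least_le[of "\<lambda>k. k > i1 \<and> e (j + k) = 0" i2] i
        by (auto simp: k_def)
      have "e (j + l) \<noteq> 0" if "i1 < l" "l < k" for l
        using not_less_Least[of l "\<lambda>k. k > i1 \<and> e (j + k) = 0"] that by (auto simp: k_def)
      then have nz: "e l \<noteq> 0" if "j + i1 < l" "l < j + k" for l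
        using that by (metis add_diff_inverse_nat add_lessD1 nat_add_left_cancel_less not_less_iff_gr_or_eq)
      have "{l. l < j + k \<and> e l = 0} = insert (j + i1) {l. l < j + i1 \<and> e l = 0}"
        using k(1) i(3) nz by (auto intro: ccontr simp: not_less_iff_gr_or_eq)
      then have "z (j + k) = Suc (z (j + i1))" by (simp add: z_def)
      then have "b (j + k) \<noteq> b (j + i1)" using b0[OF k(2)] b0[OF i(3)] by (simp add: z_def)
      then show False using all[of k] all[of i1] k i by simp
    qed
    obtain k where k: "k \<le> d" "\<And>i. i \<le> d \<Longrightarrow> i \<noteq> k \<Longrightarrow> e (j + i) \<noteq> 0"
    proof (cases "\<exists>k\<le>d. e (j + k) = 0")
      case True
      then obtain k where "k \<le> d" "e (j + k) = 0" by blast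
      then show ?thesis using uniq that[of k] by (metis linorder_neqE_nat)
    qed (use that[of 0] in auto)
    have "e (j + k) = - t"
      using sp[unfolded sparse_runs_def, rule_format, of t k j] t0 k et' by blast
    then show False using et'[OF k(1)] t0 by auto
  qed
  show "\<exists>i<d. b i = x"
  proof (rule ccontr)
    assume "\<not> ?thesis"
    then have all: "b i = (\<not> x)" if "i < d" for i using that by blast
    show False
    proof (cases "\<exists>i<d. e i = 0")
      case True
      then obtain k0 where k0: "k0 < d" "e k0 = 0" by blast
      define k where "k = (LEAST k. e k = 0)"
      have k: "e k = 0" "k < d" unfolding k_def
        using LeastI[of "\<lambda>k. e k = 0" k0] Least_le[of "\<lambda>k. e k = 0" k0] k0 by auto
      have "e l \<noteq> 0" if "l < k" for l using not_less_Least[of l "\<lambda>k. e k = 0"] that by (simp add: k_def)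
      then have "{l. l < k \<and> e l = 0} = {}" by auto
      then have card0: "card {l. l < k \<and> e l = 0} = 0" by (simp only: card.empty)
      have "b k = x" using b0[OF k(1)] unfolding card0 by simp
      then show False using all[OF k(2)] by simp
    next
      case False
      define t where "t = (if x then - s else s)"
      have "e i = t" if "i < d" for i using et[of i] all[OF that] False that by (auto simp: t_def)
      moreover have "t \<noteq> 0" using s by (auto simp: t_def)
      ultimately show False using start by blast
    qed
  qed
qed

text \<open>\<open>b\<close> and \<open>b'\<close> share the filling of the zeros of
  \<open>e\<close>, and they carry the digit 1 at the negative and the positive entries,
  respectively; so their difference is \<open>e\<close>. The digit \<open>x\<close> prescribes how
  the filling starts, which lets both strings follow given digits. The last clause serves the case
  in which \<open>coupling_time\<close> provides only a sign of \<delta>.\<close>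

lemma coupling_digit_strings:
  assumes "\<bar>\<delta>\<bar> \<le> 1 / 2 + 1 / (2 * (\<beta> + 1))" "\<delta> \<in> int_adjoin \<beta>"
  obtains b b' :: "nat \<Rightarrow> bool" and N where
    "\<And>i. i \<ge> N \<Longrightarrow> b i = b' i"
    "\<delta> = (\<Sum>i<N. (of_bool (b' i) - of_bool (b i)) * q ^ (i + 1))"
    "\<And>j a. \<exists>i\<le>d. b (j + i) \<noteq> a" "\<And>j a. \<exists>i\<le>d. b' (j + i) \<noteq> a"
    "\<exists>i<d. b i = x" "\<exists>i<d. b' i = x"
    "\<delta> > 0 \<and> x \<or> \<delta> < 0 \<and> \<not> x \<Longrightarrow> b' 0 = x \<and> (\<exists>i<d. b i \<noteq> x)"
proof -
  obtain N e where e: "string_of \<delta> N e" "sparse_runs e" "\<And>t. t \<noteq> 0 \<Longrightarrow> \<not> (\<forall>i<d. e i = t)"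
    using sparse_string_exists[OF assms] by blast
  have vals: "e i \<in> {-1, 0, 1}" for i using e(1) by (simp add: string_of_def)
  define f where "f i = (x \<noteq> odd (card {k. k < i \<and> e k = 0}))" for i
  define b where "b i = (if e i = 0 then f i else e i = -1)" for i
  define b' where "b' i = (if e i = 0 then f i else e i = 1)" for i
  have runs: "\<exists>i\<le>d. b (j + i) \<noteq> a" "\<exists>i<d. b i = x" "\<exists>i\<le>d. b' (j + i) \<noteq> a" "\<exists>i<d. b' i = x" for j a
    using alternating_fill_runs[OF e(2) vals _ e(3), of "-1" b x] alternating_fill_runs[OF e(2) vals _ e(3), of 1 b' x]
    by (auto simp: b_def b'_def f_def)
  have diff: "of_bool (b' i) - of_bool (b i) = real_of_int (e i)" for i
    using vals[of i] by (auto simp: b_def b'_def)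
  show ?thesis
  proof (rule that[of N b b'])
    show "b i = b' i" if "i \<ge> N" for i using e(1) that by (simp add: b_def b'_def string_of_def)
    show "\<delta> = (\<Sum>i<N. (of_bool (b' i) - of_bool (b i)) * q ^ (i + 1))"
      using e(1) by (simp add: diff string_of_def)
    have "{k. k < 1 \<and> e k = 0} = {0}" if "e 0 = 0" using that by auto
    then have f01: "f 0 = x" "e 0 = 0 \<Longrightarrow> f 1 = (\<not> x)" by (auto simp: f_def)
    have d1: "0 < d" "1 < d" using d2 by auto
    show "b' 0 = x \<and> (\<exists>i<d. b i \<noteq> x)" if "\<delta> > 0 \<and> x \<or> \<delta> < 0 \<and> \<not> x"
      using that
    proof
      assume x: "\<delta> > 0 \<and> x"
      note l = string_leading_neg[OF e(1,2) x[THEN conjunct1]]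
      have "b 0 \<noteq> x \<or> b 1 \<noteq> x" using l x vals[of 0] vals[of 1] f01 by (auto simp: b_def)
      moreover have "b' 0 = x" using l x vals[of 0] f01 by (auto simp: b'_def)
      ultimately show ?thesis using d1 by blast
    next
      assume x: "\<delta> < 0 \<and> \<not> x"
      then have "- \<delta> > 0" by simp
      note l = string_leading_neg[OF string_of_uminus[OF e(1)] sparse_runs_uminus[OF e(2)] this]
      have "b 0 \<noteq> x \<or> b 1 \<noteq> x" using l x vals[of 0] vals[of 1] f01 by (auto simp: b_def)
      moreover have "b' 0 = x" using l x vals[of 0] f01 by (auto simp: b'_def)
      ultimately show ?thesis using d1 by blast
    qed
  qed (use runs in auto)
qed

section \<open>The conjugate transformation\<close>

text \<open>Determined by \<open>\<beta> * c = c + 1 / 2\<close>: the two branches of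
  \<open>T\<close> send \<open>c\<close> to the two ends of \<open>X\<close>. The reflection at
  \<open>c\<close> exchanges the branches and hence the digits, up to end points.\<close>

definition c :: real where "c = 1 / (2 * (\<beta> - 1))"

definition X :: "real set" where "X = {c - 1/2..<c + 1/2}"

definition T :: "real \<Rightarrow> real" where "T u = \<beta> * u - of_bool (c \<le> u)"

definition dig :: "real \<Rightarrow> nat \<Rightarrow> bool" where "dig u n \<longleftrightarrow> c \<le> (T ^^ n) u"

definition pre :: "bool \<Rightarrow> real \<Rightarrow> real" where "pre a u = q * (u + of_bool a)"

lemma beta_q_cancel: "\<beta> * (q * y) = y" and q_beta_cancel: "q * (\<beta> * y) = y"
  by (metis beta_q mult.assoc mult_1, metis q_beta mult.assoc mult_1)

lemma c_pos: "c > 0" and beta_c: "\<beta> * c = c + 1 / 2" and q_c: "q * (c + 1/2) = c"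
proof -
  show "c > 0" using b1 by (simp add: c_def)
  show *: "\<beta> * c = c + 1 / 2" using b1 by (simp add: c_def field_simps)
  show "q * (c + 1/2) = c" using b1 by (simp add: *[symmetric] q_def)
qed

text \<open>The left end of \<open>X\<close> needs exactly \<open>d\<close> steps with digit 0 to
  reach the discontinuity \<open>c\<close>. This is why runs of length \<open>d\<close> occur and
  longer ones do not.\<close>

lemma beta_pow_d_c: "\<beta> ^ d * (c - 1 / 2) = c"
proof -
  have "q ^ d = 2 - \<beta>" using q_pow_Suc_d b1 by (simp add: q_def field_simps)
  then have "\<beta> ^ d * (2 - \<beta>) = 1" using beta_pow_q[of d] by simp
  moreover have "c - 1 / 2 = (2 - \<beta>) * c" using b1 by (simp add: c_def field_simps)
  ultimately show ?thesis by (simp flip: mult.assoc)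
qed

lemma T_in_X: "u \<in> X \<Longrightarrow> T u \<in> X"
proof -
  assume u: "u \<in> X"
  have 1: "\<beta> * u < \<beta> * c \<longleftrightarrow> u < c" using b1 by simp
  have 2: "\<beta> * u < \<beta> * (c + 1/2)" "\<beta> * (c - 1/2) \<le> \<beta> * u" using u b1 by (auto simp: X_def)
  have 3: "c - 1/2 \<le> \<beta> * (c - 1/2)" "\<beta> * (c + 1/2) \<le> c + 3/2"
    using b2 beta_c by (auto simp: algebra_simps)
  show ?thesis using 1 2 3 beta_c by (auto simp: T_def X_def)
qed

lemma T_pow_in_X: "u \<in> X \<Longrightarrow> (T ^^ n) u \<in> X"
  by (induction n) (auto intro: T_in_X)

lemma dig_T: "dig (T u) n = dig u (Suc n)"
  by (simp only: dig_def funpow_Suc_right o_apply)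

lemma T_pow_run_0: "(\<forall>i<n. \<not> dig u i) \<Longrightarrow> (T ^^ n) u = \<beta> ^ n * u"
  by (induction n) (auto simp: dig_def T_def less_Suc_eq)

lemma T_pow_run_1: "(\<forall>i<n. dig u i) \<Longrightarrow> 2 * c - (T ^^ n) u = \<beta> ^ n * (2 * c - u)"
proof (induction n)
  case (Suc n)
  then have "2 * c - (T ^^ Suc n) u = \<beta> * (2 * c - (T ^^ n) u)"
    using beta_c by (auto simp: T_def dig_def algebra_simps)
  then show ?case using Suc by simp
qed simp

lemma dig_runs:
  assumes "u \<in> X"
  shows "\<exists>i\<le>d. dig u i \<noteq> a"
proof (rule ccontr)
  assume "\<not> ?thesis"
  then have all: "dig u i = a" if "i \<le> d" for i using that by blast
  show False
  proof (cases a)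
    case True
    have "2 * c - (T ^^ d) u = \<beta> ^ d * (2 * c - u)" using all True by (intro T_pow_run_1) auto
    moreover have "\<beta> ^ d * (c - 1/2) < \<beta> ^ d * (2 * c - u)" using assms b1 by (simp add: X_def)
    moreover have "c \<le> (T ^^ d) u" using all[of d] True by (simp add: dig_def)
    ultimately show False using beta_pow_d_c by simp
  next
    case False
    have "(T ^^ d) u = \<beta> ^ d * u" using all False by (intro T_pow_run_0) auto
    moreover have "\<beta> ^ d * (c - 1/2) \<le> \<beta> ^ d * u" using assms b1 by (simp add: X_def)
    moreover have "(T ^^ d) u < c" using all[of d] False by (simp add: dig_def)
    ultimately show False using beta_pow_d_c by simp
  qed
qed

lemma dig_runs': "u \<in> X \<Longrightarrow> \<exists>i\<le>d. dig u (j + i) \<noteq> a"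
proof -
  have "dig ((T ^^ j) u) i = dig u (j + i)" for i
    by (simp add: dig_def funpow_add[symmetric, THEN fun_cong, unfolded o_def] add.commute)
  then show "u \<in> X \<Longrightarrow> ?thesis" using dig_runs[OF T_pow_in_X] by metis
qed

text \<open>If the first digit of \<open>u\<close> different from \<open>a\<close> has index
  \<open>j < d\<close>, then \<open>u\<close> is so far from the end of \<open>X\<close> associated
  with \<open>a\<close> that the inverse branch stays inside: for digit 0,
  \<open>q * u \<ge> q ^ (j + 1) * c \<ge> q ^ d * c = c - 1 / 2\<close>. Digit 1 is the mirror
  image.\<close>

lemma pre_admissible:
  assumes u: "u \<in> X" and "\<exists>j<d. dig u j \<noteq> a"
  shows "pre a u \<in> X" "c \<le> pre a u \<longleftrightarrow> a" "T (pre a u) = u"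
proof -
  obtain j0 where j0: "j0 < d" "dig u j0 \<noteq> a" using assms(2) by blast
  define j where "j = (LEAST j. dig u j \<noteq> a)"
  have j: "dig u j \<noteq> a" "j < d" unfolding j_def
    using LeastI[of "\<lambda>j. dig u j \<noteq> a" j0] Least_le[of "\<lambda>j. dig u j \<noteq> a" j0] j0 by auto
  have before: "dig u i = a" if "i < j" for i using not_less_Least[of i "\<lambda>j. dig u j \<noteq> a"] that by (auto simp: j_def)
  have qb: "q ^ j * (\<beta> ^ j * y) = y" for y
    using beta_pow_q[of j] by (metis mult.assoc mult.commute mult_1)
  have qc: "c - 1/2 \<le> q * (q ^ j * c)"
  proof -
    have "c - 1/2 = q ^ d * c" using beta_pow_d_c beta_pow_q[of d] by (metis mult.assoc mult.commute mult_1)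
    also have "\<dots> \<le> q ^ Suc j * c" using c_pos q_pos q_lt1 j(2)
      by (intro mult_right_mono power_decreasing) auto
    finally show ?thesis by (simp add: mult.assoc)
  qed
  have "pre a u \<in> X \<and> (c \<le> pre a u \<longleftrightarrow> a)"
  proof (cases a)
    case False
    have "(T ^^ j) u = \<beta> ^ j * u" using before False by (intro T_pow_run_0) auto
    then have "c \<le> \<beta> ^ j * u" using j False by (simp add: dig_def)
    then have "q ^ j * c \<le> q ^ j * (\<beta> ^ j * u)" using q_pos by (intro mult_left_mono) auto
    then have "q ^ j * c \<le> u" unfolding qb .
    then have "q * (q ^ j * c) \<le> q * u" using q_pos by (intro mult_left_mono) auto
    moreover have "q * u < q * (c + 1/2)" using u q_pos by (simp add: X_def)
    ultimately show ?thesis using qc q_c False by (simp add: pre_def X_def)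
  next
    case True
    have "2 * c - (T ^^ j) u = \<beta> ^ j * (2 * c - u)" using before True by (intro T_pow_run_1) auto
    then have "c < \<beta> ^ j * (2 * c - u)" using j True by (simp add: dig_def)
    then have "q ^ j * c < q ^ j * (\<beta> ^ j * (2 * c - u))" using q_pos by (intro mult_strict_left_mono) auto
    then have "q ^ j * c < 2 * c - u" unfolding qb .
    then have "q * (q ^ j * c) < q * (2 * c - u)" using q_pos by (intro mult_strict_left_mono) auto
    moreover have "q * (2 * c - u) = 2 * c - q * (u + 1)" using q_c by (simp add: algebra_simps)
    moreover have "q * (c + 1/2) \<le> q * (u + 1)" using u q_pos by (simp add: X_def)
    ultimately show ?thesis using qc q_c True by (simp add: pre_def X_def)
  qed
  then show "pre a u \<in> X" "c \<le> pre a u \<longleftrightarrow> a" by auto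
  then have "T (pre a u) = \<beta> * pre a u - of_bool a" by (simp only: T_def)
  also have "\<dots> = u" unfolding pre_def by (simp only: beta_q_cancel add_diff_cancel_right')
  finally show "T (pre a u) = u" .
qed

lemma pre_T: "pre (c \<le> u) (T u) = u"
  by (simp add: pre_def T_def q_beta_cancel)

section \<open>Concatenation of digit strings\<close>

definition glue :: "(nat \<Rightarrow> bool) \<Rightarrow> nat \<Rightarrow> real \<Rightarrow> nat \<Rightarrow> bool" where
  "glue b n u i = (if i < n then b i else dig u (i - n))"

text \<open>A composition of inverse branches. It is the point with digit sequence
  \<open>glue b n u\<close> only if that sequence is admissible; see
  \<open>cat_admissible\<close>.\<close>

definition cat :: "(nat \<Rightarrow> bool) \<Rightarrow> nat \<Rightarrow> real \<Rightarrow> real" where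
  "cat b n u = (\<Sum>i<n. of_bool (b i) * q ^ (i + 1)) + q ^ n * u"

lemma cat_0 [simp]: "cat b 0 u = u"
  by (simp add: cat_def)

lemma cat_Suc: "cat b (Suc n) u = pre (b 0) (cat (\<lambda>i. b (Suc i)) n u)"
  unfolding cat_def pre_def
  by (subst sum.lessThan_Suc_shift) (simp add: sum_distrib_left distrib_left mult_ac)

lemma cat_add: "cat b n u - cat b n u' = q ^ n * (u - u')"
  by (simp add: cat_def algebra_simps)

lemma cat_dig: "cat (dig u) n ((T ^^ n) u) = u"
proof (induction n arbitrary: u)
  case (Suc n)
  have "cat (dig u) (Suc n) ((T ^^ Suc n) u) = pre (dig u 0) (cat (dig (T u)) n ((T ^^ n) (T u)))"
    by (simp add: cat_Suc dig_T[abs_def, symmetric] funpow_swap1)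
  also have "\<dots> = u" using Suc[of "T u"] pre_T[of u] by (simp add: dig_def[of u 0])
  finally show ?case .
qed simp

text \<open>Together with \<open>dig_runs'\<close> this describes the digit sequences: bounded runs
  suffice, because \<open>pre_admissible\<close> asks only for another digit among the next
  \<open>d\<close>.\<close>

lemma cat_admissible:
  assumes "u \<in> X" "\<And>j a. \<exists>i\<le>d. glue b n u (j + i) \<noteq> a"
  shows "cat b n u \<in> X \<and> dig (cat b n u) = glue b n u \<and> (T ^^ n) (cat b n u) = u"
  using assms(2)
proof (induction n arbitrary: b)
  case 0
  then show ?case using assms(1) by (auto simp: glue_def)
next
  case (Suc n)
  define b' where "b' = (\<lambda>i. b (Suc i))"
  have g: "glue b' n u i = glue b (Suc n) u (Suc i)" for i by (simp add: glue_def b'_def)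
  have "\<exists>i\<le>d. glue b' n u (j + i) \<noteq> a" for j a using Suc.prems[of "Suc j" a] by (simp add: g)
  note IH = Suc.IH[OF this]
  have cS: "cat b (Suc n) u = pre (b 0) (cat b' n u)" by (simp add: cat_Suc b'_def)
  obtain i where i: "i \<le> d" "glue b (Suc n) u i \<noteq> b 0" using Suc.prems[of 0 "b 0"] by auto
  then obtain k where k: "i = Suc k" by (cases i) (auto simp: glue_def)
  have "\<exists>j<d. dig (cat b' n u) j \<noteq> b 0" using i IH by (intro exI[of _ k]) (auto simp: k g)
  note p = pre_admissible[OF _ this]
  have "dig (cat b (Suc n) u) i = glue b (Suc n) u i" for i
  proof (cases i)
    case 0
    then show ?thesis using p IH by (simp add: dig_def glue_def cS)
  next
    case (Suc k)
    have "dig (cat b (Suc n) u) i = dig (T (cat b (Suc n) u)) k" by (simp add: dig_T Suc)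
    also have "\<dots> = glue b' n u k" using p IH by (simp add: cS)
    finally show ?thesis by (simp add: g Suc)
  qed
  moreover have "(T ^^ Suc n) (cat b (Suc n) u) = u"
    unfolding cS funpow_Suc_right o_apply using p IH by simp
  ultimately show ?case using p IH by (auto simp: cS)
qed

lemma glue_runs:
  assumes "u \<in> X" "\<And>j a. j + d < n \<Longrightarrow> \<exists>i\<le>d. b (j + i) \<noteq> a" "n > 0 \<Longrightarrow> b (n - 1) \<noteq> dig u 0"
  shows "\<exists>i\<le>d. glue b n u (j + i) \<noteq> a"
proof -
  consider "j + d < n" | "j < n" "n \<le> j + d" | "n \<le> j" by linarith
  then show ?thesis
  proof cases
    case 1
    then obtain i where "i \<le> d" "b (j + i) \<noteq> a" using assms(2)[OF 1] by metis
    then show ?thesis using 1 by (intro exI[of _ i]) (simp add: glue_def)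
  next
    case 2
    have "glue b n u (j + (n - 1 - j)) = b (n - 1)" "glue b n u (j + (n - j)) = dig u 0"
      using 2 by (simp_all add: glue_def)
    moreover have "b (n - 1) \<noteq> dig u 0" using assms(3) 2 by simp
    moreover have "n - 1 - j \<le> d" "n - j \<le> d" using 2 by simp_all
    ultimately show ?thesis by metis
  next
    case 3
    obtain i where "i \<le> d" "dig u (j - n + i) \<noteq> a" using dig_runs'[OF assms(1)] by metis
    then show ?thesis using 3 by (intro exI[of _ i]) (simp add: glue_def)
  qed
qed


section \<open>Coupling of orbits\<close>

text \<open>The points \<open>alt_pt a\<close> have alternating digits; they form an orbit of period 2.\<close>

definition h :: real where "h = 1 / (2 * (\<beta> + 1))"

definition alt_pt :: "bool \<Rightarrow> real" where
  "alt_pt a = (if a then c + h else c - h)"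

lemma h_bounds: "0 < h" "h < 1 / 2" "\<beta> * h = 1 / 2 - h"
  using b1 by (auto simp: h_def field_simps)

lemma alt_pt_step: "alt_pt a \<in> X" "c \<le> alt_pt a \<longleftrightarrow> a" "T (alt_pt a) = alt_pt (\<not> a)"
proof -
  show "alt_pt a \<in> X" "c \<le> alt_pt a \<longleftrightarrow> a" "T (alt_pt a) = alt_pt (\<not> a)"
    using h_bounds beta_c by (auto simp: alt_pt_def X_def T_def distrib_left right_diff_distrib)
qed

lemma T_pow_alt_pt: "(T ^^ n) (alt_pt a) = alt_pt (a \<noteq> odd n)"
  by (induction n) (auto simp: alt_pt_step)

lemma dig_alt_pt: "dig (alt_pt a) n \<longleftrightarrow> (a \<noteq> odd n)"
  by (simp add: dig_def T_pow_alt_pt alt_pt_step)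

lemma X_diff_lt: "u \<in> X \<Longrightarrow> u' \<in> X \<Longrightarrow> \<bar>u - u'\<bar> < 1"
  by (auto simp: X_def)

lemma q_pow_small: "\<epsilon> > 0 \<Longrightarrow> \<exists>n. q ^ n < \<epsilon>"
  using real_arch_pow_inv q_lt1 by blast

text \<open>Keep the first \<open>m\<close> digits of a point close to \<open>u\<close> and continue
  with the 2-cycle, entered with the digit opposite to the last one kept, so that no run crosses the
  seam.\<close>

lemma eventually_alternating_dense:
  assumes u: "u \<in> X" and "\<epsilon> > 0" "u + \<epsilon> \<le> c + 1 / 2"
  obtains w m where "w \<in> X" "u < w" "w < u + \<epsilon>" "\<And>n. n \<ge> m \<Longrightarrow> \<exists>a. (T ^^ n) w = alt_pt a"
proof -
  define y where "y = u + \<epsilon> / 2"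
  have y: "y \<in> X" using assms by (auto simp: X_def y_def)
  obtain m0 where m0: "q ^ m0 < \<epsilon> / 2" using q_pow_small assms(2) by (meson half_gt_zero)
  define m where "m = Suc m0"
  have "q ^ m \<le> q ^ m0" unfolding m_def using q_pos q_lt1 by (intro power_decreasing) auto
  then have m: "q ^ m < \<epsilon> / 2" using m0 by linarith
  define p where "p = alt_pt (\<not> dig y m0)"
  have p: "p \<in> X" by (simp add: p_def alt_pt_step)
  have "\<exists>i\<le>d. glue (dig y) m p (j + i) \<noteq> a" for j a
    by (rule glue_runs[OF p dig_runs'[OF y]]) (simp add: p_def m_def dig_alt_pt)
  then have w: "cat (dig y) m p \<in> X" "(T ^^ m) (cat (dig y) m p) = p"
    using cat_admissible[OF p, of "dig y" m] by blast+
  define w where "w = cat (dig y) m p"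
  have "\<bar>w - y\<bar> = q ^ m * \<bar>p - (T ^^ m) y\<bar>"
    using cat_add[of "dig y" m p "(T ^^ m) y"] cat_dig[of y m] q_pow_pos[of m] by (simp add: w_def abs_mult)
  also have "\<dots> \<le> q ^ m * 1"
    using X_diff_lt[OF p T_pow_in_X[OF y], of m] q_pow_pos[of m]
    by (intro mult_left_mono) auto
  finally have "\<bar>w - y\<bar> < \<epsilon> / 2" using m by simp
  then have uw: "u < w" "w < u + \<epsilon>" by (auto simp: y_def abs_if split: if_splits)
  have "\<exists>a. (T ^^ n) w = alt_pt a" if "n \<ge> m" for n
  proof -
    have "(T ^^ n) w = (T ^^ (n - m)) ((T ^^ m) w)"
      using that by (metis funpow_add le_add_diff_inverse2 o_apply)
    then show ?thesis using w(2) T_pow_alt_pt by (auto simp: w_def p_def)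
  qed
  then show ?thesis using that[of w m] w uw by (auto simp: w_def)
qed

text \<open>A time at which both digit sequences can be continued freely: either they agree in two consecutive
  places, or the last digit of \<open>w2\<close> differs from the first digit that the continuation requires.\<close>

lemma coupling_time:
  assumes w: "w \<in> X" "w2 \<in> X" and alt: "\<And>n. n \<ge> m \<Longrightarrow> dig w (Suc n) \<noteq> dig w n"
  defines "\<delta> \<equiv> \<lambda>n. (T ^^ n) w2 - (T ^^ n) w"
  obtains n x where "n \<ge> m"
    "dig w n = dig w2 n \<and> dig w (Suc n) = dig w2 (Suc n) \<and> x = (\<not> dig w (Suc n)) \<or>
     x = (\<not> dig w2 (Suc n)) \<and> (\<delta> (n + 2) > 0 \<and> x \<or> \<delta> (n + 2) < 0 \<and> \<not> x)"
proof (rule ccontr)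
  note goal = that
  assume "\<not> thesis"
  then have no: "\<not> (dig w n = dig w2 n \<and> dig w (Suc n) = dig w2 (Suc n) \<and> x = (\<not> dig w (Suc n)) \<or>
     x = (\<not> dig w2 (Suc n)) \<and> (\<delta> (n + 2) > 0 \<and> x \<or> \<delta> (n + 2) < 0 \<and> \<not> x))" if "n \<ge> m" for n x
    using that goal by blast
  have no1: "\<not> (dig w n = dig w2 n \<and> dig w (Suc n) = dig w2 (Suc n))" if "n \<ge> m" for n
    using no[OF that, of "\<not> dig w (Suc n)"] by blast
  \<comment> \<open>Otherwise the time \<open>n - 1\<close> with
    \<open>x = (\<not> dig w2 n)\<close> would satisfy the second alternative.\<close>
  have no2: "dig w2 n \<Longrightarrow> \<delta> (Suc n) \<ge> 0" "\<not> dig w2 n \<Longrightarrow> \<delta> (Suc n) \<le> 0" if "n \<ge> Suc m" for n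
    using no[of "n - 1" "\<not> dig w2 n"] that by (auto simp: not_less)
  have rec: "\<delta> n = q * (\<delta> (Suc n) + of_bool (dig w2 n) - of_bool (dig w n))" for n
  proof -
    have "\<delta> (Suc n) + of_bool (dig w2 n) - of_bool (dig w n) = \<beta> * \<delta> n"
      by (simp add: \<delta>_def T_def dig_def right_diff_distrib)
    then show ?thesis by (simp only: q_beta_cancel)
  qed
  \<comment> \<open>As \<open>w\<close> alternates, its next digit is \<open>a\<close>. If that of
    \<open>w2\<close> were not, \<open>rec\<close> would give \<open>\<delta> (Suc n)\<close> the
    sign that \<open>no2\<close> forbids. So they agree at \<open>Suc n\<close> and by
    \<open>no1\<close> disagree at the following place, where the situation repeats. In the end
    \<open>w2\<close> would have digit \<open>a\<close> forever.\<close>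
  have step: "dig w2 (Suc n) = a \<and> dig w (Suc (Suc n)) \<noteq> a \<and> dig w2 (Suc (Suc n)) = a"
    if n: "n \<ge> Suc m" "dig w n \<noteq> a" "dig w2 n = a" for n a
  proof -
    have "dig w (Suc n) \<noteq> dig w n" "dig w (Suc (Suc n)) \<noteq> dig w (Suc n)"
      using alt n(1) by simp_all
    then have wa: "dig w (Suc n) = a" "dig w (Suc (Suc n)) \<noteq> a" using n(2) by blast+
    have "dig w2 (Suc n) = a"
    proof (rule ccontr)
      assume *: "dig w2 (Suc n) \<noteq> a"
      show False
      proof (cases a)
        case True
        then have "\<delta> (Suc (Suc n)) \<le> 0" using no2[of "Suc n"] n * by auto
        then have "\<delta> (Suc n) \<le> q * (- 1)" unfolding rec[of "Suc n"] using q_pos wa * True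
          by (intro mult_left_mono) auto
        then show False using no2[of n] n True q_pos by auto
      next
        case False
        then have "\<delta> (Suc (Suc n)) \<ge> 0" using no2[of "Suc n"] n * by auto
        then have "\<delta> (Suc n) \<ge> q * 1" unfolding rec[of "Suc n"] using q_pos wa * False
          by (intro mult_left_mono) auto
        then show False using no2[of n] n False q_pos by auto
      qed
    qed
    then show ?thesis using no1[of "Suc n"] n wa by auto
  qed
  have "dig w (Suc m) \<noteq> dig w2 (Suc m) \<or> dig w (Suc (Suc m)) \<noteq> dig w2 (Suc (Suc m))"
    using no1[of "Suc m"] by simp
  then obtain M where M: "M \<ge> Suc m" "dig w M \<noteq> dig w2 M" by (metis le_refl le_SucI)
  define a where "a = dig w2 M"
  have k: "dig w (M + 2 * k) \<noteq> a \<and> dig w2 (M + 2 * k) = a" for k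
  proof (induction k)
    case (Suc k)
    have "Suc m \<le> M + 2 * k" using M by simp
    from step[OF this] Suc have "dig w (Suc (Suc (M + 2 * k))) \<noteq> a \<and> dig w2 (Suc (Suc (M + 2 * k))) = a"
      by blast
    then show ?case by simp
  qed (use M in \<open>auto simp: a_def\<close>)
  have "dig w2 (M + j) = a" for j
  proof (cases "even j")
    case True
    then obtain k' where "j = 2 * k'" by blast
    then show ?thesis using k[of k'] by simp
  next
    case False
    then obtain k' where "j = 2 * k' + 1" by (blast elim: oddE)
    moreover have "Suc m \<le> M + 2 * k'" using M by simp
    from step[OF this] k[of k'] have "dig w2 (Suc (M + 2 * k')) = a" by blast
    ultimately show ?thesis by simp
  qed
  then show False using dig_runs'[OF w(2), of M a] by blast
qed

lemma cat_cat: "cat b (N + M) u = cat b N (cat (\<lambda>i. b (N + i)) M u)"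
proof (induction N arbitrary: b)
  case (Suc N)
  then show ?case using Suc[of "\<lambda>i. b (Suc i)"] by (simp add: cat_Suc)
qed simp

lemma cat_cong: "(\<And>i. i < n \<Longrightarrow> b i = b' i) \<Longrightarrow> cat b n u = cat b' n u"
  by (simp add: cat_def)

text \<open>In the second alternative a run across the seam starts at the last place of
  \<open>f\<close> and is broken within the first \<open>d\<close> places of \<open>b\<close>, so
  its length is at most \<open>d\<close>.\<close>

lemma join_runs:
  assumes f: "\<And>j a. \<exists>i\<le>d. f (j + i) \<noteq> (a::bool)" and b: "\<And>j a. \<exists>i\<le>d. b (j + i) \<noteq> a" and "N = n + 2"
    and cross: "f (Suc n) \<noteq> b 0 \<or> f n \<noteq> f (Suc n) \<and> (\<exists>i<d. b i \<noteq> f (Suc n))"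
  shows "\<exists>i\<le>d. (\<lambda>i. if i < N then f i else b (i - N)) (j + i) \<noteq> a"
proof -
  define F where "F = (\<lambda>i. if i < N then f i else b (i - N))"
  have in_win: ?thesis if "k \<ge> j" "k \<le> j + d" "F k \<noteq> a" for k
    using that by (intro exI[of _ "k - j"]) (auto simp: F_def)
  consider "j + d < N" | "N \<le> j" | "j \<le> Suc n" "N \<le> j + d" using assms(3) by linarith
  then show ?thesis
  proof cases
    case 1
    obtain i where "i \<le> d" "f (j + i) \<noteq> a" using f by metis
    then show ?thesis using 1 by (intro exI[of _ i]) auto
  next
    case 2
    obtain i where "i \<le> d" "b (j - N + i) \<noteq> a" using b by metis
    then show ?thesis using 2 by (intro exI[of _ i]) auto
  next
    case 3
    have F: "F n = f n" "F (Suc n) = f (Suc n)" "F N = b 0" using assms(3) by (auto simp: F_def)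
    have w1: ?thesis if "F (Suc n) \<noteq> a" using in_win[of "Suc n"] that 3 assms(3) by auto
    have w2: ?thesis if "F N \<noteq> a" using in_win[of N] that 3 assms(3) by auto
    show ?thesis
    proof (cases "f (Suc n) = a \<and> b 0 = a")
      case False
      then have "F (Suc n) \<noteq> a \<or> F N \<noteq> a" using F by simp
      then show ?thesis using w1 w2 by blast
    next
      case True
      then have cr: "f n \<noteq> a" "\<exists>i<d. b i \<noteq> a" using cross by auto
      show ?thesis
      proof (cases "j \<le> n")
        case True
        then show ?thesis using cr F 3 assms(3) by (intro in_win[of n]) simp_all
      next
        case False
        then have j: "j = Suc n" using 3 by simp
        obtain i where i: "i < d" "b i \<noteq> a" using cr by blast
        then show ?thesis using j assms(3) by (intro in_win[of "N + i"]) (simp_all add: F_def)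
      qed
    qed
  qed
qed

text \<open>\<open>q - 1 = - q * (\<beta> - 1)\<close>, so multiplication by \<open>q\<close> acts
  trivially on the cosets of Z[\<beta>].\<close>

lemma q_pow_minus_in_Zb:
  assumes "(\<beta> - 1) * u \<in> int_adjoin \<beta>"
  shows "q ^ n * u - u \<in> int_adjoin \<beta>"
proof (induction n)
  case (Suc n)
  have "q * u - u = - (q * ((\<beta> - 1) * u))" by (simp add: algebra_simps q_beta_cancel)
  then have "q * u - u \<in> int_adjoin \<beta>" using assms by simp
  moreover have "q ^ Suc n * u - u = q * (q ^ n * u - u) + (q * u - u)" by (simp add: algebra_simps)
  ultimately show ?case using Suc by (metis int_adjoin_add int_adjoin_mult q_in_Zb)
qed simp

lemma T_pow_diff_in_Zb:
  assumes "u2 - u1 \<in> int_adjoin \<beta>"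
  shows "(T ^^ n) u2 - (T ^^ n) u1 \<in> int_adjoin \<beta>"
proof (induction n)
  case (Suc n)
  have "(T ^^ Suc n) u2 - (T ^^ Suc n) u1 = \<beta> * ((T ^^ n) u2 - (T ^^ n) u1)
      + of_bool (c \<le> (T ^^ n) u1) - of_bool (c \<le> (T ^^ n) u2)"
    by (simp add: T_def algebra_simps)
  moreover have "of_bool P \<in> int_adjoin \<beta>" for P by (cases P) auto
  ultimately show ?case using Suc by simp
qed (use assms in simp)

text \<open>Choose \<open>w\<close> near \<open>u1\<close> with eventually alternating digits and
  let \<open>w2\<close> be the parallel point near \<open>u2\<close>. At a time \<open>N\<close>
  from \<open>coupling_time\<close> the tails are replaced by \<open>b\<close> and
  \<open>b'\<close>, followed by the digits of one point \<open>u\<close> for both. The new tails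
  differ by \<open>\<delta> N\<close> like the old ones, so the new points still differ by
  \<open>u2 - u1\<close>; their common displacement is \<open>v\<close>.\<close>

theorem coupling:
  assumes u1: "u1 \<in> X" and u2: "u2 \<in> X" and diff: "u2 - u1 \<in> int_adjoin \<beta>"
    and L: "(\<beta> - 1) * u1 \<in> int_adjoin \<beta>" and "\<epsilon> > 0"
  obtains v n where "v \<in> int_adjoin \<beta>" "0 \<le> v" "v < \<epsilon>" "u1 + v \<in> X" "u2 + v \<in> X"
    "(T ^^ n) (u1 + v) = (T ^^ n) (u2 + v)"
proof -
  define \<epsilon>' where "\<epsilon>' = min \<epsilon> (min (c + 1/2 - u1) (c + 1/2 - u2))"
  have e': "\<epsilon>' > 0" "\<epsilon>' \<le> \<epsilon>" "u1 + \<epsilon>' \<le> c + 1/2" "u2 + \<epsilon>' \<le> c + 1/2"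
    using assms by (auto simp: \<epsilon>'_def X_def)
  obtain w m where w: "w \<in> X" "u1 < w" "w < u1 + \<epsilon>'"
    and w_alt: "\<And>n. n \<ge> m \<Longrightarrow> \<exists>a. (T ^^ n) w = alt_pt a"
    using eventually_alternating_dense[OF u1 e'(1,3)] by blast
  define w2 where "w2 = u2 + (w - u1)"
  have w2: "w2 \<in> X" using w u2 e' by (auto simp: X_def w2_def)
  \<comment> \<open>Changing digits of \<open>w\<close> from place \<open>n0\<close> on keeps the
    point between \<open>u1\<close> and \<open>u1 + \<epsilon>'\<close>, which ensures
    \<open>0 \<le> v < \<epsilon>\<close>.\<close>
  have "min (w - u1) (u1 + \<epsilon>' - w) > 0" using w by simp
  then obtain n0 where n0: "q ^ n0 < min (w - u1) (u1 + \<epsilon>' - w)" using q_pow_small by blast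
  have alt: "dig w (Suc n) \<noteq> dig w n" if "n \<ge> max m n0" for n
    using w_alt[of n] that by (auto simp: dig_def alt_pt_step)
  define \<delta> where "\<delta> n = (T ^^ n) w2 - (T ^^ n) w" for n
  obtain n x where n: "n \<ge> max m n0" and type:
    "dig w n = dig w2 n \<and> dig w (Suc n) = dig w2 (Suc n) \<and> x = (\<not> dig w (Suc n)) \<or>
     x = (\<not> dig w2 (Suc n)) \<and> (\<delta> (n + 2) > 0 \<and> x \<or> \<delta> (n + 2) < 0 \<and> \<not> x)"
    using coupling_time[OF w(1) w2 alt] unfolding \<delta>_def by blast
  define N where "N = n + 2"
  have \<delta>: "\<delta> N \<in> int_adjoin \<beta>" using T_pow_diff_in_Zb[of w2 w N] diff by (simp add: \<delta>_def w2_def)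
  \<comment> \<open>The orbit of \<open>w\<close> is at distance \<open>h\<close> from the centre
    \<open>c\<close> of \<open>X\<close>, so no point of \<open>X\<close> is farther from it than
    \<open>1 / 2 + h\<close>.\<close>
  have "\<bar>\<delta> N\<bar> \<le> 1 / 2 + 1 / (2 * (\<beta> + 1))"
  proof -
    obtain a where "(T ^^ N) w = alt_pt a" using w_alt[of N] n by (auto simp: N_def)
    moreover have "(T ^^ N) w2 \<in> X" by (rule T_pow_in_X[OF w2])
    ultimately have "\<bar>\<delta> N\<bar> \<le> 1 / 2 + h"
      using h_bounds by (auto simp: \<delta>_def alt_pt_def X_def split: if_splits)
    then show ?thesis by (simp add: h_def)
  qed
  then obtain b b' :: "nat \<Rightarrow> bool" and N2 where b:
    "\<And>i. i \<ge> N2 \<Longrightarrow> b i = b' i"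
    "\<delta> N = (\<Sum>i<N2. (of_bool (b' i) - of_bool (b i)) * q ^ (i + 1))"
    "\<And>j a. \<exists>i\<le>d. b (j + i) \<noteq> a" "\<And>j a. \<exists>i\<le>d. b' (j + i) \<noteq> a"
    "\<exists>i<d. b i = x" "\<exists>i<d. b' i = x"
    "\<delta> N > 0 \<and> x \<or> \<delta> N < 0 \<and> \<not> x \<Longrightarrow> b' 0 = x \<and> (\<exists>i<d. b i \<noteq> x)"
    by (rule coupling_digit_strings[OF _ \<delta>, of x]) blast+
  define F where "F i = (if i < N then dig w i else b (i - N))" for i
  define G where "G i = (if i < N then dig w2 i else b' (i - N))" for i
  have fN: "dig w n \<noteq> dig w (Suc n)" using alt[OF n] by simp
  have F_runs: "\<exists>i\<le>d. F (j + i) \<noteq> a" for j a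
  proof -
    have "\<exists>i<d. b i \<noteq> dig w (Suc n)"
      using type b(5,7) by (cases "dig w (Suc n) = x") (auto simp: N_def)
    then show ?thesis unfolding F_def
      using join_runs[OF dig_runs'[OF w(1)] b(3) N_def] fN by blast
  qed
  have G_runs: "\<exists>i\<le>d. G (j + i) \<noteq> a" for j a
  proof -
    have "dig w2 (Suc n) \<noteq> b' 0 \<or> dig w2 n \<noteq> dig w2 (Suc n) \<and> (\<exists>i<d. b' i \<noteq> dig w2 (Suc n))"
      using type b(6,7) fN by (auto simp: N_def)
    then show ?thesis unfolding G_def
      by (rule join_runs[OF dig_runs'[OF w2] b(4) N_def])
  qed
  define y where "y = b N2"
  \<comment> \<open>The common continuation must start with a digit other than \<open>y\<close>, and
    it must lie in the coset of \<open>u1\<close> so that \<open>v\<close> is in Z[\<beta>]. Either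
    \<open>u1\<close> itself or a preimage of it will do.\<close>
  obtain u where u: "u \<in> X" "dig u 0 \<noteq> y" "u - u1 \<in> int_adjoin \<beta>"
  proof (cases "dig u1 0 = y")
    case False
    then show ?thesis using that[of u1] u1 by simp
  next
    case True
    have "0 < d" using d2 by simp
    then have "\<exists>j<d. dig u1 j \<noteq> (\<not> y)" using True by (intro exI[of _ 0]) auto
    note p = pre_admissible[OF u1 this]
    have "pre (\<not> y) u1 - u1 = (q ^ 1 * u1 - u1) + q * of_bool (\<not> y)"
      by (simp add: pre_def algebra_simps)
    also have "\<dots> \<in> int_adjoin \<beta>" using q_pow_minus_in_Zb[OF L, of 1] by simp
    finally show ?thesis using that[of "pre (\<not> y) u1"] p by (auto simp: dig_def)
  qed
  \<comment> \<open>One place beyond the support of the difference: the last digit \<open>y\<close>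
    is then common to both strings.\<close>
  define M where "M = Suc N2"
  have last: "F (N + M - 1) = y" "G (N + M - 1) = y" using b(1)[of N2] by (auto simp: F_def G_def M_def y_def)
  have "\<exists>i\<le>d. glue F (N + M) u (j + i) \<noteq> a" for j a
    by (rule glue_runs[OF u(1)]) (use F_runs last u(2) in auto)
  note cF = cat_admissible[OF u(1) this]
  have "\<exists>i\<le>d. glue G (N + M) u (j + i) \<noteq> a" for j a
    by (rule glue_runs[OF u(1)]) (use G_runs last u(2) in auto)
  note cG = cat_admissible[OF u(1) this]
  have "\<exists>i\<le>d. glue b M u (j + i) \<noteq> a" for j a
    by (rule glue_runs[OF u(1)]) (use b(3) u(2) in \<open>auto simp: M_def y_def\<close>)
  note cb = cat_admissible[OF u(1) this]
  have F_eq: "cat F (N + M) u = cat (dig w) N (cat b M u)"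
  proof -
    have "cat F (N + M) u = cat F N (cat b M u)" by (simp add: cat_cat) (simp add: F_def)
    also have "\<dots> = cat (dig w) N (cat b M u)" by (rule cat_cong) (simp add: F_def)
    finally show ?thesis .
  qed
  have G_eq: "cat G (N + M) u = cat (dig w2) N (cat b' M u)"
  proof -
    have "cat G (N + M) u = cat G N (cat b' M u)" by (simp add: cat_cat) (simp add: G_def)
    also have "\<dots> = cat (dig w2) N (cat b' M u)" by (rule cat_cong) (simp add: G_def)
    finally show ?thesis .
  qed
  have "cat b' M u - cat b M u = (\<Sum>i<M. (of_bool (b' i) - of_bool (b i)) * q ^ (i + 1))"
    by (simp add: cat_def left_diff_distrib sum_subtractf)
  also have "\<dots> = \<delta> N" using b(1)[of N2] by (simp add: b(2) M_def)
  finally have b_diff: "cat b' M u - cat b M u = \<delta> N" .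
  have w_eq: "cat (dig w) N ((T ^^ N) w) = w" "cat (dig w2) N ((T ^^ N) w2) = w2"
    by (rule cat_dig)+
  have "cat G (N + M) u - w2 - (cat F (N + M) u - w)
      = (cat (dig w2) N (cat b' M u) - cat (dig w2) N ((T ^^ N) w2)) -
        (cat (dig w) N (cat b M u) - cat (dig w) N ((T ^^ N) w))"
    unfolding w_eq F_eq G_eq ..
  also have "\<dots> = q ^ N * ((cat b' M u - cat b M u) - \<delta> N)"
    unfolding cat_add \<delta>_def by (simp add: algebra_simps)
  finally have main: "cat G (N + M) u - cat F (N + M) u = u2 - u1" using b_diff by (simp add: w2_def)
  have "\<bar>cat F (N + M) u - w\<bar> = q ^ N * \<bar>cat b M u - (T ^^ N) w\<bar>"
    using cat_add[of "dig w" N "cat b M u" "(T ^^ N) w"] q_pow_pos[of N]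
    unfolding w_eq F_eq by (simp add: abs_mult)
  also have "\<dots> \<le> q ^ N * 1"
    using X_diff_lt[OF conjunct1[OF cb] T_pow_in_X[OF w(1), of N]] q_pow_pos[of N]
    by (intro mult_left_mono) auto
  also have "\<dots> \<le> q ^ n0 * 1" using n q_pos q_lt1 by (intro mult_right_mono power_decreasing) (auto simp: N_def)
  finally have close: "\<bar>cat F (N + M) u - w\<bar> < min (w - u1) (u1 + \<epsilon>' - w)" using n0 by simp
  define v where "v = cat F (N + M) u - u1"
  have Lu: "(\<beta> - 1) * u \<in> int_adjoin \<beta>"
  proof -
    have "(\<beta> - 1) * u = (\<beta> - 1) * u1 + (\<beta> - 1) * (u - u1)" by (simp add: algebra_simps)
    then show ?thesis using L u(3) by simp
  qed
  have "v = (\<Sum>i<N+M. of_bool (F i) * q ^ (i + 1)) + (q ^ (N+M) * u - u) + (u - u1)"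
    by (simp add: v_def cat_def)
  also have "\<dots> \<in> int_adjoin \<beta>"
  proof -
    have "of_bool P \<in> int_adjoin \<beta>" for P by (cases P) auto
    then show ?thesis using q_pow_minus_in_Zb[OF Lu] u(3) by (intro int_adjoin_add int_adjoin_sum int_adjoin_mult) auto
  qed
  finally have vZ: "v \<in> int_adjoin \<beta>" .
  have "u1 + v = cat F (N + M) u" "u2 + v = cat G (N + M) u" using main by (auto simp: v_def)
  moreover have "0 \<le> v" "v < \<epsilon>" using close e'(2) by (auto simp: v_def abs_if split: if_splits)
  ultimately show ?thesis using that[of v "N + M"] vZ cF cG by simp
qed


section \<open>Tiles in the space of conjugates\<close>

definition L :: "real set" where "L = {u. (\<beta> - 1) * u \<in> int_adjoin \<beta>}"

definition preimgs :: "nat \<Rightarrow> real \<Rightarrow> real set" where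
  "preimgs n u = {y \<in> X. (T ^^ n) y = u}"

definition agree :: "real \<Rightarrow> real \<Rightarrow> bool" where
  "agree u u' \<longleftrightarrow> (\<forall>i<d. dig u i = dig u' i)"

lemma L_add [simp]: "u \<in> L \<Longrightarrow> v \<in> L \<Longrightarrow> u + v \<in> L"
  and L_diff [simp]: "u \<in> L \<Longrightarrow> v \<in> L \<Longrightarrow> u - v \<in> L"
  and L_0 [simp]: "0 \<in> L"
  by (simp_all add: L_def distrib_left right_diff_distrib)

lemma Zb_in_L: "v \<in> int_adjoin \<beta> \<Longrightarrow> v \<in> L"
  by (simp add: L_def)

lemma L_mult [simp]: "u \<in> L \<Longrightarrow> r \<in> int_adjoin \<beta> \<Longrightarrow> r * u \<in> L"
proof -
  assume "u \<in> L" "r \<in> int_adjoin \<beta>"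
  then have "r * ((\<beta> - 1) * u) \<in> int_adjoin \<beta>" by (simp add: L_def)
  then show ?thesis by (simp add: L_def mult.left_commute)
qed

lemma of_bool_in_Zb [simp]: "of_bool P \<in> int_adjoin \<beta>"
  by (cases P) auto

lemma T_L_iff: "T y \<in> L \<longleftrightarrow> y \<in> L"
proof
  assume "T y \<in> L"
  then have "q * (T y + of_bool (c \<le> y)) \<in> L" by (simp add: Zb_in_L)
  then show "y \<in> L" by (simp add: T_def q_beta_cancel)
qed (simp add: T_def Zb_in_L)

lemma T_pow_L_iff: "(T ^^ n) y \<in> L \<longleftrightarrow> y \<in> L"
  by (induction n) (auto simp: T_L_iff)

lemma preimgs_L: "u \<in> L \<Longrightarrow> y \<in> preimgs n u \<Longrightarrow> y \<in> L"
  by (auto simp: preimgs_def T_pow_L_iff)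

lemma T_minus_in_Zb: "u \<in> L \<Longrightarrow> T u - u \<in> int_adjoin \<beta>"
proof -
  assume "u \<in> L"
  then have "(\<beta> - 1) * u - of_bool (c \<le> u) \<in> int_adjoin \<beta>" by (simp add: L_def)
  then show ?thesis by (simp add: T_def algebra_simps)
qed

lemma preimgs_0: "u \<in> X \<Longrightarrow> preimgs 0 u = {u}"
  by (auto simp: preimgs_def)

lemma preimgs_Suc_iff: "y \<in> preimgs (Suc n) u \<longleftrightarrow> y \<in> X \<and> T y \<in> preimgs n u"
  by (auto simp: preimgs_def T_in_X funpow_Suc_right simp del: funpow.simps)

lemma preimgs_add: "y \<in> preimgs (n + m) u \<Longrightarrow> (T ^^ m) y \<in> preimgs n u"
  by (auto simp: preimgs_def T_pow_in_X funpow_add)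

lemma preimgs_trans: "y \<in> preimgs n u \<Longrightarrow> x \<in> preimgs m y \<Longrightarrow> x \<in> preimgs (n + m) u"
  by (auto simp: preimgs_def funpow_add)

lemma finite_preimgs: "finite (preimgs n u)"
proof (induction n)
  case (Suc n)
  have "preimgs (Suc n) u \<subseteq> pre True ` preimgs n u \<union> pre False ` preimgs n u"
  proof
    fix y assume "y \<in> preimgs (Suc n) u"
    then have "T y \<in> preimgs n u" by (simp add: preimgs_Suc_iff)
    moreover have "y = pre (c \<le> y) (T y)" by (simp add: pre_T)
    ultimately show "y \<in> pre True ` preimgs n u \<union> pre False ` preimgs n u"
      by (cases "c \<le> y") auto
  qed
  then show ?case using Suc finite_subset by blast
qed (simp add: preimgs_def)

lemma preimgs_1_nonempty:
  assumes "u \<in> X"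
  obtains y where "y \<in> preimgs 1 u"
proof -
  have "0 < d" using d2 by simp
  then have "\<exists>j<d. dig u j \<noteq> (\<not> dig u 0)" by (intro exI[of _ 0]) auto
  from pre_admissible[OF assms this] show ?thesis by (intro that) (auto simp: preimgs_def)
qed

text \<open>Whether a digit can be prepended depends only on the first \<open>d\<close> digits, so the backward trees of
  two points that agree there are translates of each other.\<close>

lemma agree_preimgs:
  assumes "u \<in> X" "u' \<in> X" "agree u u'" "y \<in> preimgs n u"
  shows "y + q ^ n * (u' - u) \<in> preimgs n u' \<and> agree y (y + q ^ n * (u' - u))"
  using assms(4)
proof (induction n arbitrary: y)
  case 0
  then show ?case using assms by (auto simp: preimgs_def)
next
  case (Suc n)
  define x where "x = T y"
  define x' where "x' = x + q ^ n * (u' - u)"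
  define a where "a = (c \<le> y)"
  have y: "y \<in> X" "x \<in> preimgs n u" using Suc.prems by (auto simp: preimgs_Suc_iff x_def)
  have x': "x' \<in> preimgs n u'" "agree x x'" using Suc.IH[OF y(2)] by (auto simp: x'_def)
  have dy: "dig y 0 = a" "dig y (Suc i) = dig x i" for i by (simp_all add: dig_def a_def x_def funpow_swap1)
  obtain i where i: "i \<le> d" "dig y i \<noteq> a" using dig_runs[OF y(1)] by blast
  then obtain k where k: "i = Suc k" using dy by (cases i) auto
  have "\<exists>j<d. dig x' j \<noteq> a" using i k dy x'(2) by (intro exI[of _ k]) (auto simp: agree_def)
  note p = pre_admissible[OF _ this]
  have x'X: "x' \<in> X" using x'(1) by (simp add: preimgs_def)
  have "pre a x' = pre a x + q * (q ^ n * (u' - u))" by (simp add: pre_def x'_def algebra_simps)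
  then have eq: "pre a x' = y + q ^ Suc n * (u' - u)" by (simp add: a_def x_def pre_T)
  have "dig (pre a x') i = dig y i" if "i < d" for i
  proof (cases i)
    case 0
    then show ?thesis using p[OF x'X] dy by (simp add: dig_def)
  next
    case (Suc j)
    have "dig (pre a x') i = dig (T (pre a x')) j" by (simp add: Suc dig_T)
    also have "\<dots> = dig x j" using p[OF x'X] x'(2) that Suc by (simp add: agree_def)
    finally show ?thesis by (simp add: Suc dy)
  qed
  then have "agree y (pre a x')" by (simp add: agree_def)
  moreover have "pre a x' \<in> preimgs (Suc n) u'" using p[OF x'X] x'(1) by (simp add: preimgs_Suc_iff)
  ultimately show ?case by (simp add: eq)
qed

text \<open>The branch of digit 1 is closed at \<open>c\<close>, so moving to the right keeps a
  digit 1, and a digit 0 survives until the iterate reaches \<open>c\<close>.\<close>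

lemma agree_right:
  assumes "u \<in> X"
  obtains \<epsilon> where "\<epsilon> > 0" "\<And>v. 0 \<le> v \<Longrightarrow> v < \<epsilon> \<Longrightarrow> u + v \<in> X \<and> agree u (u + v)"
proof -
  have "\<exists>\<epsilon>>0. \<forall>v. 0 \<le> v \<and> v < \<epsilon> \<longrightarrow> (\<forall>i<n. dig (u + v) i = dig u i) \<and> (T ^^ n) (u + v) = (T ^^ n) u + \<beta> ^ n * v" for n
  proof (induction n)
    case 0
    show ?case by (intro exI[of _ 1]) auto
  next
    case (Suc n)
    then obtain \<epsilon> where e: "\<epsilon> > 0" "\<And>v. 0 \<le> v \<Longrightarrow> v < \<epsilon> \<Longrightarrow>
      (\<forall>i<n. dig (u + v) i = dig u i) \<and> (T ^^ n) (u + v) = (T ^^ n) u + \<beta> ^ n * v" by blast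
    define \<eta> where "\<eta> = (if dig u n then 1 else q ^ n * (c - (T ^^ n) u))"
    have "\<eta> > 0" using q_pow_pos by (auto simp: \<eta>_def dig_def)
    have dn: "dig (u + v) n = dig u n" if v: "0 \<le> v" "v < min \<epsilon> \<eta>" for v
    proof (cases "dig u n")
      case True
      moreover have "0 \<le> \<beta> ^ n * v" using v b1 by simp
      ultimately have "c \<le> (T ^^ n) u + \<beta> ^ n * v" by (simp add: dig_def)
      then show ?thesis using e(2)[of v] v True by (simp add: dig_def)
    next
      case False
      have "\<beta> ^ n * v < \<beta> ^ n * (q ^ n * (c - (T ^^ n) u))" using v False b1 by (simp add: \<eta>_def)
      also have "\<dots> = c - (T ^^ n) u" using beta_pow_q[of n] by (simp flip: mult.assoc)
      finally have "(T ^^ n) u + \<beta> ^ n * v < c" by simp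
      then show ?thesis using e(2)[of v] v False by (simp add: dig_def)
    qed
    have "(\<forall>i<Suc n. dig (u + v) i = dig u i) \<and> (T ^^ Suc n) (u + v) = (T ^^ Suc n) u + \<beta> ^ Suc n * v"
      if v: "0 \<le> v" "v < min \<epsilon> \<eta>" for v
    proof
      show "\<forall>i<Suc n. dig (u + v) i = dig u i" using dn[OF v] e(2)[of v] v by (auto simp: less_Suc_eq)
      have "(c \<le> (T ^^ n) (u + v)) = (c \<le> (T ^^ n) u)" using dn[OF v] by (simp add: dig_def)
      then have "(T ^^ Suc n) (u + v) = \<beta> * (T ^^ n) (u + v) - of_bool (c \<le> (T ^^ n) u)"
        by (simp add: T_def[of "(T ^^ n) (u + v)"])
      also have "(T ^^ n) (u + v) = (T ^^ n) u + \<beta> ^ n * v" using e(2)[of v] v by simp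
      finally show "(T ^^ Suc n) (u + v) = (T ^^ Suc n) u + \<beta> ^ Suc n * v"
        by (simp add: T_def[of "(T ^^ n) u"] distrib_left)
    qed
    then show ?case using \<open>\<eta> > 0\<close> e(1) by (intro exI[of _ "min \<epsilon> \<eta>"]) auto
  qed
  from this[of d] obtain \<epsilon> where e: "\<epsilon> > 0" "\<And>v. 0 \<le> v \<Longrightarrow> v < \<epsilon> \<Longrightarrow> \<forall>i<d. dig (u + v) i = dig u i"
    by blast
  show ?thesis
  proof (rule that[of "min \<epsilon> (c + 1/2 - u)"])
    show "min \<epsilon> (c + 1/2 - u) > 0" using e assms by (auto simp: X_def)
    show "u + v \<in> X \<and> agree u (u + v)" if "0 \<le> v" "v < min \<epsilon> (c + 1/2 - u)" for v
      using e(2)[of v] that assms by (auto simp: X_def agree_def)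
  qed
qed

text \<open>Prefix a point \<open>p\<close> of the backward orbit of \<open>y\<close> with digits of
  a point close to \<open>u\<close>; its first digit is chosen to break the run at the seam.\<close>

lemma preimages_dense:
  assumes u: "u \<in> X" and y: "y \<in> X" and "\<epsilon> > 0"
  obtains x n where "x \<in> X" "u \<le> x" "x < u + \<epsilon>" "x \<in> preimgs n y"
proof -
  define \<epsilon>' where "\<epsilon>' = min \<epsilon> (c + 1/2 - u)"
  have e: "\<epsilon>' > 0" "\<epsilon>' \<le> \<epsilon>" "u + \<epsilon>' \<le> c + 1/2" using assms by (auto simp: \<epsilon>'_def X_def)
  define t where "t = u + \<epsilon>' / 2"
  have t: "t \<in> X" using e u by (auto simp: X_def t_def)
  obtain m0 where m0: "q ^ m0 < \<epsilon>' / 2" using q_pow_small e(1) by (meson half_gt_zero)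
  define m where "m = Suc m0"
  have "q ^ m \<le> q ^ m0" unfolding m_def using q_pos q_lt1 by (intro power_decreasing) auto
  then have m: "q ^ m < \<epsilon>' / 2" using m0 by linarith
  obtain p k where p: "p \<in> preimgs k y" "dig p 0 \<noteq> dig t m0"
  proof (cases "dig y 0 = dig t m0")
    case False
    then show ?thesis using that[of y 0] y by (simp add: preimgs_0)
  next
    case True
    have "0 < d" using d2 by simp
    then have "\<exists>j<d. dig y j \<noteq> (\<not> dig t m0)" using True by (intro exI[of _ 0]) auto
    from pre_admissible[OF y this] show ?thesis
      using that[of "pre (\<not> dig t m0) y" 1] by (auto simp: preimgs_def dig_def)
  qed
  have pX: "p \<in> X" using p(1) by (simp add: preimgs_def)
  have "\<exists>i\<le>d. glue (dig t) m p (j + i) \<noteq> a" for j a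
    by (rule glue_runs[OF pX dig_runs'[OF t]]) (use p(2) in \<open>simp add: m_def\<close>)
  then have w: "cat (dig t) m p \<in> X" "(T ^^ m) (cat (dig t) m p) = p"
    using cat_admissible[OF pX, of "dig t" m] by blast+
  define x where "x = cat (dig t) m p"
  have "\<bar>x - t\<bar> = q ^ m * \<bar>p - (T ^^ m) t\<bar>"
    using cat_add[of "dig t" m p "(T ^^ m) t"] cat_dig[of t m] q_pow_pos[of m] by (simp add: x_def abs_mult)
  also have "\<dots> \<le> q ^ m * 1"
    using X_diff_lt[OF pX T_pow_in_X[OF t], of m] q_pow_pos[of m]
    by (intro mult_left_mono) auto
  finally have "\<bar>x - t\<bar> < \<epsilon>' / 2" using m by simp
  then have "u \<le> x" "x < u + \<epsilon>" using e by (auto simp: t_def abs_if split: if_splits)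
  moreover have "x \<in> preimgs (k + m) y" using w p(1) preimgs_trans[OF p(1), of x m] by (simp add: preimgs_def x_def)
  ultimately show ?thesis using that w by (simp add: x_def)
qed

end

text \<open>The cut-and-project setting in abstract form: the pairs of \<open>u\<close> and
  \<open>\<phi> u\<close> behave like a lattice. \<open>discrete\<close> expresses its discreteness,
  and \<open>dense\<close> says that even a thin one-sided strip in the real coordinate projects to
  a relatively dense set. The conjugates enter with the interpretation \<open>geo\<close>.\<close>

locale rauzy_geometry = dbonacci +
  fixes \<phi> :: "real \<Rightarrow> 'a::euclidean_space" and M :: "'a \<Rightarrow> 'a" and \<rho> :: real
  assumes \<phi>_add: "u \<in> L \<Longrightarrow> v \<in> L \<Longrightarrow> \<phi> (u + v) = \<phi> u + \<phi> v"
    and \<phi>_beta: "u \<in> L \<Longrightarrow> \<phi> (\<beta> * u) = M (\<phi> u)"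
    and linear_M: "linear M" and inj_M: "inj M"
    and norm_M: "norm (M z) \<le> \<rho> * norm z" and rho: "0 < \<rho>" "\<rho> < 1"
    and discrete: "finite {u \<in> L. \<bar>u\<bar> \<le> R \<and> norm (\<phi> u) \<le> R}"
    and dense: "\<epsilon> > 0 \<Longrightarrow> \<exists>R. \<forall>z. \<exists>v\<in>int_adjoin \<beta>. 0 \<le> v \<and> v < \<epsilon> \<and> norm (z - \<phi> v) \<le> R"
begin

text \<open>The sum of the series \<open>norm (\<phi> 1) * \<rho> ^ n\<close>, which bounds the
  total effect of all digits still to be prepended.\<close>

definition E :: real where "E = norm (\<phi> 1) / (1 - \<rho>)"

text \<open>The limit set, encoded by an error bound at every level; this makes closedness and
  translation properties immediate. That it is the Hausdorff limit is shown in
  \<open>rauzy_fractal_\<psi>\<close>.\<close>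

definition K :: "real \<Rightarrow> 'a set" where
  "K u = {z. \<forall>n. \<exists>y\<in>preimgs n u. norm (z - \<phi> (\<beta> ^ n * y)) \<le> E * \<rho> ^ n}"

definition C :: "real \<Rightarrow> 'a \<Rightarrow> real set" where
  "C w z = {u \<in> X. u - w \<in> int_adjoin \<beta> \<and> z \<in> K u}"

lemma \<phi>_0 [simp]: "\<phi> 0 = 0"
  using \<phi>_add[of 0 0] by simp

lemma \<phi>_diff: "u \<in> L \<Longrightarrow> v \<in> L \<Longrightarrow> \<phi> (u - v) = \<phi> u - \<phi> v"
  using \<phi>_add[of "u - v" v] by simp

lemma \<phi>_pow: "u \<in> L \<Longrightarrow> \<phi> (\<beta> ^ n * u) = (M ^^ n) (\<phi> u)"
proof (induction n)
  case (Suc n)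
  then show ?case using \<phi>_beta[of "\<beta> ^ n * u"] by (simp add: mult.assoc)
qed simp

lemma linear_M_pow: "linear (M ^^ n)"
proof (induction n)
  case 0
  show ?case by (simp add: linear_iff)
next
  case (Suc n)
  show ?case unfolding funpow.simps by (rule linear_compose[OF Suc linear_M])
qed

lemma inj_M_pow: "inj (M ^^ n)"
proof (induction n)
  case (Suc n)
  show ?case unfolding funpow.simps by (rule inj_compose[OF inj_M Suc])
qed simp

lemma bij_M_pow: "bij (M ^^ n)"
  unfolding bij_def using inj_M_pow linear_inj_imp_surj[OF linear_M_pow inj_M_pow] by blast

lemma norm_M_pow: "norm ((M ^^ n) z) \<le> \<rho> ^ n * norm z"
proof (induction n)
  case (Suc n)
  have "norm ((M ^^ Suc n) z) \<le> \<rho> * norm ((M ^^ n) z)" by (simp add: norm_M)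
  also have "\<dots> \<le> \<rho> * (\<rho> ^ n * norm z)" using Suc rho by (intro mult_left_mono) auto
  finally show ?case by (simp add: mult.assoc)
qed simp

lemma E_nonneg: "0 \<le> E"
  using rho by (simp add: E_def)

lemma rho_pow: "0 < \<rho> ^ n" "\<rho> ^ n \<le> 1"
  using rho by (auto intro: power_le_one)

lemma ancestor_step:
  assumes "y \<in> L"
  shows "norm (\<phi> (\<beta> ^ Suc n * y) - \<phi> (\<beta> ^ n * T y)) \<le> E * \<rho> ^ n - E * \<rho> ^ Suc n"
proof -
  have "\<beta> ^ Suc n * y = \<beta> ^ n * T y + \<beta> ^ n * of_bool (c \<le> y)" by (simp add: T_def algebra_simps)
  then have "\<phi> (\<beta> ^ Suc n * y) = \<phi> (\<beta> ^ n * T y) + (M ^^ n) (\<phi> (of_bool (c \<le> y)))"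
    using assms by (simp add: \<phi>_add \<phi>_pow T_L_iff Zb_in_L del: power_Suc)
  then have "norm (\<phi> (\<beta> ^ Suc n * y) - \<phi> (\<beta> ^ n * T y)) \<le> \<rho> ^ n * norm (\<phi> (of_bool (c \<le> y)))"
    using norm_M_pow[of n "\<phi> (of_bool (c \<le> y))"] by (simp del: power_Suc)
  also have "\<dots> \<le> \<rho> ^ n * norm (\<phi> 1)" using rho by (intro mult_left_mono) auto
  also have "norm (\<phi> 1) = E * (1 - \<rho>)" using rho by (simp add: E_def)
  finally show ?thesis by (simp add: algebra_simps)
qed

lemma ancestor_dist:
  assumes "y \<in> L"
  shows "norm (\<phi> (\<beta> ^ (m + k) * y) - \<phi> (\<beta> ^ m * (T ^^ k) y)) \<le> E * \<rho> ^ m - E * \<rho> ^ (m + k)"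
  using assms
proof (induction k arbitrary: y)
  case (Suc k)
  have "norm (\<phi> (\<beta> ^ (m + k) * T y) - \<phi> (\<beta> ^ m * (T ^^ k) (T y))) \<le> E * \<rho> ^ m - E * \<rho> ^ (m + k)"
    using Suc by (simp add: T_L_iff)
  moreover have "(T ^^ k) (T y) = (T ^^ Suc k) y" by (simp add: funpow_swap1)
  moreover have "norm (\<phi> (\<beta> ^ Suc (m + k) * y) - \<phi> (\<beta> ^ (m + k) * T y)) \<le> E * \<rho> ^ (m + k) - E * \<rho> ^ Suc (m + k)"
    by (rule ancestor_step[OF Suc.prems])
  ultimately show ?case
    using norm_triangle_le_diff[of "\<phi> (\<beta> ^ Suc (m + k) * y) - \<phi> (\<beta> ^ (m + k) * T y)"]
      norm_triangle_ineq[of "\<phi> (\<beta> ^ Suc (m + k) * y) - \<phi> (\<beta> ^ (m + k) * T y)"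
        "\<phi> (\<beta> ^ (m + k) * T y) - \<phi> (\<beta> ^ m * (T ^^ k) (T y))"]
    by (simp only: add_Suc_right diff_add_cancel add_diff_eq)
qed simp

text \<open>Approximation along infinitely many levels, with any constant, is enough. The ancestor
  at level \<open>m\<close> of an approximant at a high level is a good one for level
  \<open>m\<close>, up to an error that vanishes, and since level \<open>m\<close> is finite the
  error cannot persist.\<close>

lemma K_memI:
  assumes u: "u \<in> L" and inf: "\<And>k. \<exists>n\<ge>k. \<exists>y\<in>preimgs n u. norm (z - \<phi> (\<beta> ^ n * y)) \<le> B * \<rho> ^ n"
  shows "z \<in> K u"
proof -
  have "\<exists>y\<in>preimgs m u. norm (z - \<phi> (\<beta> ^ m * y)) \<le> E * \<rho> ^ m" for m
  proof (rule ccontr)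
    assume *: "\<not> ?thesis"
    define S where "S = (\<lambda>y. norm (z - \<phi> (\<beta> ^ m * y)) - E * \<rho> ^ m) ` preimgs m u"
    have fS: "finite S" by (simp add: S_def finite_preimgs)
    have S_pos: "s > 0" if "s \<in> S" for s using * that by (auto simp: S_def not_le)
    define \<eta> where "\<eta> = Min (insert 1 S)"
    have \<eta>: "\<eta> > 0" using fS S_pos by (simp add: \<eta>_def)
    have \<eta>_le: "\<eta> \<le> norm (z - \<phi> (\<beta> ^ m * y)) - E * \<rho> ^ m" if "y \<in> preimgs m u" for y
      using that fS by (auto simp: \<eta>_def S_def intro!: Min_le)
    have "(\<lambda>n. B * \<rho> ^ n) \<longlonglongrightarrow> B * 0"
      using rho by (intro tendsto_intros LIMSEQ_power_zero) auto
    then have "\<forall>\<^sub>F n in sequentially. B * \<rho> ^ n < \<eta>" using \<eta> by (simp add: order_tendstoD(2))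
    then obtain k where k: "\<And>n. n \<ge> k \<Longrightarrow> B * \<rho> ^ n < \<eta>" by (auto simp: eventually_sequentially)
    obtain n y where n: "n \<ge> max k m" and y: "y \<in> preimgs n u" "norm (z - \<phi> (\<beta> ^ n * y)) \<le> B * \<rho> ^ n"
      using inf by blast
    define x where "x = (T ^^ (n - m)) y"
    have "n = m + (n - m)" using n by simp
    then have x: "x \<in> preimgs m u" using y(1) preimgs_add unfolding x_def by metis
    have "norm (\<phi> (\<beta> ^ n * y) - \<phi> (\<beta> ^ m * x)) \<le> E * \<rho> ^ m - E * \<rho> ^ n"
      using ancestor_dist[OF preimgs_L[OF u y(1)], of m "n - m"] n by (simp add: x_def)
    moreover have "0 \<le> E * \<rho> ^ n" using E_nonneg rho_pow[of n] by simp
    moreover have "norm (z - \<phi> (\<beta> ^ m * x)) \<le> norm (z - \<phi> (\<beta> ^ n * y)) + norm (\<phi> (\<beta> ^ n * y) - \<phi> (\<beta> ^ m * x))"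
      by (metis norm_triangle_ineq add_diff_eq diff_add_cancel)
    ultimately show False using \<eta>_le[OF x] y(2) k[of n] n by simp
  qed
  then show ?thesis by (simp add: K_def)
qed

lemma K_norm: "u \<in> X \<Longrightarrow> z \<in> K u \<Longrightarrow> norm (z - \<phi> u) \<le> E"
proof -
  assume u: "u \<in> X" and "z \<in> K u"
  then have "\<exists>y\<in>preimgs 0 u. norm (z - \<phi> (\<beta> ^ 0 * y)) \<le> E * \<rho> ^ 0" unfolding K_def by blast
  then show ?thesis using u by (simp add: preimgs_0)
qed

lemma compact_K:
  assumes "u \<in> X" shows "compact (K u)"
proof -
  have "K u = (\<Inter>n. \<Union>y\<in>preimgs n u. cball (\<phi> (\<beta> ^ n * y)) (E * \<rho> ^ n))"
    by (auto simp: K_def dist_norm norm_minus_commute)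
  then have "closed (K u)" by (simp add: closed_INT closed_UN finite_preimgs)
  moreover have "K u \<subseteq> cball (\<phi> u) E" using K_norm[OF assms] by (auto simp: dist_norm norm_minus_commute)
  ultimately show ?thesis by (meson compact_eq_bounded_closed bounded_subset bounded_cball)
qed

text \<open>Extend \<open>y\<close> to an infinite backward orbit. The associated points stay in a
  ball, and any of their limit points lies in \<open>K u\<close>. This is the half of Hausdorff
  convergence that the definition of \<open>K\<close> does not contain.\<close>

lemma K_approx:
  assumes u: "u \<in> X" "u \<in> L" and y: "y \<in> preimgs n u"
  obtains z where "z \<in> K u" "norm (z - \<phi> (\<beta> ^ n * y)) \<le> E * \<rho> ^ n"
proof -
  have yX: "y \<in> X" using y by (simp add: preimgs_def)
  have "\<exists>s. \<forall>k. (s k \<in> X \<and> (k = 0 \<longrightarrow> s k = y)) \<and> s (Suc k) \<in> preimgs 1 (s k)"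
  proof (rule dependent_nat_choice)
    show "\<exists>x. x \<in> X \<and> (0 = (0::nat) \<longrightarrow> x = y)" using yX by blast
    fix x and k :: nat
    assume "x \<in> X \<and> (k = 0 \<longrightarrow> x = y)"
    then obtain x' where "x' \<in> preimgs 1 x" using preimgs_1_nonempty by blast
    then show "\<exists>x'. (x' \<in> X \<and> (Suc k = 0 \<longrightarrow> x' = y)) \<and> x' \<in> preimgs 1 x"
      by (intro exI[of _ x']) (simp add: preimgs_def)
  qed
  then obtain s where s0: "s 0 = y" and sS: "\<And>k. s k \<in> X \<and> s (Suc k) \<in> preimgs 1 (s k)" by metis
  have sp: "s (k + j) \<in> preimgs j (s k)" for k j
  proof (induction j)
    case 0
    then show ?case using sS by (simp add: preimgs_0)
  next
    case (Suc j)
    have "s (Suc (k + j)) \<in> preimgs 1 (s (k + j))" using sS by blast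
    from preimgs_trans[OF Suc this] show ?case by simp
  qed
  have su: "s k \<in> preimgs (n + k) u" for k using preimgs_trans[OF y] sp[of 0 k] s0 by simp
  define p where "p k = \<phi> (\<beta> ^ (n + k) * s k)" for k
  have pd: "norm (p (k + j) - p k) \<le> E * \<rho> ^ (n + k)" for k j
  proof -
    have "(T ^^ j) (s (k + j)) = s k" using sp[of k j] by (simp add: preimgs_def)
    then have "norm (p (k + j) - p k) \<le> E * \<rho> ^ (n + k) - E * \<rho> ^ (n + k + j)"
      using ancestor_dist[OF preimgs_L[OF u(2) su], of "n + k" j "k + j"] by (simp add: p_def add.assoc)
    moreover have "0 \<le> E * \<rho> ^ (n + k + j)" using E_nonneg rho_pow[of "n + k + j"] by simp
    ultimately show ?thesis by linarith
  qed
  have "p k \<in> cball (p 0) (E * \<rho> ^ n)" for k using pd[of 0 k] by (simp add: dist_norm norm_minus_commute)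
  then obtain z r where r: "strict_mono r" "(p \<circ> r) \<longlonglongrightarrow> z"
    using compact_cball[of "p 0" "E * \<rho> ^ n"] unfolding compact_def by meson
  have zp: "norm (z - p k) \<le> E * \<rho> ^ (n + k)" for k
  proof (rule Lim_norm_ubound[of sequentially])
    show "(\<lambda>j. (p \<circ> r) j - p k) \<longlonglongrightarrow> z - p k" by (intro tendsto_intros r(2))
    show "\<forall>\<^sub>F j in sequentially. norm ((p \<circ> r) j - p k) \<le> E * \<rho> ^ (n + k)"
      using eventually_ge_at_top[of k]
    proof eventually_elim
      case (elim j)
      then have "r j \<ge> k" using seq_suble[OF r(1), of j] by simp
      then show ?case using pd[of k "r j - k"] by simp
    qed
  qed simp
  have "z \<in> K u"
  proof (rule K_memI[OF u(2)])
    show "\<exists>m\<ge>k. \<exists>y\<in>preimgs m u. norm (z - \<phi> (\<beta> ^ m * y)) \<le> E * \<rho> ^ m" for k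
      using zp[of k] su[of k] by (intro exI[of _ "n + k"] conjI bexI[of _ "s k"]) (auto simp: p_def)
  qed
  then show ?thesis using that[of z] zp[of 0] s0 by (simp add: p_def)
qed

lemma K_nonempty: "u \<in> X \<Longrightarrow> u \<in> L \<Longrightarrow> K u \<noteq> {}"
  using K_approx[of u u 0] preimgs_0 by auto

lemma pigeonhole_inf:
  assumes "finite S" "\<And>n::nat. f n \<in> S"
  obtains y where "y \<in> S" "\<And>k. \<exists>n\<ge>k. f n = y"
proof -
  have "finite (range f)" using assms finite_subset by (metis image_subsetI)
  then obtain y where "infinite {n. f n = y}"
    using pigeonhole_infinite[of UNIV f] by auto
  then have "\<exists>n\<ge>k. f n = y" for k by (metis (mono_tags, lifting) infinite_nat_iff_unbounded_le mem_Collect_eq)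
  then show ?thesis using that assms by metis
qed

text \<open>The set equation of the tiles. For the nontrivial inclusion, infinitely many
  approximants of \<open>z\<close> pass through the same one of the finitely many preimages of
  \<open>u\<close>. Applying the inverse of \<open>M\<close> worsens their errors only by a
  constant, which \<open>K_memI\<close> tolerates.\<close>

lemma K_decomp:
  assumes u: "u \<in> X" "u \<in> L"
  shows "K u = (\<Union>y\<in>preimgs 1 u. M ` K y)"
proof (intro subset_antisym subsetI)
  fix z assume "z \<in> (\<Union>y\<in>preimgs 1 u. M ` K y)"
  then obtain y w where y: "y \<in> preimgs 1 u" "w \<in> K y" "z = M w" by blast
  show "z \<in> K u"
  proof (rule K_memI[OF u(2)])
    fix k
    obtain x where x: "x \<in> preimgs k y" "norm (w - \<phi> (\<beta> ^ k * x)) \<le> E * \<rho> ^ k"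
      using y(2) by (auto simp: K_def)
    have xL: "x \<in> L" using preimgs_L[OF preimgs_L[OF u(2) y(1)] x(1)] .
    have "z - \<phi> (\<beta> ^ Suc k * x) = M (w - \<phi> (\<beta> ^ k * x))"
      using \<phi>_beta[of "\<beta> ^ k * x"] xL linear_diff[OF linear_M] y(3) by (simp add: mult.assoc)
    then have "norm (z - \<phi> (\<beta> ^ Suc k * x)) \<le> \<rho> * norm (w - \<phi> (\<beta> ^ k * x))"
      using norm_M[of "w - \<phi> (\<beta> ^ k * x)"] by simp
    also have "\<dots> \<le> \<rho> * (E * \<rho> ^ k)" using x(2) rho by (intro mult_left_mono) auto
    finally have "norm (z - \<phi> (\<beta> ^ Suc k * x)) \<le> \<rho> * (E * \<rho> ^ k)" .
    moreover have "x \<in> preimgs (Suc k) u" using preimgs_trans[OF y(1) x(1)] by simp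
    ultimately show "\<exists>n\<ge>k. \<exists>y\<in>preimgs n u. norm (z - \<phi> (\<beta> ^ n * y)) \<le> E * \<rho> ^ n"
      by (intro exI[of _ "Suc k"]) (auto simp: mult_ac)
  qed
next
  fix z assume z: "z \<in> K u"
  have "\<exists>x. \<forall>n. x n \<in> preimgs (Suc n) u \<and> norm (z - \<phi> (\<beta> ^ Suc n * x n)) \<le> E * \<rho> ^ Suc n"
  proof (rule choice, rule allI)
    fix n
    from z have "\<exists>y\<in>preimgs (Suc n) u. norm (z - \<phi> (\<beta> ^ Suc n * y)) \<le> E * \<rho> ^ Suc n"
      unfolding K_def by blast
    then show "\<exists>y. y \<in> preimgs (Suc n) u \<and> norm (z - \<phi> (\<beta> ^ Suc n * y)) \<le> E * \<rho> ^ Suc n"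
      by blast
  qed
  then obtain x where x: "\<And>n. x n \<in> preimgs (Suc n) u" "\<And>n. norm (z - \<phi> (\<beta> ^ Suc n * x n)) \<le> E * \<rho> ^ Suc n"
    by blast
  have "(T ^^ n) (x n) \<in> preimgs 1 u" for n using preimgs_add[of "x n" 1 n] x(1)[of n] by simp
  from pigeonhole_inf[of _ "\<lambda>n. (T ^^ n) (x n)", OF finite_preimgs this]
  obtain y where y: "y \<in> preimgs 1 u" "\<And>k. \<exists>n\<ge>k. (T ^^ n) (x n) = y"
    by metis
  obtain w where w: "z = M w" using bij_M_pow[of 1] by (auto simp: bij_def surj_def)
  obtain N where N: "linear N" "\<And>v. N (M v) = v"
    using linear_injective_left_inverse[OF linear_M inj_M] by (metis o_apply id_apply)
  obtain B where B: "\<And>v. norm (N v) \<le> B * norm v" using linear_bounded[OF N(1)] by blast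
  have "w \<in> K y"
  proof (rule K_memI[OF preimgs_L[OF u(2) y(1)], of _ "\<bar>B\<bar> * (E * \<rho>)"])
    fix k
    obtain n where n: "n \<ge> k" "(T ^^ n) (x n) = y" using y(2) by blast
    have xL: "x n \<in> L" using preimgs_L[OF u(2) x(1)] .
    have "w - \<phi> (\<beta> ^ n * x n) = N (z - \<phi> (\<beta> ^ Suc n * x n))"
      using \<phi>_beta[of "\<beta> ^ n * x n"] xL N linear_diff[OF N(1)] w by (simp add: mult.assoc)
    then have "norm (w - \<phi> (\<beta> ^ n * x n)) \<le> B * norm (z - \<phi> (\<beta> ^ Suc n * x n))" using B by simp
    also have "\<dots> \<le> \<bar>B\<bar> * norm (z - \<phi> (\<beta> ^ Suc n * x n))" by (intro mult_right_mono) auto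
    also have "\<dots> \<le> \<bar>B\<bar> * (E * \<rho> ^ Suc n)" using x(2) by (intro mult_left_mono) auto
    finally have "norm (w - \<phi> (\<beta> ^ n * x n)) \<le> \<bar>B\<bar> * (E * \<rho>) * \<rho> ^ n" by (simp add: mult_ac)
    moreover have "x n \<in> preimgs n y" using x(1)[of n] n by (simp add: preimgs_def)
    ultimately show "\<exists>n\<ge>k. \<exists>x\<in>preimgs n y. norm (w - \<phi> (\<beta> ^ n * x)) \<le> \<bar>B\<bar> * (E * \<rho>) * \<rho> ^ n"
      using n(1) by blast
  qed
  then show "z \<in> (\<Union>y\<in>preimgs 1 u. M ` K y)" using w y(1) by blast
qed

lemma K_translate:
  assumes u: "u \<in> X" "u \<in> L" and u': "u' \<in> X" "u' \<in> L" and "agree u u'"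
  shows "K u' = (+) (\<phi> (u' - u)) ` K u"
proof -
  have sub: "z + \<phi> (u' - u) \<in> K u'" if u: "u \<in> X" "u \<in> L" and u': "u' \<in> X" "u' \<in> L" and "agree u u'" "z \<in> K u"
    for u u' z
  proof (rule K_memI[OF u'(2)])
    fix k
    obtain y where y: "y \<in> preimgs k u" "norm (z - \<phi> (\<beta> ^ k * y)) \<le> E * \<rho> ^ k"
      using \<open>z \<in> K u\<close> by (auto simp: K_def)
    define y' where "y' = y + q ^ k * (u' - u)"
    have "y' \<in> preimgs k u'" using agree_preimgs[OF u(1) u'(1) \<open>agree u u'\<close> y(1)] by (simp add: y'_def)
    moreover have "\<beta> ^ k * y' = \<beta> ^ k * y + (u' - u)"
      using beta_pow_q[of k] by (simp add: y'_def distrib_left flip: mult.assoc)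
    then have "\<phi> (\<beta> ^ k * y') = \<phi> (\<beta> ^ k * y) + \<phi> (u' - u)"
      using preimgs_L[OF u(2) y(1)] u u' by (simp add: \<phi>_add)
    ultimately show "\<exists>n\<ge>k. \<exists>y\<in>preimgs n u'. norm (z + \<phi> (u' - u) - \<phi> (\<beta> ^ n * y)) \<le> E * \<rho> ^ n"
      using y(2) by (intro exI[of _ k] conjI bexI[of _ y']) simp_all
  qed
  have "agree u' u" using assms(5) by (simp add: agree_def)
  show ?thesis
  proof (intro subset_antisym subsetI)
    fix z assume "z \<in> K u'"
    then have "z + \<phi> (u - u') \<in> K u" using sub[OF u' u \<open>agree u' u\<close>] by simp
    then show "z \<in> (+) (\<phi> (u' - u)) ` K u"
      using u u' by (intro image_eqI[of _ _ "z + \<phi> (u - u')"]) (auto simp: \<phi>_diff)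
  qed (use sub[OF u u' assms(5)] in \<open>auto simp: add.commute\<close>)
qed

lemma K_locally_finite:
  assumes "bounded B"
  shows "finite {u \<in> X \<inter> L. K u \<inter> B \<noteq> {}}"
proof -
  obtain b where b: "\<And>z. z \<in> B \<Longrightarrow> norm z \<le> b" using assms bounded_iff by blast
  have "{u \<in> X \<inter> L. K u \<inter> B \<noteq> {}} \<subseteq> {u \<in> L. \<bar>u\<bar> \<le> max (c + 1) (b + E) \<and> norm (\<phi> u) \<le> max (c + 1) (b + E)}"
  proof
    fix u assume "u \<in> {u \<in> X \<inter> L. K u \<inter> B \<noteq> {}}"
    then obtain z where u: "u \<in> X" "u \<in> L" "z \<in> K u" "z \<in> B" by blast
    have "norm (\<phi> u) \<le> norm z + norm (z - \<phi> u)"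
      using norm_triangle_ineq4[of z "z - \<phi> u"] by simp
    then have "norm (\<phi> u) \<le> b + E" using K_norm[OF u(1,3)] b[OF u(4)] by linarith
    moreover have "\<bar>u\<bar> \<le> c + 1" using u(1) c_pos by (auto simp: X_def)
    ultimately show "u \<in> {u \<in> L. \<bar>u\<bar> \<le> max (c + 1) (b + E) \<and> norm (\<phi> u) \<le> max (c + 1) (b + E)}"
      using u(2) by auto
  qed
  then show ?thesis using discrete finite_subset by blast
qed

section \<open>Points of one coset whose tiles meet\<close>

lemma C_subset: "w \<in> L \<Longrightarrow> C w z \<subseteq> X \<inter> L"
proof
  fix u assume "w \<in> L" "u \<in> C w z"
  then have u: "u \<in> X" "u - w \<in> int_adjoin \<beta>" by (auto simp: C_def)
  have "w + (u - w) \<in> L" by (rule L_add[OF \<open>w \<in> L\<close> Zb_in_L[OF u(2)]])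
  with u(1) show "u \<in> X \<inter> L" by simp
qed

lemma finite_C: "w \<in> L \<Longrightarrow> finite (C w z)"
  by (rule finite_subset[OF _ K_locally_finite[of "{z}"]]) (use C_subset in \<open>auto simp: C_def\<close>)

lemma coset_dense:
  assumes w: "w \<in> L"
  obtains R where "R \<ge> 0" "\<And>z. \<exists>y\<in>X. y - w \<in> int_adjoin \<beta> \<and> norm (z - \<phi> y) \<le> R"
proof -
  define k where "k = \<lfloor>w - (c - 1/2)\<rfloor>"
  define y0 where "y0 = w - of_int k"
  have y0: "y0 \<in> X" unfolding X_def y0_def k_def by (simp, linarith)
  have y0L: "y0 \<in> L" unfolding y0_def by (rule L_diff[OF w Zb_in_L]) simp
  have "c + 1/2 - y0 > 0" using y0 by (simp add: X_def)
  then obtain R where R: "\<And>z. \<exists>v\<in>int_adjoin \<beta>. 0 \<le> v \<and> v < c + 1/2 - y0 \<and> norm (z - \<phi> v) \<le> R"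
    using dense by blast
  have "R \<ge> 0" using R[of 0] norm_ge_zero order_trans by blast
  moreover have "\<exists>y\<in>X. y - w \<in> int_adjoin \<beta> \<and> norm (z - \<phi> y) \<le> R" for z
  proof -
    obtain v where v: "v \<in> int_adjoin \<beta>" "0 \<le> v" "v < c + 1/2 - y0" "norm (z - \<phi> y0 - \<phi> v) \<le> R"
      using R by blast
    have "y0 + v \<in> X" using y0 v by (simp add: X_def)
    moreover have "y0 + v - w = v - of_int k" by (simp add: y0_def)
    moreover have "v - of_int k \<in> int_adjoin \<beta>" using v by simp
    moreover have "norm (z - \<phi> (y0 + v)) \<le> R"
      using v(4) \<phi>_add[OF y0L Zb_in_L[OF v(1)]] by (simp add: diff_diff_eq)
    ultimately show ?thesis by metis
  qed
  ultimately show ?thesis using that by blast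
qed

lemma T_pow_coset: "w \<in> L \<Longrightarrow> y - w \<in> int_adjoin \<beta> \<Longrightarrow> (T ^^ n) y - w \<in> int_adjoin \<beta>"
proof (induction n)
  case (Suc n)
  have "w + ((T ^^ n) y - w) \<in> L" by (rule L_add[OF Suc(2) Zb_in_L[OF Suc.IH[OF Suc.prems]]])
  then have "T ((T ^^ n) y) - (T ^^ n) y \<in> int_adjoin \<beta>" using T_minus_in_Zb by simp
  then have "T ((T ^^ n) y) - (T ^^ n) y + ((T ^^ n) y - w) \<in> int_adjoin \<beta>"
    using Suc.IH[OF Suc.prems] int_adjoin_add by blast
  then show ?case by simp
qed simp

text \<open>Pull \<open>z\<close> back by \<open>M ^^ n\<close>, approximate the result by a point
  of the coset, and apply \<open>T ^^ n\<close> to that point. The results lie in a finite set by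
  \<open>discrete\<close>, so one of them occurs for infinitely many \<open>n\<close>, and its tile
  contains \<open>z\<close>.\<close>

lemma K_covering:
  assumes w: "w \<in> L"
  shows "C w z \<noteq> {}"
proof -
  obtain R where R: "R \<ge> 0" "\<And>z. \<exists>y\<in>X. y - w \<in> int_adjoin \<beta> \<and> norm (z - \<phi> y) \<le> R"
    using coset_dense[OF w] by blast
  have "\<exists>y. \<forall>n. y n \<in> X \<and> y n - w \<in> int_adjoin \<beta> \<and> norm (z - \<phi> (\<beta> ^ n * y n)) \<le> R * \<rho> ^ n"
  proof (rule choice, rule allI)
    fix n
    obtain z' where z': "z = (M ^^ n) z'" using bij_M_pow[of n] by (auto simp: bij_def surj_def)
    obtain y where y: "y \<in> X" "y - w \<in> int_adjoin \<beta>" "norm (z' - \<phi> y) \<le> R" using R by blast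
    have "w + (y - w) \<in> L" by (rule L_add[OF w Zb_in_L[OF y(2)]])
    then have "z - \<phi> (\<beta> ^ n * y) = (M ^^ n) (z' - \<phi> y)"
      by (simp add: \<phi>_pow z' linear_diff[OF linear_M_pow])
    then have "norm (z - \<phi> (\<beta> ^ n * y)) \<le> \<rho> ^ n * norm (z' - \<phi> y)" using norm_M_pow by metis
    also have "\<dots> \<le> \<rho> ^ n * R" using y(3) rho by (intro mult_left_mono) auto
    finally show "\<exists>y. y \<in> X \<and> y - w \<in> int_adjoin \<beta> \<and> norm (z - \<phi> (\<beta> ^ n * y)) \<le> R * \<rho> ^ n"
      using y by (auto simp: mult.commute)
  qed
  then obtain y where y: "\<And>n. y n \<in> X" "\<And>n. y n - w \<in> int_adjoin \<beta>"
    "\<And>n. norm (z - \<phi> (\<beta> ^ n * y n)) \<le> R * \<rho> ^ n" by blast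
  define u where "u n = (T ^^ n) (y n)" for n
  define B where "B = max (c + 1) (norm z + R + E)"
  have uin: "u n \<in> {u \<in> L. \<bar>u\<bar> \<le> B \<and> norm (\<phi> u) \<le> B}" for n
  proof -
    have yL: "y n \<in> L" using L_add[OF w Zb_in_L[OF y(2)[of n]]] by simp
    have "norm (\<phi> (\<beta> ^ n * y n) - \<phi> (u n)) \<le> E - E * \<rho> ^ n"
      using ancestor_dist[OF yL, of 0 n] by (simp add: u_def)
    moreover have "0 \<le> E * \<rho> ^ n" using E_nonneg rho_pow[of n] by simp
    moreover have "R * \<rho> ^ n \<le> R * 1" using R(1) rho_pow[of n] by (intro mult_left_mono) auto
    moreover have "norm (\<phi> (u n)) \<le> norm z + norm (z - \<phi> (\<beta> ^ n * y n)) + norm (\<phi> (\<beta> ^ n * y n) - \<phi> (u n))"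
      using norm_triangle_ineq4[of z "z - \<phi> (\<beta> ^ n * y n)"]
        norm_triangle_ineq4[of "\<phi> (\<beta> ^ n * y n)" "\<phi> (\<beta> ^ n * y n) - \<phi> (u n)"] by simp
    ultimately have "norm (\<phi> (u n)) \<le> norm z + R + E" using y(3)[of n] by linarith
    moreover have "u n \<in> X" using T_pow_in_X[OF y(1)] by (simp add: u_def)
    then have "\<bar>u n\<bar> \<le> c + 1" using c_pos by (auto simp: X_def)
    moreover have "u n \<in> L" using yL by (simp add: u_def T_pow_L_iff)
    ultimately show ?thesis by (simp add: B_def le_max_iff_disj)
  qed
  obtain v where v: "v \<in> {u \<in> L. \<bar>u\<bar> \<le> B \<and> norm (\<phi> u) \<le> B}" "\<And>k. \<exists>n\<ge>k. u n = v"
    by (rule pigeonhole_inf[of "{u \<in> L. \<bar>u\<bar> \<le> B \<and> norm (\<phi> u) \<le> B}" u, OF discrete uin]) (rule that; assumption)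
  have vL: "v \<in> L" using v(1) by simp
  have "z \<in> K v"
  proof (rule K_memI[OF vL])
    fix k
    obtain n where n: "n \<ge> k" "u n = v" using v(2) by blast
    then have "y n \<in> preimgs n v" using y(1) by (simp add: preimgs_def u_def)
    then show "\<exists>n\<ge>k. \<exists>y\<in>preimgs n v. norm (z - \<phi> (\<beta> ^ n * y)) \<le> R * \<rho> ^ n"
      using n(1) y(3) by blast
  qed
  moreover obtain n where n: "u n = v" using v(2) by blast
  then have "v \<in> X" "v - w \<in> int_adjoin \<beta>"
    using T_pow_in_X[OF y(1)] T_pow_coset[OF w y(2)] by (auto simp: u_def)
  ultimately show ?thesis by (auto simp: C_def)
qed

lemma C_M:
  assumes w: "w \<in> L"
  shows "C w (M z) = T ` C w z"
proof (intro subset_antisym subsetI)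
  fix u assume u: "u \<in> C w (M z)"
  then have uX: "u \<in> X" "u \<in> L" using C_subset[OF w] by auto
  have "M z \<in> K u" using u by (simp add: C_def)
  then obtain y where y: "y \<in> preimgs 1 u" "M z \<in> M ` K y" using K_decomp[OF uX] by blast
  then have "z \<in> K y" using inj_M by (auto simp: inj_image_mem_iff)
  moreover have Ty: "T y = u" "y \<in> X" using y(1) by (auto simp: preimgs_def)
  moreover have "y - w \<in> int_adjoin \<beta>"
  proof -
    have "T y - y \<in> int_adjoin \<beta>" using T_minus_in_Zb preimgs_L[OF uX(2) y(1)] by blast
    moreover have "u - w \<in> int_adjoin \<beta>" using u by (simp add: C_def)
    moreover have "y - w = (u - w) - (T y - y)" using Ty by simp
    ultimately show ?thesis by (metis int_adjoin_diff)
  qed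
  ultimately show "u \<in> T ` C w z" by (auto simp: C_def)
next
  fix u assume "u \<in> T ` C w z"
  then obtain y where y: "y \<in> C w z" "u = T y" by blast
  then have yX: "y \<in> X" "y \<in> L" "z \<in> K y" "y - w \<in> int_adjoin \<beta>"
    using C_subset[OF w] by (auto simp: C_def)
  have u: "u \<in> X" "u \<in> L" using yX y(2) by (auto simp: T_in_X T_L_iff)
  have "y \<in> preimgs 1 u" using yX y(2) by (simp add: preimgs_def)
  then have "M z \<in> K u" using K_decomp[OF u] yX(3) by blast
  moreover have "u - w \<in> int_adjoin \<beta>" using T_pow_coset[OF w yX(4), of 1] y(2) by simp
  ultimately show "u \<in> C w (M z)" using u(1) by (simp add: C_def)
qed

lemma C_M_pow: "w \<in> L \<Longrightarrow> C w ((M ^^ n) z) = (T ^^ n) ` C w z"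
  by (induction n) (simp_all add: C_M image_comp)

lemma C_translate:
  assumes w: "w \<in> L"
  obtains \<epsilon> where "\<epsilon> > 0"
    "\<And>z v. norm (z - z0) \<le> r \<Longrightarrow> v \<in> int_adjoin \<beta> \<Longrightarrow> 0 \<le> v \<Longrightarrow> v < \<epsilon> \<Longrightarrow>
       C w (z + \<phi> v) = (\<lambda>u. u + v) ` C w z"
proof -
  define B where "B = max (c + 2) (norm z0 + r + E)"
  \<comment> \<open>Also contains candidates outside \<open>X\<close>: a point just left of
    \<open>X\<close> must not be moved into it by \<open>v\<close>. A finite set of candidates gives
    one \<epsilon> for the whole ball around \<open>z0\<close>.\<close>
  define Q where "Q = {t \<in> L. \<bar>t\<bar> \<le> B \<and> norm (\<phi> t) \<le> B}"
  have fQ: "finite Q" unfolding Q_def by (rule discrete)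
  have "\<exists>\<epsilon>>0. \<forall>v. 0 \<le> v \<and> v < \<epsilon> \<longrightarrow> (t \<in> X \<longrightarrow> t + v \<in> X \<and> agree t (t + v)) \<and> (t < c - 1/2 \<longrightarrow> t + v < c - 1/2)" for t
  proof (cases "t \<in> X")
    case True
    then obtain \<epsilon> where "\<epsilon> > 0" "\<And>v. 0 \<le> v \<Longrightarrow> v < \<epsilon> \<Longrightarrow> t + v \<in> X \<and> agree t (t + v)"
      using agree_right by blast
    then show ?thesis using True by (intro exI[of _ \<epsilon>]) (auto simp: X_def)
  next
    case False
    show ?thesis
    proof (cases "t < c - 1/2")
      case True
      then show ?thesis using False by (intro exI[of _ "c - 1/2 - t"]) auto
    qed (use False in \<open>auto intro: exI[of _ 1]\<close>)
  qed
  then obtain \<eta> where \<eta>: "\<And>t. \<eta> t > (0::real)" "\<And>t v. 0 \<le> v \<Longrightarrow> v < \<eta> t \<Longrightarrow> t \<in> X \<Longrightarrow> t + v \<in> X \<and> agree t (t + v)"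
    "\<And>t v. 0 \<le> v \<Longrightarrow> v < \<eta> t \<Longrightarrow> t < c - 1/2 \<Longrightarrow> t + v < c - 1/2" by metis
  define \<epsilon> where "\<epsilon> = Min (insert 1 (\<eta> ` Q))"
  have \<epsilon>: "\<epsilon> > 0" "\<epsilon> \<le> 1" "\<And>t. t \<in> Q \<Longrightarrow> \<epsilon> \<le> \<eta> t" using fQ \<eta>(1) by (auto simp: \<epsilon>_def)
  show ?thesis
  proof (rule that[OF \<epsilon>(1)])
    fix z v assume z: "norm (z - z0) \<le> r" and v: "v \<in> int_adjoin \<beta>" "0 \<le> v" "v < \<epsilon>"
    have nz: "norm z \<le> norm z0 + r" using z norm_triangle_ineq2[of z z0] by linarith
    have inQ: "t \<in> Q" if "t \<in> L" "\<bar>t\<bar> \<le> c + 2" "norm (z - \<phi> t) \<le> E" for t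
    proof -
      have "norm (\<phi> t) \<le> norm z + norm (z - \<phi> t)"
        using norm_triangle_ineq4[of z "z - \<phi> t"] by simp
      then show ?thesis using that nz by (auto simp: Q_def B_def)
    qed
    have vL: "v \<in> L" by (rule Zb_in_L[OF v(1)])
    show "C w (z + \<phi> v) = (\<lambda>u. u + v) ` C w z"
    proof (intro subset_antisym subsetI)
      fix u' assume u': "u' \<in> C w (z + \<phi> v)"
      define t where "t = u' - v"
      have u'X: "u' \<in> X" "u' \<in> L" "u' - w \<in> int_adjoin \<beta>" "z + \<phi> v \<in> K u'"
        using u' C_subset[OF w] by (auto simp: C_def)
      have tL: "t \<in> L" using u'X(2) vL by (simp add: t_def)
      have \<phi>t: "\<phi> u' = \<phi> t + \<phi> v" using \<phi>_add[OF tL vL] by (simp add: t_def)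
      have "norm (z - \<phi> t) \<le> E" using K_norm[OF u'X(1,4)] by (simp add: \<phi>t)
      moreover have "\<bar>t\<bar> \<le> c + 2" using u'X(1) v \<epsilon>(2) c_pos by (auto simp: t_def X_def)
      ultimately have tQ: "t \<in> Q" using inQ tL by blast
      have v\<eta>: "v < \<eta> t" using \<epsilon>(3)[OF tQ] v by simp
      have tX: "t \<in> X"
      proof (rule ccontr)
        assume "t \<notin> X"
        then have "t < c - 1/2" using u'X(1) v by (auto simp: t_def X_def)
        then have "t + v < c - 1/2" using \<eta>(3)[OF v(2) v\<eta>] by blast
        then show False using u'X(1) by (simp add: t_def X_def)
      qed
      have "agree t u'" using \<eta>(2)[OF v(2) v\<eta> tX] by (simp add: t_def)
      from K_translate[OF tX tL u'X(1,2) this] have "K u' = (+) (\<phi> v) ` K t" by (simp add: t_def)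
      then have "z \<in> K t" using u'X(4) by (auto simp: add.commute)
      moreover have "t - w = (u' - w) - v" by (simp add: t_def)
      then have "t - w \<in> int_adjoin \<beta>" using int_adjoin_diff[OF u'X(3) v(1)] by metis
      ultimately have "t \<in> C w z" using tX by (simp add: C_def)
      then show "u' \<in> (\<lambda>u. u + v) ` C w z" by (intro image_eqI[of _ _ t]) (auto simp: t_def)
    next
      fix u' assume "u' \<in> (\<lambda>u. u + v) ` C w z"
      then obtain t where t: "u' = t + v" "t \<in> C w z" by blast
      have tX: "t \<in> X" "t \<in> L" "t - w \<in> int_adjoin \<beta>" "z \<in> K t"
        using t(2) C_subset[OF w] by (auto simp: C_def)
      have "\<bar>t\<bar> \<le> c + 2" using tX(1) c_pos by (auto simp: X_def)
      then have tQ: "t \<in> Q" using inQ tX(2) K_norm[OF tX(1,4)] by blast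
      have "t + v \<in> X \<and> agree t (t + v)" using \<eta>(2)[OF v(2) _ tX(1)] \<epsilon>(3)[OF tQ] v by simp
      then have u': "u' \<in> X" "agree t u'" by (auto simp: t(1))
      have u'L: "u' \<in> L" using tX(2) vL by (simp add: t(1))
      from K_translate[OF tX(1,2) u'(1) u'L u'(2)] have "K u' = (+) (\<phi> v) ` K t" by (simp add: t(1))
      then have "z + \<phi> v \<in> K u'" using tX(4) by (auto simp: add.commute)
      moreover have "u' - w = (t - w) + v" by (simp add: t(1))
      then have "u' - w \<in> int_adjoin \<beta>" using int_adjoin_add[OF tX(3) v(1)] by metis
      ultimately show "u' \<in> C w (z + \<phi> v)" using u'(1) by (simp add: C_def)
    qed
  qed
qed

text \<open>Only finitely many tiles come near \<open>z\<close>, and all are closed, so those that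
  miss \<open>z\<close> also miss a neighbourhood of it.\<close>

lemma C_usc:
  assumes w: "w \<in> L"
  obtains r where "r > 0" "\<And>z'. z' \<in> ball z r \<Longrightarrow> C w z' \<subseteq> C w z"
proof -
  define Q where "Q = {u \<in> X \<inter> L. K u \<inter> ball z 1 \<noteq> {}}"
  define F where "F = (\<Union>u\<in>{u \<in> Q. z \<notin> K u}. K u)"
  have "finite Q" unfolding Q_def by (rule K_locally_finite) simp
  then have "closed F" unfolding F_def using compact_K compact_imp_closed
    by (intro closed_UN finite_subset[OF _ \<open>finite Q\<close>]) (auto simp: Q_def)
  moreover have "z \<notin> F" by (auto simp: F_def)
  ultimately obtain r where r: "r > 0" "ball z r \<subseteq> - F"
    using open_contains_ball[of "- F"] by auto
  show ?thesis
  proof (rule that[of "min r 1"])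
    fix z' assume z': "z' \<in> ball z (min r 1)"
    show "C w z' \<subseteq> C w z"
    proof
      fix u assume u: "u \<in> C w z'"
      then have "u \<in> Q" using z' C_subset[OF w] by (auto simp: C_def Q_def)
      then have "z \<in> K u" using r(2) z' u by (auto simp: F_def C_def)
      then show "u \<in> C w z" using u by (simp add: C_def)
    qed
  qed (use r in auto)
qed

text \<open>At a minimum of \<open>card (C w z)\<close>: a small translation does not change the cardinality, whereas
  coupling makes a power of \<open>T\<close> non-injective on the translate of \<open>C w z\<close>.\<close>

lemma C_singleton_exists:
  assumes w: "w \<in> L"
  obtains z0 u where "C w z0 = {u}"
proof -
  obtain z0 where z0: "\<And>z. card (C w z0) \<le> card (C w z)"
    using ex_has_least_nat[of "\<lambda>_. True" _ "\<lambda>z. card (C w z)"] by auto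
  have "card (C w z0) \<le> 1"
  proof (rule ccontr)
    assume "\<not> ?thesis"
    then obtain u1 u2 where u: "u1 \<in> C w z0" "u2 \<in> C w z0" "u1 \<noteq> u2"
      by (metis One_nat_def card_le_Suc0_iff_eq finite_C[OF w])
    obtain \<epsilon> where \<epsilon>: "\<epsilon> > 0" "\<And>z v. norm (z - z0) \<le> 0 \<Longrightarrow> v \<in> int_adjoin \<beta> \<Longrightarrow> 0 \<le> v \<Longrightarrow> v < \<epsilon> \<Longrightarrow>
       C w (z + \<phi> v) = (\<lambda>u. u + v) ` C w z" using C_translate[OF w, of z0 0] by metis
    have uX: "u1 \<in> X" "u2 \<in> X" "u1 \<in> L" using u C_subset[OF w] by auto
    have u21: "(u2 - w) - (u1 - w) \<in> int_adjoin \<beta>"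
    proof (rule int_adjoin_diff)
      show "u2 - w \<in> int_adjoin \<beta>" "u1 - w \<in> int_adjoin \<beta>" using u by (simp_all add: C_def)
    qed
    have "u2 - u1 \<in> int_adjoin \<beta>" using u21 by simp
    moreover have "(\<beta> - 1) * u1 \<in> int_adjoin \<beta>" using uX(3) by (simp add: L_def)
    ultimately obtain v n where v: "v \<in> int_adjoin \<beta>" "0 \<le> v" "v < \<epsilon>"
      "(T ^^ n) (u1 + v) = (T ^^ n) (u2 + v)"
      using coupling[OF uX(1,2) _ _ \<epsilon>(1)] by metis
    define S where "S = C w (z0 + \<phi> v)"
    have S: "S = (\<lambda>u. u + v) ` C w z0" using \<epsilon>(2)[of z0] v by (simp add: S_def)
    have "\<not> inj_on (T ^^ n) S" using u v(4) by (auto simp: S inj_on_def)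
    then have "card ((T ^^ n) ` S) < card S"
      using finite_C[OF w] card_image_le eq_card_imp_inj_on unfolding S_def by (metis order_le_less)
    also have "card S \<le> card (C w z0)" unfolding S by (rule card_image_le[OF finite_C[OF w]])
    finally have "card (C w ((M ^^ n) (z0 + \<phi> v))) < card (C w z0)" by (simp add: C_M_pow[OF w] S_def)
    then show False using z0 not_less by blast
  qed
  then have "card (C w z0) = 1"
    using K_covering[OF w, of z0] finite_C[OF w, of z0] by (metis One_nat_def card_0_eq le_Suc_eq le_zero_eq)
  then show ?thesis using that card_1_singletonE by metis
qed

definition single :: "real \<Rightarrow> 'a set" where
  "single w = {z. card (C w z) = 1}"

lemma single_iff: "w \<in> L \<Longrightarrow> z \<in> single w \<longleftrightarrow> (\<exists>u. C w z = {u})"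
  by (auto simp: single_def card_1_singleton_iff)

lemma single_ball:
  assumes w: "w \<in> L"
  obtains z0 u r where "r > 0" "\<And>z. z \<in> ball z0 r \<Longrightarrow> C w z = {u}"
proof -
  obtain z0 u where z0: "C w z0 = {u}" using C_singleton_exists[OF w] by blast
  obtain r where r: "r > 0" "\<And>z'. z' \<in> ball z0 r \<Longrightarrow> C w z' \<subseteq> C w z0" using C_usc[OF w] by blast
  have "C w z = {u}" if "z \<in> ball z0 r" for z
    using r(2)[OF that] K_covering[OF w, of z] z0 by auto
  then show ?thesis using that r(1) by blast
qed

lemma open_single:
  assumes w: "w \<in> L"
  shows "open (single w)"
proof (rule openI)
  fix z assume "z \<in> single w"
  then obtain u where u: "C w z = {u}" using single_iff[OF w] by blast
  obtain r where r: "r > 0" "\<And>z'. z' \<in> ball z r \<Longrightarrow> C w z' \<subseteq> C w z" using C_usc[OF w] by blast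
  have "z' \<in> single w" if "z' \<in> ball z r" for z'
    using r(2)[OF that] K_covering[OF w, of z'] u single_iff[OF w] by (auto simp: subset_singleton_iff)
  then show "\<exists>e>0. ball z e \<subseteq> single w" using r(1) by blast
qed

lemma single_M_pow: "w \<in> L \<Longrightarrow> z \<in> single w \<Longrightarrow> (M ^^ n) z \<in> single w"
  by (auto simp: single_iff C_M_pow)

text \<open>The ball of \<open>single_ball\<close> may be translated by \<open>\<phi> v\<close> for
  every small \<open>v \<ge> 0\<close>; the \<epsilon> of \<open>C_translate\<close> is uniform on
  the ball, and by \<open>dense\<close> these translates come within bounded distance of every
  point.\<close>

lemma single_relatively_dense:
  assumes w: "w \<in> L"
  obtains r R where "r > 0" "R > 0" "\<And>z. \<exists>p. ball p r \<subseteq> single w \<inter> ball z R"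
proof -
  obtain z0 u r where r: "r > 0" "\<And>z. z \<in> ball z0 r \<Longrightarrow> C w z = {u}" using single_ball[OF w] by metis
  obtain \<epsilon> where \<epsilon>: "\<epsilon> > 0" "\<And>z v. norm (z - z0) \<le> r \<Longrightarrow> v \<in> int_adjoin \<beta> \<Longrightarrow> 0 \<le> v \<Longrightarrow> v < \<epsilon> \<Longrightarrow>
       C w (z + \<phi> v) = (\<lambda>u. u + v) ` C w z" using C_translate[OF w, of z0 r] by metis
  obtain R where R: "\<And>z. \<exists>v\<in>int_adjoin \<beta>. 0 \<le> v \<and> v < \<epsilon> \<and> norm (z - \<phi> v) \<le> R" using dense[OF \<epsilon>(1)] by blast
  have "R \<ge> 0" using R[of 0] norm_ge_zero order_trans by blast
  show ?thesis
  proof (rule that[of r "R + r"])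
    fix z
    obtain v where v: "v \<in> int_adjoin \<beta>" "0 \<le> v" "v < \<epsilon>" "norm (z - z0 - \<phi> v) \<le> R" using R by blast
    have "ball (z0 + \<phi> v) r \<subseteq> single w \<inter> ball z (R + r)"
    proof
      fix x assume x: "x \<in> ball (z0 + \<phi> v) r"
      then have "x - \<phi> v \<in> ball z0 r" by (simp add: dist_norm algebra_simps)
      then have "C w (x - \<phi> v) = {u}" "norm ((x - \<phi> v) - z0) \<le> r"
        using r(2) by (auto simp: dist_norm norm_minus_commute)
      then have "C w x = {u + v}" using \<epsilon>(2)[of "x - \<phi> v" v] v by simp
      moreover have "dist z x \<le> norm (z - z0 - \<phi> v) + norm (z0 + \<phi> v - x)"
        using norm_triangle_ineq[of "z - z0 - \<phi> v" "z0 + \<phi> v - x"] by (simp add: dist_norm)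
      then have "dist z x < R + r" using v(4) x by (simp add: dist_norm)
      ultimately show "x \<in> single w \<inter> ball z (R + r)" using single_iff[OF w] by auto
    qed
    then show "\<exists>p. ball p r \<subseteq> single w \<inter> ball z (R + r)" by blast
  qed (use r \<open>R \<ge> 0\<close> in auto)
qed

end

section \<open>Almost every point lies in one tile of each coset\<close>

lemma ball_eq_affine_image:
  fixes p :: "'a::euclidean_space"
  assumes "t > 0"
  shows "ball p t = (\<lambda>x. t *\<^sub>R x + p) ` ball 0 1"
proof (intro subset_antisym subsetI)
  fix y assume "y \<in> ball p t"
  then have "norm (y - p) < t" by (simp add: dist_norm norm_minus_commute)
  then have "(1 / t) *\<^sub>R (y - p) \<in> ball 0 1" "y = t *\<^sub>R ((1 / t) *\<^sub>R (y - p)) + p"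
    using assms by auto
  then show "y \<in> (\<lambda>x. t *\<^sub>R x + p) ` ball 0 1" by blast
qed (use assms in \<open>auto simp: dist_norm\<close>)

lemma linear_image_ball:
  fixes f :: "'a::euclidean_space \<Rightarrow> 'a"
  assumes f: "linear f" "bij f" and t: "t > 0"
  shows "f ` ball p t \<in> lmeasurable"
    and "measure lebesgue (f ` ball p t) = t ^ DIM('a) * measure lebesgue (f ` ball 0 1)"
proof -
  have "open (f ` ball p t)" using open_bijective_linear_image_eq[OF f, of "ball p t"] by simp
  moreover have "bounded (f ` ball p t)" using f(1) by (intro bounded_linear_image) (auto simp: linear_conv_bounded_linear)
  ultimately show "f ` ball p t \<in> lmeasurable" by (rule lmeasurable_open[rotated])
  have "f ` ball p t = (\<lambda>x. t *\<^sub>R x + f p) ` (f ` ball 0 1)"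
    unfolding ball_eq_affine_image[OF t, of p] image_image
    using linear_add[OF f(1)] linear_cmul[OF f(1)] by simp
  then show "measure lebesgue (f ` ball p t) = t ^ DIM('a) * measure lebesgue (f ` ball 0 1)"
    using measure_lebesgue_affine[of t "f p" "f ` ball 0 1"] t by simp
qed

lemma measure_ball_scale:
  fixes p :: "'a::euclidean_space"
  assumes "t > 0"
  shows "measure lebesgue (ball p t) = t ^ DIM('a) * measure lebesgue (ball (0::'a) 1)"
  using linear_image_ball(2)[of "\<lambda>x. x", OF linear_ident bij_id[unfolded id_def] assms, of p] by simp

text \<open>An open set that occupies at least a fixed proportion of every ball has null complement:
  cover a bounded piece of the complement by disjoint balls inside a tight open neighbourhood.\<close>

lemma negligible_Compl_if_proportional:
  fixes G :: "'a::euclidean_space set"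
  assumes G: "open G" and \<kappa>: "0 < \<kappa>" "\<kappa> \<le> 1"
    and dens: "\<And>x s. s > 0 \<Longrightarrow> measure lebesgue (G \<inter> ball x s) \<ge> \<kappa> * measure lebesgue (ball x s)"
  shows "negligible (- G)"
proof -
  have "measure lebesgue (- G \<inter> cball 0 k) = 0" for k
  proof -
    define S where "S = - G \<inter> cball 0 k"
    have "compact S" unfolding S_def using G by (intro closed_Int_compact) auto
    then have S: "S \<in> lmeasurable" by (rule lmeasurable_compact)
    have "\<kappa> * measure lebesgue S \<le> e" if e: "e > 0" for e
    proof -
      obtain V where V: "open V" "S \<subseteq> V" "V \<in> lmeasurable" "measure lebesgue V < measure lebesgue S + e"
      proof -
        obtain V where V: "open V" "S \<subseteq> V" "V - S \<in> lmeasurable" "emeasure lebesgue (V - S) < ennreal e"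
          using sets_lebesgue_outer_open[OF fmeasurableD[OF S] e] by metis
        have eq: "V = S \<union> (V - S)" using V(2) by blast
        have Vm: "V \<in> lmeasurable" using fmeasurable.Un[OF S V(3)] eq by simp
        have "measure lebesgue V \<le> measure lebesgue S + measure lebesgue (V - S)"
          using measure_Un_le[of S lebesgue "V - S"] S V(3) eq by (simp add: fmeasurableD)
        moreover have "measure lebesgue (V - S) < e"
          using V(3,4) e by (simp add: emeasure_eq_measure2 ennreal_less_iff)
        ultimately show ?thesis using that[OF V(1,2) Vm] by linarith
      qed
      define B where "B = {(x, t). t > 0 \<and> ball x t \<subseteq> V}"
      obtain D where D: "countable D" "D \<subseteq> B"
        "pairwise (\<lambda>i j. disjnt (ball (fst i) (snd i)) (ball (fst j) (snd j))) D"
        "negligible (S - (\<Union>i\<in>D. ball (fst i) (snd i)))"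
      proof (rule Vitali_covering_theorem_balls[where S = S and K = B and a = fst and r = snd])
        fix x and t :: real assume x: "x \<in> S" "0 < t"
        obtain s where s: "s > 0" "ball x s \<subseteq> V" using V(1,2) x(1) open_contains_ball by blast
        define m where "m = min s t / 2"
        have "ball x m \<subseteq> ball x s" using s x by (intro subset_ball) (auto simp: m_def)
        then show "\<exists>i. i \<in> B \<and> x \<in> ball (fst i) (snd i) \<and> snd i < t"
          using s x by (intro exI[of _ "(x, m)"]) (auto simp: B_def m_def)
      qed
      define U where "U = (\<Union>i\<in>D. ball (fst i) (snd i))"
      have DB: "ball (fst i) (snd i) \<subseteq> V" "0 < snd i" if "i \<in> D" for i
      proof -
        have "i \<in> B" using D(2) that by blast
        then show "ball (fst i) (snd i) \<subseteq> V" "0 < snd i" by (simp_all add: B_def case_prod_unfold)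
      qed
      have UV: "U \<subseteq> V" using DB(1) unfolding U_def by blast
      have oU: "open U" by (auto simp: U_def)
      have Um: "U \<in> lmeasurable" using fmeasurableI2[OF V(3) UV] oU by (simp add: lmeasurable_iff_integrable borel_open)
      have GUm: "G \<inter> U \<in> lmeasurable" using Um G by (intro fmeasurableI2[OF Um]) (auto intro: sets_completionI_sets borel_open)
      \<comment> \<open>The balls form a countable family, so the proportion is summed in the
        extended nonnegative reals and converted back once the unions are known to have finite
        measure.\<close>
      have ball_e: "ennreal \<kappa> * emeasure lebesgue (ball x s) \<le> emeasure lebesgue (G \<inter> ball x s)" if "s > 0" for x s
      proof -
        have "G \<inter> ball x s \<in> lmeasurable" using G by (intro lmeasurable_open) auto
        then have "emeasure lebesgue (G \<inter> ball x s) = ennreal (measure lebesgue (G \<inter> ball x s))"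
          by (rule emeasure_eq_measure2)
        moreover have "ennreal \<kappa> * emeasure lebesgue (ball x s) = ennreal (\<kappa> * measure lebesgue (ball x s))"
          using \<kappa> by (simp add: emeasure_eq_measure2 ennreal_mult)
        ultimately show ?thesis using dens[OF that, of x] by (simp add: ennreal_leI)
      qed
      have disj: "disjoint_family_on (\<lambda>i. ball (fst i) (snd i)) D"
        using D(3) by (auto simp: disjoint_family_on_def pairwise_def disjnt_def)
      have "ennreal \<kappa> * emeasure lebesgue U = ennreal \<kappa> * (\<integral>\<^sup>+i. emeasure lebesgue (ball (fst i) (snd i)) \<partial>count_space D)"
        unfolding U_def by (subst emeasure_UN_countable[OF _ D(1) disj]) auto
      also have "\<dots> = (\<integral>\<^sup>+i. ennreal \<kappa> * emeasure lebesgue (ball (fst i) (snd i)) \<partial>count_space D)"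
        by (rule nn_integral_cmult[symmetric]) simp
      also have "\<dots> \<le> (\<integral>\<^sup>+i. emeasure lebesgue (G \<inter> ball (fst i) (snd i)) \<partial>count_space D)"
        by (intro nn_integral_mono ball_e) (simp add: DB(2))
      also have "\<dots> = emeasure lebesgue (\<Union>i\<in>D. G \<inter> ball (fst i) (snd i))"
      proof (rule emeasure_UN_countable[OF _ D(1), symmetric])
        show "disjoint_family_on (\<lambda>i. G \<inter> ball (fst i) (snd i)) D"
          using disj unfolding disjoint_family_on_def by blast
        show "G \<inter> ball (fst i) (snd i) \<in> sets lebesgue" for i
          using G by (intro fmeasurableD lmeasurable_open) auto
      qed
      also have "(\<Union>i\<in>D. G \<inter> ball (fst i) (snd i)) = G \<inter> U" by (auto simp: U_def)
      finally have "\<kappa> * measure lebesgue U \<le> measure lebesgue (G \<inter> U)"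
        using Um GUm \<kappa> by (simp add: emeasure_eq_measure2 ennreal_mult'[symmetric])
      moreover have "measure lebesgue S \<le> measure lebesgue (U - G)"
      proof -
        have "S \<subseteq> (U - G) \<union> (S - U)" by (auto simp: S_def)
        moreover have n: "S - U \<in> lmeasurable" "measure lebesgue (S - U) = 0"
          using D(4) negligible_iff_measure by (auto simp: U_def)
        moreover have UG: "U - G \<in> lmeasurable" using fmeasurable_Diff[OF Um, of G] G by auto
        ultimately have "measure lebesgue S \<le> measure lebesgue ((U - G) \<union> (S - U))"
          using S by (intro measure_mono_fmeasurable) auto
        also have "\<dots> \<le> measure lebesgue (U - G) + measure lebesgue (S - U)"
          using n UG by (intro measure_Un_le) auto
        finally show ?thesis using n by simp
      qed
      moreover have "measure lebesgue (U - G) = measure lebesgue U - measure lebesgue (G \<inter> U)"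
      proof -
        have "U - G = U - G \<inter> U" by blast
        then show ?thesis using measurable_measure_Diff[OF Um, of "G \<inter> U"] GUm by auto
      qed
      ultimately have "measure lebesgue S \<le> (1 - \<kappa>) * measure lebesgue U" by (simp add: algebra_simps)
      also have "\<dots> \<le> (1 - \<kappa>) * measure lebesgue V"
        using \<kappa> UV V(3) Um by (intro mult_left_mono measure_mono_fmeasurable) auto
      also have "\<dots> \<le> (1 - \<kappa>) * (measure lebesgue S + e)" using \<kappa> V(4) by (intro mult_left_mono) auto
      also have "\<dots> \<le> (1 - \<kappa>) * measure lebesgue S + e" using \<kappa> e by (simp add: algebra_simps)
      finally show ?thesis by (simp add: algebra_simps)
    qed
    then have "\<kappa> * measure lebesgue S \<le> 0" by (rule field_le_epsilon[of _ 0, simplified])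
    then show ?thesis using \<kappa> measure_nonneg[of lebesgue S] unfolding S_def[symmetric]
      by (simp add: mult_le_0_iff)
  qed
  moreover have "- G \<inter> cball 0 k \<in> lmeasurable" for k
    using G by (intro lmeasurable_compact closed_Int_compact) auto
  ultimately have "negligible (- G \<inter> cball 0 (real k))" for k by (simp add: negligible_iff_measure)
  then have "negligible (\<Union>k. - G \<inter> cball 0 (real k))" by (intro negligible_countable_Union) auto
  moreover have "(\<Union>k. - G \<inter> cball 0 (real k)) = - G" using real_arch_simple by auto
  ultimately show ?thesis by simp
qed

context rauzy_geometry
begin

text \<open>A high power of \<open>M\<close> carries the relatively dense balls into any given ball.
  It need not be a similarity, but it scales all volumes by the same factor, so the proportion can
  be counted before the map is applied.\<close>

lemma single_proportional:
  assumes w: "w \<in> L"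
  obtains \<kappa> where "0 < \<kappa>" "\<kappa> \<le> 1"
    "\<And>x s. s > 0 \<Longrightarrow> measure lebesgue (single w \<inter> ball x s) \<ge> \<kappa> * measure lebesgue (ball x s)"
proof -
  obtain r R where r: "r > 0" and R: "R > 0" and near: "\<And>z. \<exists>p. ball p r \<subseteq> single w \<inter> ball z R"
    using single_relatively_dense[OF w] by metis
  define D where "D = DIM('a)"
  \<comment> \<open>A ball of radius \<open>r\<close> is compared with one of radius
    \<open>5 * R\<close> from the Vitali lemma; the further factor 2 comes from shrinking the radius
    \<open>s\<close> to \<open>s / 2\<close>.\<close>
  define \<kappa> where "\<kappa> = (r / (10 * R)) ^ D"
  have \<kappa>: "\<kappa> > 0" using r R by (simp add: \<kappa>_def)
  have main: "measure lebesgue (single w \<inter> ball x s) \<ge> \<kappa> * measure lebesgue (ball x s)" if s: "s > 0" for x s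
  proof -
    have "0 < s / (12 * R)" using s R by simp
    then obtain n where "\<rho> ^ n < s / (12 * R)" using real_arch_pow_inv rho(2) by blast
    \<comment> \<open>A chosen point in \<open>ball i R\<close> and a point of \<open>E0\<close> in
      \<open>ball i (5 * R)\<close> are at distance at most \<open>6 * R\<close>; after contraction
      this fits into the margin between \<open>s / 2\<close> and \<open>s\<close>.\<close>
    then have n: "\<rho> ^ n * (6 * R) < s / 2" using R by (simp add: field_simps)
    define f where "f = M ^^ n"
    have f: "linear f" "bij f" using linear_M_pow bij_M_pow by (auto simp: f_def)
    have fR: "norm (f a - f b) \<le> \<rho> ^ n * norm (a - b)" for a b
      using norm_M_pow[of n "a - b"] linear_diff[OF f(1)] by (simp add: f_def)
    obtain g where g: "linear g" "g \<circ> f = id"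
      using linear_injective_left_inverse[OF f(1)] f(2) by (auto simp: bij_def)
    define E0 where "E0 = {y. f y \<in> ball x (s / 2)}"
    have "E0 \<subseteq> g ` ball x (s / 2)"
    proof
      fix y assume "y \<in> E0"
      moreover have "y = g (f y)" using g(2) by (simp add: fun_eq_iff)
      ultimately show "y \<in> g ` ball x (s / 2)" unfolding E0_def by blast
    qed
    moreover have "bounded (g ` ball x (s / 2))"
      using g(1) by (intro bounded_linear_image) (auto simp: linear_conv_bounded_linear)
    ultimately have "compact (closure E0)" using bounded_subset by auto
    then have "\<exists>k. finite k \<and> closure E0 \<subseteq> (\<Union>y\<in>k. ball y R)"
      using R unfolding compact_eq_totally_bounded by blast
    then obtain k where k: "finite k" "closure E0 \<subseteq> (\<Union>y\<in>k. ball y R)" by blast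
    then have "E0 \<subseteq> (\<Union>y\<in>k. ball y R)" using closure_subset by blast
    then obtain P0 where P0: "P0 \<subseteq> k" "pairwise (\<lambda>i j. disjnt (ball i R) (ball j R)) P0"
      "E0 \<subseteq> (\<Union>i\<in>P0. ball i (5 * R))"
    proof (rule Vitali_covering_lemma_balls[where S = E0 and K = k and a = "\<lambda>y. y" and r = "\<lambda>_. R" and B = R])
      show "0 < R \<and> R \<le> R" using R by simp
    qed (assumption | rule that)+
    define P where "P = {i \<in> P0. ball i (5 * R) \<inter> E0 \<noteq> {}}"
    have "finite P0" using P0(1) k(1) by (rule finite_subset)
    then have fP: "finite P" by (simp add: P_def)
    have EP: "E0 \<subseteq> (\<Union>i\<in>P. ball i (5 * R))"
    proof
      fix y assume y: "y \<in> E0"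
      then obtain i where "i \<in> P0" "y \<in> ball i (5 * R)" using P0(3) by blast
      then show "y \<in> (\<Union>i\<in>P. ball i (5 * R))" using y unfolding P_def by blast
    qed
    obtain p where p: "\<And>z. ball (p z) r \<subseteq> single w \<inter> ball z R" using near by metis
    define a where "a = measure lebesgue (f ` ball 0 1)"
    have m1: "measure lebesgue (f ` ball y t) = t ^ D * a" "f ` ball y t \<in> lmeasurable" if "t > 0" for y t
      using linear_image_ball[OF f that] by (auto simp: a_def D_def)
    have "ball x (s / 2) \<subseteq> (\<Union>i\<in>P. f ` ball i (5 * R))"
    proof
      fix y assume y: "y \<in> ball x (s / 2)"
      obtain y' where y': "y = f y'" using f(2) by (auto simp: bij_def surj_def)
      then have "y' \<in> E0" using y by (simp add: E0_def)
      then show "y \<in> (\<Union>i\<in>P. f ` ball i (5 * R))" using EP y' by blast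
    qed
    then have "measure lebesgue (ball x (s / 2)) \<le> measure lebesgue (\<Union>i\<in>P. f ` ball i (5 * R))"
    proof (rule measure_mono_fmeasurable)
      show "(\<Union>i\<in>P. f ` ball i (5 * R)) \<in> lmeasurable"
        using m1(2)[of "5 * R"] R by (intro fmeasurable.finite_UN[OF fP]) auto
    qed auto
    also have "\<dots> \<le> (\<Sum>i\<in>P. measure lebesgue (f ` ball i (5 * R)))"
      using m1(2)[of "5 * R"] R by (intro measure_UNION_le[OF fP]) (simp add: fmeasurableD)
    also have "\<dots> = card P * ((5 * R) ^ D * a)" using m1 R by simp
    finally have up: "measure lebesgue (ball x (s / 2)) \<le> card P * ((5 * R) ^ D * a)" .
    have sub: "f ` ball (p i) r \<subseteq> single w \<inter> ball x s" if i: "i \<in> P" for i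
    proof
      fix z assume "z \<in> f ` ball (p i) r"
      then obtain y where y: "z = f y" "y \<in> single w" "y \<in> ball i R" using p by blast
      obtain e where e: "e \<in> E0" "e \<in> ball i (5 * R)" using i by (auto simp: P_def)
      have "dist e y \<le> dist i e + dist i y" by (metis dist_commute dist_triangle)
      then have "norm (e - y) \<le> 6 * R" using y(3) e(2) by (simp add: dist_norm)
      then have "norm (f e - f y) \<le> \<rho> ^ n * (6 * R)"
        using fR[of e y] mult_left_mono[of "norm (e - y)" "6 * R" "\<rho> ^ n"] rho_pow[of n] by linarith
      then have "dist (f e) z < s / 2" using n by (simp add: y(1) dist_norm)
      moreover have "dist x (f e) < s / 2" using e(1) by (simp add: E0_def)
      ultimately have "dist x z < s" using dist_triangle[of x z "f e"] by linarith
      moreover have "z \<in> single w" using single_M_pow[OF w y(2), of n] by (simp add: y(1) f_def)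
      ultimately show "z \<in> single w \<inter> ball x s" by simp
    qed
    have "card P * (r ^ D * a) = (\<Sum>i\<in>P. measure lebesgue (f ` ball (p i) r))" using m1 r by simp
    also have "\<dots> = measure lebesgue (\<Union>i\<in>P. f ` ball (p i) r)"
    proof (rule measure_UNION'[symmetric, OF fP])
      show "f ` ball (p i) r \<in> lmeasurable" for i using m1 r by blast
      show "pairwise (\<lambda>i j. disjnt (f ` ball (p i) r) (f ` ball (p j) r)) P"
      proof (rule pairwiseI)
        fix i j assume ij: "i \<in> P" "j \<in> P" "i \<noteq> j"
        then have "ball i R \<inter> ball j R = {}" using P0(2) by (auto simp: P_def pairwise_def disjnt_def)
        then have "ball (p i) r \<inter> ball (p j) r = {}" using p[of i] p[of j] by blast
        then show "disjnt (f ` ball (p i) r) (f ` ball (p j) r)"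
          using f(2) image_Int[of f "ball (p i) r" "ball (p j) r"] by (simp add: disjnt_def bij_def)
      qed
    qed
    also have "\<dots> \<le> measure lebesgue (single w \<inter> ball x s)"
    proof (rule measure_mono_fmeasurable)
      show "(\<Union>i\<in>P. f ` ball (p i) r) \<subseteq> single w \<inter> ball x s" using sub by blast
      show "(\<Union>i\<in>P. f ` ball (p i) r) \<in> sets lebesgue"
        using m1(2)[of r] r by (intro sets.finite_UN[OF fP]) (simp add: fmeasurableD)
      show "single w \<inter> ball x s \<in> lmeasurable" using open_single[OF w] by (intro lmeasurable_open) auto
    qed
    finally have low: "card P * (r ^ D * a) \<le> measure lebesgue (single w \<inter> ball x s)" .
    have "measure lebesgue (ball x s) = 2 ^ D * measure lebesgue (ball x (s / 2))"
      using measure_ball_scale[of s x] measure_ball_scale[of "s/2" x] s by (simp add: D_def power_divide)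
    then have "\<kappa> * measure lebesgue (ball x s) \<le> \<kappa> * (2 ^ D * (card P * ((5 * R) ^ D * a)))"
      using up \<kappa> by simp
    also have "\<dots> = card P * (r ^ D * a)"
    proof -
      have "\<kappa> * 2 ^ D * (5 * R) ^ D = (r / (10 * R) * 2 * (5 * R)) ^ D"
        by (simp only: \<kappa>_def power_mult_distrib)
      also have "r / (10 * R) * 2 * (5 * R) = r" using R by simp
      finally show ?thesis by (metis mult.assoc mult.left_commute)
    qed
    finally show ?thesis using low by simp
  qed
  show ?thesis
  proof (rule that[of "min \<kappa> 1"])
    show "min \<kappa> 1 * measure lebesgue (ball x s) \<le> measure lebesgue (single w \<inter> ball x s)" if "s > 0" for x s
    proof -
      have "min \<kappa> 1 * measure lebesgue (ball x s) \<le> \<kappa> * measure lebesgue (ball x s)"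
        by (intro mult_right_mono) auto
      then show ?thesis using main[OF that, of x] by linarith
    qed
  qed (use \<kappa> in auto)
qed

theorem AE_card_C:
  assumes "w \<in> L"
  shows "AE z in lebesgue. card (C w z) = 1"
proof -
  obtain \<kappa> where "0 < \<kappa>" "\<kappa> \<le> 1"
    "\<And>x s. s > 0 \<Longrightarrow> measure lebesgue (single w \<inter> ball x s) \<ge> \<kappa> * measure lebesgue (ball x s)"
    using single_proportional[OF assms] by metis
  then have "negligible (- single w)" by (rule negligible_Compl_if_proportional[OF open_single[OF assms]])
  then show ?thesis
    by (intro AE_I'[of "- single w"]) (auto simp: negligible_iff_null_sets single_def)
qed

section \<open>Interior of the tiles\<close>

lemma K_pow_subset:
  assumes "u \<in> X" "u \<in> L" "y \<in> preimgs n u"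
  shows "(M ^^ n) ` K y \<subseteq> K u"
  using assms(3)
proof (induction n arbitrary: y)
  case 0
  then show ?case using preimgs_0[OF assms(1)] by simp
next
  case (Suc n)
  then have y: "y \<in> X" "T y \<in> preimgs n u" by (auto simp: preimgs_Suc_iff)
  then have TX: "T y \<in> X" "T y \<in> L" using preimgs_L[OF assms(2) y(2)] by (auto simp: T_in_X)
  have "M ` K y \<subseteq> K (T y)" using K_decomp[OF TX] y(1) by (auto simp: preimgs_def)
  then have "(M ^^ n) ` (M ` K y) \<subseteq> K u" using Suc.IH[OF y(2)] by blast
  then show ?case by (simp add: image_image funpow_swap1)
qed

lemma K_pow_cover:
  assumes "u \<in> X" "u \<in> L" "z \<in> K u"
  shows "\<exists>y\<in>preimgs n u. z \<in> (M ^^ n) ` K y"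
proof (induction n)
  case 0
  show ?case using preimgs_0[OF assms(1)] assms(3) by simp
next
  case (Suc n)
  then obtain y z' where y: "y \<in> preimgs n u" "z' \<in> K y" "z = (M ^^ n) z'" by blast
  then have "y \<in> X" "y \<in> L" using preimgs_L[OF assms(2)] by (auto simp: preimgs_def)
  then obtain x where x: "x \<in> preimgs 1 y" "z' \<in> M ` K x" using K_decomp[of y] y(2) by blast
  have "z \<in> (M ^^ Suc n) ` K x" using x(2) y(3) by (auto simp: funpow_swap1)
  then show ?case using preimgs_trans[OF y(1) x(1)] by auto
qed

lemma interior_M_pow: "interior ((M ^^ n) ` S) = (M ^^ n) ` interior S"
  by (rule interior_injective_linear_image[OF linear_M_pow inj_M_pow])

text \<open>Some tile \<open>K u\<close> has interior points by \<open>single_ball\<close>. An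
  iterated preimage of \<open>y\<close> just right of \<open>u\<close> agrees with \<open>u\<close>,
  so its tile is a translate of \<open>K u\<close>, and a contracted copy of that translate lies in
  \<open>K y\<close>.\<close>

lemma interior_K_nonempty:
  assumes y: "y \<in> X" "y \<in> L"
  shows "interior (K y) \<noteq> {}"
proof -
  obtain z0 u r where r: "r > 0" "\<And>z. z \<in> ball z0 r \<Longrightarrow> C y z = {u}" using single_ball[OF y(2)] by metis
  have "u \<in> C y z0" using r by simp
  then have u: "u \<in> X" "u \<in> L" using C_subset[OF y(2)] by auto
  have "ball z0 r \<subseteq> K u"
  proof
    fix z assume "z \<in> ball z0 r"
    then have "u \<in> C y z" using r(2) by simp
    then show "z \<in> K u" by (simp add: C_def)
  qed
  then have z0: "z0 \<in> interior (K u)" using r(1) by (meson centre_in_ball interiorI open_ball)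
  obtain \<epsilon> where \<epsilon>: "\<epsilon> > 0" "\<And>v. 0 \<le> v \<Longrightarrow> v < \<epsilon> \<Longrightarrow> u + v \<in> X \<and> agree u (u + v)"
    using agree_right[OF u(1)] by metis
  obtain x n where x: "x \<in> X" "u \<le> x" "x < u + \<epsilon>" "x \<in> preimgs n y"
    using preimages_dense[OF u(1) y(1) \<epsilon>(1)] by metis
  have xL: "x \<in> L" by (rule preimgs_L[OF y(2) x(4)])
  have "agree u x" using \<epsilon>(2)[of "x - u"] x by simp
  from K_translate[OF u x(1) xL this] have "interior (K x) = (+) (\<phi> (x - u)) ` interior (K u)"
    by (simp add: interior_translation)
  then have "interior (K x) \<noteq> {}" using z0 by auto
  then have "interior ((M ^^ n) ` K x) \<noteq> {}" by (simp add: interior_M_pow)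
  then show ?thesis using interior_mono[OF K_pow_subset[OF y x(4)]] by blast
qed

theorem closure_interior_K:
  assumes u: "u \<in> X" "u \<in> L"
  shows "closure (interior (K u)) = K u"
proof (rule subset_antisym)
  show "closure (interior (K u)) \<subseteq> K u"
    using compact_imp_closed[OF compact_K[OF u(1)]] by (simp add: closure_minimal interior_subset)
  show "K u \<subseteq> closure (interior (K u))"
  proof
    fix z assume z: "z \<in> K u"
    show "z \<in> closure (interior (K u))"
      unfolding closure_approachable
    proof (intro allI impI)
      fix e :: real assume e: "0 < e"
      have "0 < e / (2 * E + 1)" using e E_nonneg by simp
      then obtain n where "\<rho> ^ n < e / (2 * E + 1)" using real_arch_pow_inv rho(2) by blast
      then have n: "\<rho> ^ n * (2 * E + 1) < e" using E_nonneg by (simp add: field_simps)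
      obtain y where y: "y \<in> preimgs n u" "z \<in> (M ^^ n) ` K y" using K_pow_cover[OF u z] by blast
      then obtain a where a: "a \<in> K y" "z = (M ^^ n) a" by blast
      have yX: "y \<in> X" "y \<in> L" using y(1) preimgs_L[OF u(2)] by (auto simp: preimgs_def)
      obtain b where b: "b \<in> interior (K y)" using interior_K_nonempty[OF yX] by blast
      then have "norm (b - \<phi> y) \<le> E" "norm (a - \<phi> y) \<le> E"
        using K_norm[OF yX(1)] a interior_subset by blast+
      then have ab: "norm (b - a) \<le> 2 * E" using norm_triangle_ineq4[of "b - \<phi> y" "a - \<phi> y"] by simp
      have "norm ((M ^^ n) b - z) = norm ((M ^^ n) (b - a))" by (simp add: a(2) linear_diff[OF linear_M_pow])
      also have "\<dots> \<le> \<rho> ^ n * norm (b - a)" by (rule norm_M_pow)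
      also have "\<dots> \<le> \<rho> ^ n * (2 * E + 1)" using ab rho_pow[of n] by (intro mult_left_mono) auto
      finally have "dist ((M ^^ n) b) z < e" using n by (simp add: dist_norm)
      moreover have "(M ^^ n) b \<in> interior ((M ^^ n) ` K y)" using b by (simp add: interior_M_pow)
      then have "(M ^^ n) b \<in> interior (K u)" using interior_mono[OF K_pow_subset[OF u y(1)]] by blast
      ultimately show "\<exists>y\<in>interior (K u). dist y z < e" by blast
    qed
  qed
qed

theorem K_finite_shapes:
  "\<exists>F. finite F \<and> (\<forall>u\<in>X \<inter> L. \<exists>S\<in>F. \<exists>v. K u = (+) v ` S)"
proof -
  define pat where "pat u = map (dig u) [0..<d]" for u
  \<comment> \<open>Patterns that do not occur contribute an arbitrary set, which does no
    harm.\<close>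
  define F where "F = (\<lambda>p. K (SOME y. y \<in> X \<inter> L \<and> pat y = p)) ` {p. set p \<subseteq> UNIV \<and> length p = d}"
  have "finite F" unfolding F_def by (intro finite_imageI finite_lists_length_eq) simp
  moreover have "\<exists>S\<in>F. \<exists>v. K u = (+) v ` S" if u: "u \<in> X \<inter> L" for u
  proof -
    define y where "y = (SOME y. y \<in> X \<inter> L \<and> pat y = pat u)"
    have y: "y \<in> X \<inter> L \<and> pat y = pat u" unfolding y_def by (rule someI[of _ u]) (use u in simp)
    then have "agree y u" by (auto simp: agree_def pat_def)
    then have "K u = (+) (\<phi> (u - y)) ` K y" using K_translate[of y u] y u by blast
    moreover have "K y \<in> F" unfolding F_def y_def by (intro imageI) (simp add: pat_def)
    ultimately show ?thesis by blast
  qed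
  ultimately show ?thesis by blast
qed

end

section \<open>Galois conjugates\<close>

definition rat_eval :: "rat poly \<Rightarrow> 'a::field_char_0 \<Rightarrow> 'a" where
  "rat_eval p a = poly (map_poly of_rat p) a"

lemma rat_eval_add: "rat_eval (p + q) a = rat_eval p a + rat_eval q a"
proof -
  have "map_poly (of_rat :: rat \<Rightarrow> 'a) (p + q) = map_poly of_rat p + map_poly of_rat q"
    by (rule poly_eqI) (simp add: coeff_map_poly of_rat_add)
  then show ?thesis by (simp add: rat_eval_def)
qed

lemma rat_eval_mult: "rat_eval (p * q) a = rat_eval p a * rat_eval q a"
proof -
  have "map_poly (of_rat :: rat \<Rightarrow> 'a) (p * q) = map_poly of_rat p * map_poly of_rat q"
    by (rule poly_eqI) (simp add: coeff_map_poly coeff_mult of_rat_sum of_rat_mult)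
  then show ?thesis by (simp add: rat_eval_def)
qed

lemma rat_eval_0 [simp]: "rat_eval 0 a = 0"
  by (simp add: rat_eval_def)

lemma rat_eval_const: "rat_eval [:r:] a = of_rat r"
  by (simp add: rat_eval_def map_poly_pCons)

lemma rat_eval_monom: "rat_eval (monom r n) a = of_rat r * a ^ n"
  by (simp add: rat_eval_def map_poly_monom poly_monom)

lemma rat_eval_sum: "rat_eval (\<Sum>i\<in>A. f i) a = (\<Sum>i\<in>A. rat_eval (f i) a)"
  by (induction A rule: infinite_finite_induct) (auto simp: rat_eval_add)

lemma rat_eval_diff: "rat_eval (p - q) a = rat_eval p a - rat_eval q a"
  using rat_eval_add[of "p - q" q a] by simp

text \<open>Justifies the definite description in \<open>min_poly\<close>: an annihilating
  polynomial of least degree, made monic, divides all others and is therefore the only monic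
  irreducible one.\<close>

lemma min_poly_exists:
  fixes a :: "'a::field_char_0"
  assumes "q \<noteq> 0" "rat_eval q a = 0"
  shows "lead_coeff (min_poly a) = 1" "irreducible (min_poly a)" "rat_eval (min_poly a) a = 0"
    and "\<And>r. rat_eval r a = 0 \<Longrightarrow> min_poly a dvd r"
proof -
  define P where "P p \<longleftrightarrow> p \<noteq> 0 \<and> rat_eval p a = 0" for p :: "rat poly"
  obtain p0 where p0: "P p0" "\<And>r. P r \<Longrightarrow> degree p0 \<le> degree r"
    using ex_has_least_nat[of P q degree] assms by (auto simp: P_def)
  define p where "p = smult (1 / lead_coeff p0) p0"
  have p: "p \<noteq> 0" "lead_coeff p = 1" "degree p = degree p0"
    using p0(1) by (auto simp: p_def P_def)
  have "p = [:1 / lead_coeff p0:] * p0" by (simp add: p_def)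
  then have root: "rat_eval p a = 0" using p0(1) by (simp only: rat_eval_mult) (simp add: P_def)
  have least: "degree p \<le> degree r" if "r \<noteq> 0" "rat_eval r a = 0" for r
    using p0(2)[of r] that p(3) by (simp add: P_def)
  have pdvd: "p dvd r" if "rat_eval r a = 0" for r
  proof -
    have "r = p * (r div p) + r mod p" by simp
    then have "rat_eval r a = rat_eval p a * rat_eval (r div p) a + rat_eval (r mod p) a"
      by (metis rat_eval_add rat_eval_mult)
    then have 0: "rat_eval (r mod p) a = 0" using root that by simp
    have "r mod p = 0"
    proof (rule ccontr)
      assume n: "r mod p \<noteq> 0"
      then have "degree (r mod p) < degree p" using degree_mod_less[OF p(1), of r] by auto
      then show False using least[OF n 0] by simp
    qed
    then show ?thesis by (simp add: mod_eq_0_iff_dvd)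
  qed
  have deg: "degree p > 0"
  proof (rule ccontr)
    assume "\<not> degree p > 0"
    then obtain r where "p = [:r:]" using degree_eq_zeroE by blast
    then show False using root p(1) by (simp add: rat_eval_const)
  qed
  have irr: "irreducible p"
  proof (rule irreducibleI[OF p(1)])
    show "\<not> p dvd 1" using deg p(1) by (simp add: is_unit_iff_degree)
    fix r s assume rs: "p = r * s"
    then have nz: "r \<noteq> 0" "s \<noteq> 0" using p(1) by auto
    have d: "degree p = degree r + degree s" using rs nz by (simp add: degree_mult_eq)
    have "rat_eval r a = 0 \<or> rat_eval s a = 0" using root rs by (simp add: rat_eval_mult)
    then have "degree r = 0 \<or> degree s = 0" using least[OF nz(1)] least[OF nz(2)] d by linarith
    then show "r dvd 1 \<or> s dvd 1" using nz by (simp add: is_unit_iff_degree)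
  qed
  have uniq: "r = p" if r: "lead_coeff r = 1" "irreducible r" "rat_eval r a = 0" for r
  proof -
    obtain s where s: "r = p * s" using pdvd[OF r(3)] by (auto elim: dvdE)
    have "\<not> p dvd 1" using irr by (auto simp: irreducible_def)
    then have "s dvd 1" using r(2) s by (auto simp: irreducible_def)
    moreover have "s \<noteq> 0" using s r(1) by auto
    ultimately obtain k where k: "s = [:k:]" using is_unit_iff_degree degree_eq_zeroE by blast
    then have "lead_coeff r = k" using s p(2) by (simp add: lead_coeff_mult)
    then have "k = 1" using r(1) by simp
    then show ?thesis using k s by simp
  qed
  have "min_poly a = p"
    unfolding min_poly_def
  proof (rule the_equality)
    show "lead_coeff p = 1 \<and> irreducible p \<and> poly (map_poly of_rat p) a = 0"
      using p(2) irr root by (simp add: rat_eval_def)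
    show "r = p" if "lead_coeff r = 1 \<and> irreducible r \<and> poly (map_poly of_rat r) a = 0" for r
      using uniq[of r] that by (simp add: rat_eval_def)
  qed
  then show "lead_coeff (min_poly a) = 1" "irreducible (min_poly a)" "rat_eval (min_poly a) a = 0"
    "\<And>r. rat_eval r a = 0 \<Longrightarrow> min_poly a dvd r"
    using p(2) irr root pdvd by simp_all
qed

lemma subfield_of_rat_adjoin: "subfield_of (rat_adjoin a)" and self_in_rat_adjoin: "a \<in> rat_adjoin a"
  unfolding rat_adjoin_def hull_def subfield_of_def by auto

lemma rat_adjoin_closed:
  "1 \<in> rat_adjoin a" "0 \<in> rat_adjoin a"
  "x \<in> rat_adjoin a \<Longrightarrow> y \<in> rat_adjoin a \<Longrightarrow> x - y \<in> rat_adjoin a"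
  "x \<in> rat_adjoin a \<Longrightarrow> y \<in> rat_adjoin a \<Longrightarrow> x + y \<in> rat_adjoin a"
  "x \<in> rat_adjoin a \<Longrightarrow> y \<in> rat_adjoin a \<Longrightarrow> x * y \<in> rat_adjoin a"
proof -
  note s = subfield_of_rat_adjoin[of a, unfolded subfield_of_def]
  show 1: "1 \<in> rat_adjoin a" using s by blast
  show d: "x - y \<in> rat_adjoin a" if "x \<in> rat_adjoin a" "y \<in> rat_adjoin a" for x y using s that by blast
  show 0: "0 \<in> rat_adjoin a" using d[OF 1 1] by simp
  show "x \<in> rat_adjoin a \<Longrightarrow> y \<in> rat_adjoin a \<Longrightarrow> x + y \<in> rat_adjoin a"
    using d[of x "0 - y"] d[OF 0, of y] by simp
  show "x \<in> rat_adjoin a \<Longrightarrow> y \<in> rat_adjoin a \<Longrightarrow> x * y \<in> rat_adjoin a" using s by blast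
qed

lemma of_int_in_rat_adjoin: "of_int k \<in> rat_adjoin a"
proof -
  have n: "of_nat m \<in> rat_adjoin a" for m
    by (induction m) (auto simp: rat_adjoin_closed)
  show ?thesis
  proof (cases "k \<ge> 0")
    case True
    then show ?thesis using n[of "nat k"] by simp
  next
    case False
    then show ?thesis using rat_adjoin_closed(3)[OF rat_adjoin_closed(2) n[of "nat (- k)"]] by simp
  qed
qed

lemma int_adjoin_subset_rat_adjoin: "x \<in> int_adjoin a \<Longrightarrow> x \<in> rat_adjoin a"
  by (induction rule: int_adjoin_induct)
    (auto intro!: rat_adjoin_closed of_int_in_rat_adjoin self_in_rat_adjoin)

lemma field_iso_on_int_adjoin:
  fixes f :: "'a::field_char_0 \<Rightarrow> 'b::field_char_0"
  assumes f: "field_iso_on f (rat_adjoin a) B"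
  shows "f 0 = 0" "f 1 = 1"
    "x \<in> int_adjoin a \<Longrightarrow> y \<in> int_adjoin a \<Longrightarrow> f (x + y) = f x + f y"
    "x \<in> int_adjoin a \<Longrightarrow> y \<in> int_adjoin a \<Longrightarrow> f (x * y) = f x * f y"
    "f (of_int k) = of_int k"
proof -
  have f1: "f 1 = 1" and fa: "f (x + y) = f x + f y" "f (x * y) = f x * f y"
    if "x \<in> rat_adjoin a" "y \<in> rat_adjoin a" for x y
    using f that unfolding field_iso_on_def by blast+
  show "f 1 = 1" using f unfolding field_iso_on_def by blast
  show f0: "f 0 = 0" using fa(1)[of 0 0] rat_adjoin_closed(2)[of a] by simp
  show "x \<in> int_adjoin a \<Longrightarrow> y \<in> int_adjoin a \<Longrightarrow> f (x + y) = f x + f y"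
    "x \<in> int_adjoin a \<Longrightarrow> y \<in> int_adjoin a \<Longrightarrow> f (x * y) = f x * f y"
    using fa int_adjoin_subset_rat_adjoin by blast+
  have n: "f (of_nat m) = of_nat m" for m
  proof (induction m)
    case (Suc m)
    have "f (of_nat m + 1) = f (of_nat m) + f 1"
      using fa(1)[of "of_nat m" 1] of_int_in_rat_adjoin[of "int m" a] rat_adjoin_closed(1)[of a] by simp
    then show ?case using Suc \<open>f 1 = 1\<close> by (simp add: add.commute)
  qed (simp add: f0)
  show "f (of_int k) = of_int k"
  proof (cases "k \<ge> 0")
    case True
    then show ?thesis using n[of "nat k"] by simp
  next
    case False
    have "f (of_int k + of_nat (nat (- k))) = f (of_int k) + f (of_nat (nat (- k)))"
      using of_int_in_rat_adjoin[of k a] of_int_in_rat_adjoin[of "- k" a] False by (intro fa(1)) auto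
    then have "f (of_int k) + f (of_nat (nat (- k))) = 0" using False f0 by simp
    moreover have "f (of_nat (nat (- k))) = - of_int k" unfolding n using False by simp
    ultimately show ?thesis by simp
  qed
qed

section \<open>The polynomial of \<beta> and its roots\<close>

context dbonacci
begin

definition dpoly :: "rat poly" where
  "dpoly = monom 1 d - (\<Sum>i<d. monom 1 i)"

lemma rat_eval_dpoly: "rat_eval dpoly a = a ^ d - (\<Sum>i<d. a ^ i)"
  by (simp add: dpoly_def rat_eval_diff rat_eval_sum rat_eval_monom)

lemma coeff_dpoly: "coeff dpoly i = (if i = d then 1 else if i < d then -1 else 0)"
  by (simp add: dpoly_def coeff_sum coeff_diff)

lemma degree_dpoly: "degree dpoly = d" "dpoly \<noteq> 0"
proof -
  show "degree dpoly = d"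
    by (rule antisym) (auto intro: degree_le le_degree simp: coeff_dpoly)
  show "dpoly \<noteq> 0" using coeff_dpoly[of d] by auto
qed

lemma dpoly_root: "rat_eval dpoly \<beta> = 0"
  by (simp add: rat_eval_dpoly bd)

lemmas min_poly_beta = min_poly_exists[OF degree_dpoly(2) dpoly_root]

lemma degree_min_poly_le: "degree (min_poly \<beta>) \<le> d"
  using dvd_imp_degree_le[OF min_poly_beta(4)[OF dpoly_root] degree_dpoly(2)] degree_dpoly by simp

lemma galois_conjugates_root:
  assumes "z \<in> galois_conjugates \<beta>"
  shows "z ^ d = (\<Sum>i<d. z ^ i)"
proof -
  obtain r where "dpoly = min_poly \<beta> * r" using min_poly_beta(4)[OF dpoly_root] by (auto elim: dvdE)
  moreover have "rat_eval (min_poly \<beta>) z = 0" using assms by (simp add: galois_conjugates_def rat_eval_def)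
  ultimately have "rat_eval dpoly z = 0" by (simp add: rat_eval_mult)
  then show ?thesis by (simp add: rat_eval_dpoly)
qed

lemma finite_galois_conjugates: "finite (galois_conjugates \<beta>)" "card (galois_conjugates \<beta>) \<le> degree (min_poly \<beta>)"
proof -
  define p :: "complex poly" where "p = map_poly of_rat (min_poly \<beta>)"
  have "min_poly \<beta> \<noteq> 0" using min_poly_beta(1) by auto
  then have p: "p \<noteq> 0" by (simp add: p_def map_poly_eq_0_iff)
  have g: "galois_conjugates \<beta> = {z. poly p z = 0}" by (simp add: galois_conjugates_def p_def)
  show "finite (galois_conjugates \<beta>)" unfolding g using poly_roots_finite[OF p] .
  have "card {z. poly p z = 0} \<le> degree p" by (rule card_poly_roots_bound[OF p])
  also have "degree p = degree (min_poly \<beta>)" unfolding p_def by (intro degree_map_poly) auto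
  finally show "card (galois_conjugates \<beta>) \<le> degree (min_poly \<beta>)" unfolding g .
qed

lemma beta_in_galois_conjugates: "of_real \<beta> \<in> galois_conjugates \<beta>"
proof -
  have r: "complex_of_real (of_rat s) = of_rat s" for s
    by (cases s) (simp add: of_rat_rat)
  have "rat_eval p (complex_of_real x) = of_real (rat_eval p x)" for p and x :: real
    by (induction p) (simp_all add: rat_eval_def map_poly_pCons r)
  then show ?thesis using min_poly_beta(3) by (simp add: galois_conjugates_def rat_eval_def)
qed

text \<open>Enestroem--Kakeya: after division by the root \<open>\<beta>\<close>, the reciprocal polynomial has
  decreasing coefficients \<open>h k = q + \<dots> + q ^ (d - k)\<close>.\<close>

lemma conjugate_norm_lt_1:
  fixes z :: complex
  assumes z: "z ^ d = (\<Sum>i<d. z ^ i)" "z \<noteq> of_real \<beta>"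
  shows "norm z < 1" "z \<noteq> 0"
proof -
  have d0: "d > 0" using d2 by simp
  have "(\<Sum>i<d. (0::complex) ^ i) = 1" using d0 by (simp add: power_0_left)
  then show z0: "z \<noteq> 0" using z(1) d0 by (auto simp: power_0_left)
  show "norm z < 1"
  proof (rule ccontr)
    assume "\<not> norm z < 1"
    define w where "w = 1 / z"
    have w: "norm w \<le> 1" "w \<noteq> 0" "w * z = 1" using \<open>\<not> norm z < 1\<close> z0 by (auto simp: w_def norm_divide divide_simps)
    have w_sum: "(\<Sum>i<d. w ^ (i + 1)) = 1"
    proof -
      have "(\<Sum>i<d. w ^ (i + 1)) = (\<Sum>i<d. w ^ d * z ^ i)"
      proof (rule sum.reindex_bij_witness[of _ "\<lambda>i. d - 1 - i" "\<lambda>i. d - 1 - i"])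
        fix i assume "i \<in> {..<d}"
        then have "d = (i + 1) + (d - 1 - i)" by auto
        then have "w ^ d * z ^ (d - 1 - i) = w ^ (i+1) * (w ^ (d-1-i) * z ^ (d - 1 - i))"
          by (metis mult.assoc power_add)
        then show "w ^ d * z ^ (d - 1 - i) = w ^ (i+1)" using w(3) by (simp flip: power_mult_distrib)
      qed auto
      also have "\<dots> = w ^ d * z ^ d" by (simp add: z(1) sum_distrib_left)
      finally show ?thesis using w(3) by (simp flip: power_mult_distrib)
    qed
    define h where "h k = (\<Sum>i<d - k. q ^ (i + 1))" for k
    have h0: "h 0 = 1" using q_sum by (simp add: h_def)
    have hd: "h d = 0" by (simp add: h_def)
    have h_rec: "\<beta> * h k = 1 + h (Suc k)" if "k < d" for k
    proof -
      have "d - k = Suc (d - Suc k)" using that by simp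
      then have "h k = q + q * h (Suc k)"
        unfolding h_def by (simp add: sum.lessThan_Suc_shift sum_distrib_left del: sum.lessThan_Suc)
      then show ?thesis by (simp add: distrib_left flip: mult.assoc)
    qed
    have h_dec: "h k - h (Suc k) = q ^ (d - k)" if "k < d" for k
    proof -
      have "d - k = Suc (d - Suc k)" using that by simp
      then show ?thesis unfolding h_def by simp
    qed
    \<comment> \<open>The quotient of \<open>1 - (\<Sum>i<d. w ^ (i + 1))\<close> by
      \<open>1 - of_real \<beta> * w\<close>.\<close>
    define H where "H = (\<Sum>k<d. of_real (h k) * w ^ k)"
    have "(1 - of_real \<beta> * w) * H = 1 - (\<Sum>i<d. w ^ (i + 1))"
    proof -
      have "of_real \<beta> * w * H = (\<Sum>k<d. of_real (\<beta> * h k) * w ^ (k + 1))"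
        by (simp add: H_def sum_distrib_left mult_ac)
      also have "\<dots> = (\<Sum>k<d. w ^ (k + 1) + of_real (h (Suc k)) * w ^ Suc k)"
        by (rule sum.cong) (auto simp: h_rec distrib_right)
      also have "\<dots> = (\<Sum>k<d. w ^ (k + 1)) + (\<Sum>k<d. of_real (h (Suc k)) * w ^ Suc k)"
        by (rule sum.distrib)
      also have "(\<Sum>k<d. of_real (h (Suc k)) * w ^ Suc k) = (\<Sum>k<Suc d. of_real (h k) * w ^ k) - of_real (h 0)"
        by (subst sum.lessThan_Suc_shift) simp
      also have "\<dots> = H - 1" using hd h0 by (simp add: H_def)
      finally show ?thesis by (simp add: algebra_simps)
    qed
    then have "(1 - of_real \<beta> * w) * H = 0" using w_sum by simp
    moreover have "1 - of_real \<beta> * w \<noteq> 0"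
    proof
      assume "1 - of_real \<beta> * w = 0"
      then have "of_real \<beta> * (w * z) = z" by (simp flip: mult.assoc)
      then show False using w(3) z(2) by simp
    qed
    ultimately have H0: "H = 0" by simp
    \<comment> \<open>A convex combination of powers of \<open>w\<close> with the positive weights
      \<open>q ^ (d - k)\<close> equals 1 although no power exceeds 1 in norm. So all real parts are
      1; the first one yields \<open>w = 1\<close>, for which the sum in \<open>w_sum\<close> would
      be \<open>d\<close>.\<close>
    have a: "(\<Sum>k<d. of_real (h k - h (Suc k)) * w ^ Suc k) = 1"
    proof -
      have "(\<Sum>k<d. of_real (h k - h (Suc k)) * w ^ Suc k)
          = w * H - (\<Sum>k<d. of_real (h (Suc k)) * w ^ Suc k)"
        by (simp add: H_def sum_distrib_left algebra_simps sum_subtractf)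
      also have "(\<Sum>k<d. of_real (h (Suc k)) * w ^ Suc k) = (\<Sum>k<Suc d. of_real (h k) * w ^ k) - of_real (h 0)"
        by (subst sum.lessThan_Suc_shift) simp
      also have "\<dots> = H - 1" using hd h0 by (simp add: H_def)
      finally show ?thesis using H0 by simp
    qed
    have tele: "(\<Sum>k<d. h k - h (Suc k)) = 1" using h0 hd by (simp add: sum_lessThan_telescope')
    have "(\<Sum>k<d. (h k - h (Suc k)) * (1 - Re (w ^ Suc k))) = 0"
    proof -
      have "Re (\<Sum>k<d. of_real (h k - h (Suc k)) * w ^ Suc k) = (\<Sum>k<d. (h k - h (Suc k)) * Re (w ^ Suc k))"
        unfolding Re_sum by (rule sum.cong) (simp_all del: of_real_diff power_Suc)
      then have "(\<Sum>k<d. (h k - h (Suc k)) * Re (w ^ Suc k)) = 1" unfolding a by simp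
      then show ?thesis using tele by (simp add: right_diff_distrib sum_subtractf)
    qed
    moreover have nn: "(h k - h (Suc k)) * (1 - Re (w ^ Suc k)) \<ge> 0" if "k \<in> {..<d}" for k
    proof -
      have "Re (w ^ Suc k) \<le> norm (w ^ Suc k)" by (rule complex_Re_le_cmod)
      also have "\<dots> \<le> 1" using w(1) by (simp only: norm_power power_le_one norm_ge_zero)
      finally show ?thesis using that h_dec q_pow_pos by (intro mult_nonneg_nonneg) (auto simp: less_imp_le)
    qed
    ultimately have "(h 0 - h (Suc 0)) * (1 - Re (w ^ Suc 0)) = 0"
      using sum_nonneg_eq_0_iff[of "{..<d}" "\<lambda>k. (h k - h (Suc k)) * (1 - Re (w ^ Suc k))"] d0 by blast
    moreover have "h 0 - h (Suc 0) > 0" using h_dec[of 0] d0 q_pow_pos by simp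
    ultimately have Re1: "Re w = 1" by simp
    have "(Re w)\<^sup>2 + (Im w)\<^sup>2 \<le> 1" using w(1) by (simp add: cmod_def)
    then have "Im w = 0" using Re1 by simp
    then have "w = 1" using Re1 by (simp add: complex_eq_iff)
    then have "of_nat d = (1::complex)" using w_sum by simp
    then show False using d2 by simp
  qed
qed

lemma Zb_basis_sum:
  assumes "x \<in> int_adjoin \<beta>"
  obtains n :: "nat \<Rightarrow> int" where "x = (\<Sum>i<d. of_int (n i) * \<beta> ^ i)"
proof -
  have "\<exists>n :: nat \<Rightarrow> int. x = (\<Sum>i<d. of_int (n i) * \<beta> ^ i)"
    using assms
  proof (induction rule: int_adjoin_induct)
    case zero
    show ?case by (intro exI[of _ "\<lambda>_. 0"]) simp
  next
    case (step y k)
    then obtain n :: "nat \<Rightarrow> int" where n: "y = (\<Sum>i<d. of_int (n i) * \<beta> ^ i)" by blast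
    obtain m where m: "d = Suc m" using d2 by (cases d) auto
    define n' where "n' i = (if i = 0 then k else n (i - 1)) + n m" for i
    have "\<beta> * y = (\<Sum>i<d. of_int (n i) * \<beta> ^ Suc i)" by (simp add: n sum_distrib_left mult_ac)
    also have "\<dots> = (\<Sum>i<m. of_int (n i) * \<beta> ^ Suc i) + of_int (n m) * \<beta> ^ d" by (simp add: m)
    also have "of_int (n m) * \<beta> ^ d = (\<Sum>i<d. of_int (n m) * \<beta> ^ i)" by (simp add: bd sum_distrib_left)
    also have "of_int k + ((\<Sum>i<m. of_int (n i) * \<beta> ^ Suc i) + (\<Sum>i<d. of_int (n m) * \<beta> ^ i))
       = (\<Sum>i<d. of_int (if i = 0 then k else n (i - 1)) * \<beta> ^ i) + (\<Sum>i<d. of_int (n m) * \<beta> ^ i)"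
      unfolding m by (subst sum.lessThan_Suc_shift) (simp del: sum.lessThan_Suc)
    also have "\<dots> = (\<Sum>i<d. of_int (n' i) * \<beta> ^ i)"
      unfolding n'_def sum.distrib[symmetric] by (rule sum.cong) (auto simp: distrib_right)
    finally show ?case by metis
  qed
  then show ?thesis using that by blast
qed

end

locale rauzy_setting = dbonacci +
  fixes e :: nat and b :: "nat \<Rightarrow> complex" and \<sigma> :: "nat \<Rightarrow> real \<Rightarrow> complex" and \<iota> :: "'n::finite \<Rightarrow> nat"
  assumes gal_nonreal: "galois_conjugates \<beta> - \<real> = b ` {1..e} \<union> cnj ` b ` {1..e}"
    and card_nonreal: "card (galois_conjugates \<beta> - \<real>) = 2 * e"
    and gal_real: "galois_conjugates \<beta> \<inter> \<real> - {of_real \<beta>} = b ` {e+1..d-e-1}"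
    and card_real: "card (galois_conjugates \<beta> \<inter> \<real> - {of_real \<beta>}) = d - 2 * e - 1"
    and iso: "\<And>j. j \<in> {1..d-e-1} \<Longrightarrow>
           field_iso_on (\<sigma> j) (rat_adjoin \<beta>) (rat_adjoin (b j)) \<and> \<sigma> j \<beta> = b j"
    and bij_\<iota>: "bij_betw \<iota> UNIV {1..d-1}"
begin

definition N :: nat where "N = d - e - 1"

abbreviation \<Phi> :: "real \<Rightarrow> real ^ 'n" where "\<Phi> \<equiv> Phi d e \<sigma> \<iota>"

lemma Phi_nth: "\<Phi> x $ i = (if \<iota> i \<le> N then Re (\<sigma> (\<iota> i) x) else Im (\<sigma> (\<iota> i - N) x))"
  by (simp add: Phi_def N_def)

text \<open>The prescribed numbers of conjugates add up to \<open>d\<close> and cannot exceed the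
  degree of \<open>min_poly \<beta>\<close>, so that degree is \<open>d\<close>. The count also
  shows that the subtraction \<open>d - 2 * e - 1\<close> is not truncated.\<close>

lemma card_gal: "card (galois_conjugates \<beta>) = d" and e_bound: "2 * e + 1 \<le> d"
proof -
  let ?G = "galois_conjugates \<beta>"
  have G: "?G = (?G - \<real>) \<union> (insert (of_real \<beta>) (?G \<inter> \<real> - {of_real \<beta>}))"
    using beta_in_galois_conjugates by auto
  have "card ?G = card (?G - \<real>) + card (insert (of_real \<beta>) (?G \<inter> \<real> - {of_real \<beta>}))"
    using finite_galois_conjugates(1) by (subst G, subst card_Un_disjoint) auto
  also have "\<dots> = 2 * e + Suc (d - 2 * e - 1)"
    using finite_galois_conjugates(1) card_real by (subst card_insert_disjoint) (auto simp: card_nonreal)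
  finally have 1: "card ?G = 2 * e + Suc (d - 2 * e - 1)" .
  moreover have "card ?G \<le> d" using finite_galois_conjugates(2) degree_min_poly_le by linarith
  ultimately show "2 * e + 1 \<le> d" by linarith
  then show "card ?G = d" using 1 by linarith
qed

lemma N_e: "e \<le> N" "N + e = d - 1" "N < d"
  using e_bound d2 by (auto simp: N_def)

lemma b_nonreal: "j \<in> {1..e} \<Longrightarrow> b j \<in> galois_conjugates \<beta> - \<real>"
  unfolding gal_nonreal by blast

lemma b_real: "j \<in> {e+1..N} \<Longrightarrow> b j \<in> galois_conjugates \<beta> \<inter> \<real> - {of_real \<beta>}"
  unfolding gal_real N_def by blast

lemma Im_b_real: "j \<in> {e+1..N} \<Longrightarrow> Im (b j) = 0"
  using b_real[of j] by (simp add: complex_is_Real_iff)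

lemma b_norm: assumes "j \<in> {1..N}" shows "norm (b j) < 1" "b j \<noteq> 0"
proof -
  have "b j \<in> galois_conjugates \<beta> \<and> b j \<noteq> of_real \<beta>"
    using b_nonreal[of j] b_real[of j] assms by (cases "j \<le> e") auto
  then show "norm (b j) < 1" "b j \<noteq> 0" using conjugate_norm_lt_1 galois_conjugates_root by blast+
qed

lemma \<sigma>_props:
  assumes "j \<in> {1..N}"
  shows "\<sigma> j \<beta> = b j" "\<sigma> j 0 = 0" "\<sigma> j 1 = 1"
    "x \<in> int_adjoin \<beta> \<Longrightarrow> y \<in> int_adjoin \<beta> \<Longrightarrow> \<sigma> j (x + y) = \<sigma> j x + \<sigma> j y"
    "x \<in> int_adjoin \<beta> \<Longrightarrow> y \<in> int_adjoin \<beta> \<Longrightarrow> \<sigma> j (x * y) = \<sigma> j x * \<sigma> j y"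
    "\<sigma> j (of_int k) = of_int k"
  using iso[of j] assms field_iso_on_int_adjoin[of "\<sigma> j" \<beta> "rat_adjoin (b j)"] by (auto simp: N_def)

lemma \<sigma>_pow: "j \<in> {1..N} \<Longrightarrow> \<sigma> j (\<beta> ^ n) = b j ^ n"
  by (induction n) (simp_all add: \<sigma>_props)

lemma \<sigma>_sum:
  assumes "j \<in> {1..N}" "\<And>i. i \<in> A \<Longrightarrow> f i \<in> int_adjoin \<beta>"
  shows "\<sigma> j (\<Sum>i\<in>A. f i) = (\<Sum>i\<in>A. \<sigma> j (f i))"
  using assms(2) by (induction A rule: infinite_finite_induct) (simp_all add: \<sigma>_props[OF assms(1)])

section \<open>Coordinates of the space of conjugates\<close>

definition idx :: "nat \<Rightarrow> 'n" where "idx k = inv_into UNIV \<iota> k"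

lemma idx: "k \<in> {1..d-1} \<Longrightarrow> \<iota> (idx k) = k" "idx (\<iota> i) = i"
  using bij_\<iota> by (auto simp: idx_def bij_betw_def f_inv_into_f)

lemma \<iota>_range: "\<iota> i \<in> {1..d-1}"
  using bij_\<iota> by (auto simp: bij_betw_def)

text \<open>The vector \<open>z\<close> as a family of complex coordinates, of which the first \<open>e\<close> are arbitrary and
  the others real.\<close>

definition zc :: "real ^ 'n \<Rightarrow> nat \<Rightarrow> complex" where
  "zc z j = Complex (z $ idx j) (if j \<le> e then z $ idx (N + j) else 0)"

lemma zc_linear: "zc (x + y) j = zc x j + zc y j" "zc (r *\<^sub>R x) j = r *\<^sub>R zc x j" "zc 0 j = 0"
  by (auto simp: zc_def complex_eq_iff)

lemma zc_nth: "z $ i = (if \<iota> i \<le> N then Re (zc z (\<iota> i)) else Im (zc z (\<iota> i - N)))"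
proof (cases "\<iota> i \<le> N")
  case False
  then have "\<iota> i - N \<le> e" "N + (\<iota> i - N) = \<iota> i" using \<iota>_range[of i] N_e by auto
  then show ?thesis using False by (simp add: zc_def idx)
qed (simp add: zc_def idx)

lemma zc_eqI: "(\<And>j. j \<in> {1..N} \<Longrightarrow> zc x j = zc y j) \<Longrightarrow> x = y"
proof -
  assume *: "\<And>j. j \<in> {1..N} \<Longrightarrow> zc x j = zc y j"
  have "x $ i = y $ i" for i
  proof (cases "\<iota> i \<le> N")
    case True
    then show ?thesis using *[of "\<iota> i"] \<iota>_range[of i] zc_nth[of x i] zc_nth[of y i] by simp
  next
    case False
    then have "\<iota> i - N \<in> {1..N}" using \<iota>_range[of i] N_e by auto
    then show ?thesis using False *[of "\<iota> i - N"] zc_nth[of x i] zc_nth[of y i] by simp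
  qed
  then show "x = y" by (simp add: vec_eq_iff)
qed

lemma norm_zc: "(norm z)\<^sup>2 = (\<Sum>j=1..N. (norm (zc z j))\<^sup>2)"
proof -
  have "(norm z)\<^sup>2 = (\<Sum>i\<in>UNIV. (z $ i)\<^sup>2)"
    unfolding power2_norm_eq_inner inner_vec_def by (simp add: power2_eq_square)
  also have "\<dots> = (\<Sum>i\<in>UNIV. (\<lambda>k. (z $ idx k)\<^sup>2) (\<iota> i))" by (simp add: idx)
  also have "\<dots> = (\<Sum>k=1..d-1. (z $ idx k)\<^sup>2)" by (rule sum.reindex_bij_betw[OF bij_\<iota>])
  also have "{1..d-1} = {1..N} \<union> {N+1..N+e}" using N_e by auto
  also have "(\<Sum>k\<in>{1..N} \<union> {N+1..N+e}. (z $ idx k)\<^sup>2)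
      = (\<Sum>k=1..N. (z $ idx k)\<^sup>2) + (\<Sum>k=N+1..N+e. (z $ idx k)\<^sup>2)"
    by (rule sum.union_disjoint) auto
  also have "(\<Sum>k=N+1..N+e. (z $ idx k)\<^sup>2) = (\<Sum>k=1..e. (z $ idx (N + k))\<^sup>2)"
    by (rule sum.reindex_bij_witness[of _ "\<lambda>k. N + k" "\<lambda>k. k - N"]) auto
  also have "\<dots> = (\<Sum>k=1..N. if k \<le> e then (z $ idx (N + k))\<^sup>2 else 0)"
    using N_e(1) by (intro sum.mono_neutral_cong_left) auto
  also have "(\<Sum>k=1..N. (z $ idx k)\<^sup>2) + \<dots> = (\<Sum>j=1..N. (norm (zc z j))\<^sup>2)"
    unfolding sum.distrib[symmetric] by (rule sum.cong) (auto simp: zc_def cmod_power2)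
  finally show ?thesis .
qed

lemma zc_\<Phi>:
  assumes j: "j \<in> {1..N}" and x: "x \<in> int_adjoin \<beta>"
  shows "zc (\<Phi> x) j = \<sigma> j x"
proof -
  have "Im (\<sigma> j x) = 0" if "j > e"
    using x
  proof (induction rule: int_adjoin_induct)
    case (step y k)
    have "\<sigma> j (of_int k + \<beta> * y) = of_int k + b j * \<sigma> j y"
      using step(1) by (simp add: \<sigma>_props[OF j])
    then show ?case using step Im_b_real[of j] j that by simp
  qed (simp add: \<sigma>_props[OF j])
  moreover have "N + j \<in> {1..d-1}" "\<not> N + j \<le> N" if "j \<le> e" using j that N_e by auto
  moreover have "j \<in> {1..d-1}" "j \<le> N" using j N_e by auto
  ultimately show ?thesis by (auto simp: zc_def Phi_nth idx complex_eq_iff)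
qed

lemma \<Phi>_add: "x \<in> int_adjoin \<beta> \<Longrightarrow> y \<in> int_adjoin \<beta> \<Longrightarrow> \<Phi> (x + y) = \<Phi> x + \<Phi> y"
  by (rule zc_eqI) (simp add: zc_\<Phi> zc_linear \<sigma>_props)

definition M :: "real ^ 'n \<Rightarrow> real ^ 'n" where
  "M z = (\<chi> i. if \<iota> i \<le> N then Re (b (\<iota> i) * zc z (\<iota> i)) else Im (b (\<iota> i - N) * zc z (\<iota> i - N)))"

lemma zc_M:
  assumes j: "j \<in> {1..N}"
  shows "zc (M z) j = b j * zc z j"
proof -
  have "Im (b j * zc z j) = 0" if "j > e" using that Im_b_real[of j] j by (simp add: zc_def)
  moreover have "N + j \<in> {1..d-1}" "\<not> N + j \<le> N" if "j \<le> e" using j that N_e by auto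
  moreover have "j \<in> {1..d-1}" "j \<le> N" using j N_e by auto
  ultimately show ?thesis unfolding zc_def[of "M z"] by (auto simp: M_def idx complex_eq_iff)
qed

lemma \<Phi>_beta: "x \<in> int_adjoin \<beta> \<Longrightarrow> \<Phi> (\<beta> * x) = M (\<Phi> x)"
  by (rule zc_eqI) (simp add: zc_\<Phi> zc_M \<sigma>_props)

lemma linear_M: "linear M"
  by (rule linearI; rule zc_eqI) (simp_all add: zc_M zc_linear distrib_left)

text \<open>The element \<open>1/2\<close> makes positivity and the existence of the maximum
  immediate.\<close>

definition \<rho> :: real where "\<rho> = Max (insert (1/2) ((\<lambda>j. norm (b j)) ` {1..N}))"

lemma \<rho>_bounds: "0 < \<rho>" "\<rho> < 1" "j \<in> {1..N} \<Longrightarrow> norm (b j) \<le> \<rho>"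
proof -
  have "1 / 2 \<le> \<rho>" unfolding \<rho>_def by (rule Max_ge) auto
  then show "0 < \<rho>" by linarith
  show "\<rho> < 1" unfolding \<rho>_def using b_norm by (subst Max_less_iff) auto
  show "j \<in> {1..N} \<Longrightarrow> norm (b j) \<le> \<rho>" unfolding \<rho>_def by (rule Max_ge) auto
qed

lemma norm_M: "norm (M z) \<le> \<rho> * norm z"
proof -
  have "(norm (M z))\<^sup>2 \<le> (\<Sum>j=1..N. \<rho>\<^sup>2 * (norm (zc z j))\<^sup>2)"
    unfolding norm_zc using \<rho>_bounds
    by (intro sum_mono) (auto simp: zc_M norm_mult power_mult_distrib intro!: mult_right_mono power_mono)
  also have "\<dots> = (\<rho> * norm z)\<^sup>2"
    by (simp add: sum_distrib_left norm_zc power_mult_distrib)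
  finally show ?thesis using \<rho>_bounds by (simp add: power2_le_iff_abs_le)
qed

lemma inj_M: "inj M"
  unfolding linear_injective_0[OF linear_M]
proof (intro allI impI)
  fix z assume "M z = 0"
  then have "b j * zc z j = 0" if "j \<in> {1..N}" for j using zc_M[OF that, of z] by (simp add: zc_linear)
  then show "z = 0" using b_norm(2) by (intro zc_eqI) (auto simp: zc_linear)
qed

text \<open>The powers \<open>\<beta> ^ i\<close> with \<open>i < d\<close> are indexed by \<open>'n option\<close>, so that the embedding of the lattice
  into \<open>\<real> \<times> \<real> ^ 'n\<close> becomes an endomorphism \<open>\<Lambda>\<close>.\<close>

definition pos :: "'n option \<Rightarrow> nat" where "pos k = (case k of None \<Rightarrow> 0 | Some i \<Rightarrow> \<iota> i)"

lemma bij_pos: "bij_betw pos UNIV {..<d}"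
proof -
  have i: "\<iota> i \<noteq> 0" "\<iota> i < d" for i using \<iota>_range[of i] d2 by auto
  have inj: "\<iota> i = \<iota> j \<longleftrightarrow> i = j" for i j using bij_\<iota> by (auto simp: bij_betw_def inj_eq)
  have "inj pos"
  proof (rule injI)
    fix k l assume "pos k = pos l"
    then show "k = l" using i(1) by (cases k; cases l) (simp_all add: pos_def inj)
  qed
  moreover have "pos ` UNIV = {..<d}"
  proof (intro subset_antisym subsetI)
    fix k assume "k \<in> pos ` UNIV"
    then obtain m where "k = pos m" by blast
    then show "k \<in> {..<d}" using d2 i(2) by (cases m) (simp_all add: pos_def)
  next
    fix k assume "k \<in> {..<d}"
    then have "k = pos (if k = 0 then None else Some (idx k))" using idx(1)[of k] by (simp add: pos_def)
    then show "k \<in> pos ` UNIV" by blast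
  qed
  ultimately show ?thesis by (simp add: bij_betw_def)
qed

definition ev :: "real ^ 'n option \<Rightarrow> complex \<Rightarrow> complex" where
  "ev a z = (\<Sum>k\<in>UNIV. of_real (a $ k) * z ^ pos k)"

lemma ev_linear: "ev (x + y) z = ev x z + ev y z" "ev (r *\<^sub>R x) z = r *\<^sub>R ev x z"
proof -
  show "ev (x + y) z = ev x z + ev y z" by (simp add: ev_def distrib_right sum.distrib)
  show "ev (r *\<^sub>R x) z = r *\<^sub>R ev x z"
    unfolding ev_def scaleR_sum_right by (rule sum.cong) (simp_all add: scaleR_conv_of_real[where 'a = complex])
qed

lemma ev_real: "z \<in> \<real> \<Longrightarrow> Im (ev a z) = 0"
proof -
  assume "z \<in> \<real>"
  then have "ev a z \<in> \<real>" unfolding ev_def by (intro sum_in_Reals Reals_mult Reals_power) auto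
  then show ?thesis by (simp add: complex_is_Real_iff)
qed

lemma ev_cnj: "ev a (cnj z) = cnj (ev a z)"
  by (simp add: ev_def)

definition \<Lambda> :: "real ^ 'n option \<Rightarrow> real ^ 'n option" where
  "\<Lambda> a = (\<chi> k. case k of None \<Rightarrow> Re (ev a (of_real \<beta>))
     | Some i \<Rightarrow> if \<iota> i \<le> N then Re (ev a (b (\<iota> i))) else Im (ev a (b (\<iota> i - N))))"

lemma linear_\<Lambda>: "linear \<Lambda>"
  by (rule linearI) (auto simp: \<Lambda>_def vec_eq_iff ev_linear split: option.splits)

text \<open>If \<open>\<Lambda> a = 0\<close>, the real polynomial with coefficients
  \<open>a\<close> vanishes at all \<open>d\<close> conjugates, at half of the non-real ones by
  complex conjugation; its degree is less than \<open>d\<close>, so it is 0.\<close>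

lemma inj_\<Lambda>: "inj \<Lambda>"
  unfolding linear_injective_0[OF linear_\<Lambda>]
proof (intro allI impI)
  fix a assume a: "\<Lambda> a = 0"
  have None: "Re (ev a (of_real \<beta>)) = 0" using arg_cong[OF a, of "\<lambda>v. v $ None"] by (simp add: \<Lambda>_def)
  have Some: "(if \<iota> i \<le> N then Re (ev a (b (\<iota> i))) else Im (ev a (b (\<iota> i - N)))) = 0" for i
    using arg_cong[OF a, of "\<lambda>v. v $ Some i"] by (simp add: \<Lambda>_def)
  have root_b: "ev a (b j) = 0" if j: "j \<in> {1..N}" for j
  proof -
    have "\<iota> (idx j) = j" using j N_e by (intro idx) auto
    then have "Re (ev a (b j)) = 0" using Some[of "idx j"] j by simp
    moreover have "Im (ev a (b j)) = 0"
    proof (cases "j \<le> e")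
      case True
      then have "\<iota> (idx (N + j)) = N + j" using j N_e by (intro idx) auto
      then show ?thesis using Some[of "idx (N + j)"] j by simp
    next
      case False
      then show ?thesis using b_real[of j] j by (intro ev_real) auto
    qed
    ultimately show ?thesis by (simp add: complex_eq_iff)
  qed
  have root: "ev a z = 0" if "z \<in> galois_conjugates \<beta>" for z
  proof -
    have "z = of_real \<beta> \<or> z \<in> galois_conjugates \<beta> - \<real> \<or> z \<in> galois_conjugates \<beta> \<inter> \<real> - {of_real \<beta>}"
      using that by blast
    then consider "z = of_real \<beta>" | "z \<in> b ` {e+1..N}" | "z \<in> b ` {1..e}" | "z \<in> cnj ` b ` {1..e}"
      unfolding gal_nonreal gal_real[folded N_def] by blast
    then show ?thesis
    proof cases
      case 1
      have "ev a (of_real \<beta>) = 0" using None ev_real[of "of_real \<beta>" a] by (simp add: complex_eq_iff)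
      then show ?thesis using 1 by simp
    next
      case 2
      then obtain j where "j \<in> {e+1..N}" "z = b j" by blast
      then show ?thesis using root_b[of j] by simp
    next
      case 3
      then obtain j where "j \<in> {1..e}" "z = b j" by blast
      then show ?thesis using root_b[of j] N_e(1) by simp
    next
      case 4
      then obtain j where "j \<in> {1..e}" "z = cnj (b j)" by blast
      then show ?thesis using root_b[of j] N_e(1) by (simp add: ev_cnj)
    qed
  qed
  define p where "p = (\<Sum>k\<in>UNIV. monom (complex_of_real (a $ k)) (pos k))"
  have poly_p: "poly p z = ev a z" for z by (simp add: p_def ev_def poly_sum poly_monom)
  have inj_pos: "pos k = pos k' \<longleftrightarrow> k = k'" for k k' using bij_pos by (auto simp: bij_betw_def inj_eq)
  have coeff_p: "coeff p (pos k) = a $ k" for k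
    by (simp add: p_def coeff_sum inj_pos if_distrib[of of_real] cong: if_cong)
  have "p = 0"
  proof (rule ccontr)
    assume p: "p \<noteq> 0"
    have "pos k < d" for k using bij_pos by (auto simp: bij_betw_def)
    then have "degree p < d"
      unfolding p_def using d2 by (intro degree_sum_less) (auto intro: le_less_trans[OF degree_monom_le])
    moreover have "card (galois_conjugates \<beta>) \<le> card {z. poly p z = 0}"
      using root poly_roots_finite[OF p] by (intro card_mono) (auto simp: poly_p)
    moreover have "card {z. poly p z = 0} \<le> degree p" by (rule card_poly_roots_bound[OF p])
    ultimately show False using card_gal by linarith
  qed
  then have "a $ k = 0" for k using coeff_p[of k] by simp
  then show "a = 0" by (simp add: vec_eq_iff)
qed

section \<open>Z[\<beta>] as a lattice\<close>

definition lat :: "('n option \<Rightarrow> int) \<Rightarrow> real" where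
  "lat n = (\<Sum>k\<in>UNIV. of_int (n k) * \<beta> ^ pos k)"

lemma lat_in_Zb: "lat n \<in> int_adjoin \<beta>"
  by (simp add: lat_def)

lemma Zb_lat: "x \<in> int_adjoin \<beta> \<Longrightarrow> \<exists>n. x = lat n"
proof -
  assume "x \<in> int_adjoin \<beta>"
  then obtain m :: "nat \<Rightarrow> int" where "x = (\<Sum>i<d. of_int (m i) * \<beta> ^ i)" using Zb_basis_sum by blast
  also have "\<dots> = (\<Sum>k\<in>UNIV. of_int (m (pos k)) * \<beta> ^ pos k)"
    by (rule sum.reindex_bij_betw[OF bij_pos, symmetric])
  finally show ?thesis by (auto simp: lat_def)
qed

lemma \<Lambda>_lat: "\<Lambda> (\<chi> k. of_int (n k)) $ None = lat n" "\<Lambda> (\<chi> k. of_int (n k)) $ Some i = \<Phi> (lat n) $ i"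
proof -
  have "ev (\<chi> k. of_int (n k)) (of_real \<beta>) = of_real (lat n)"
    by (simp add: ev_def lat_def)
  then show "\<Lambda> (\<chi> k. of_int (n k)) $ None = lat n" by (simp add: \<Lambda>_def)
  have "ev (\<chi> k. of_int (n k)) (b j) = \<sigma> j (lat n)" if j: "j \<in> {1..N}" for j
    by (simp add: ev_def lat_def \<sigma>_sum[OF j] \<sigma>_props[OF j] \<sigma>_pow[OF j])
  moreover have "\<iota> i \<in> {1..N}" if "\<iota> i \<le> N" using that \<iota>_range[of i] by auto
  moreover have "\<iota> i - N \<in> {1..N}" if "\<not> \<iota> i \<le> N" using that \<iota>_range[of i] N_e by auto
  ultimately show "\<Lambda> (\<chi> k. of_int (n k)) $ Some i = \<Phi> (lat n) $ i"
    by (simp add: \<Lambda>_def Phi_nth)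
qed

lemma \<Phi>_discrete: "finite {x \<in> int_adjoin \<beta>. \<bar>x\<bar> \<le> R \<and> norm (\<Phi> x) \<le> R}"
proof -
  obtain B where B: "B > 0" "\<And>a. B * norm a \<le> norm (\<Lambda> a)"
    using linear_inj_bounded_below_pos[OF linear_\<Lambda> inj_\<Lambda>] by metis
  define m where "m = \<lceil>(of_nat (CARD('n option)) * \<bar>R\<bar>) / B\<rceil>"
  define S where "S = {n :: 'n option \<Rightarrow> int. \<forall>k. n k \<in> {-m..m}}"
  have "S = Pi\<^sub>E UNIV (\<lambda>_. {-m..m})" by (auto simp: S_def)
  then have "finite S" by (simp add: finite_PiE)
  moreover have "{x \<in> int_adjoin \<beta>. \<bar>x\<bar> \<le> R \<and> norm (\<Phi> x) \<le> R} \<subseteq> lat ` S"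
  proof
    fix x assume "x \<in> {x \<in> int_adjoin \<beta>. \<bar>x\<bar> \<le> R \<and> norm (\<Phi> x) \<le> R}"
    then have x: "x \<in> int_adjoin \<beta>" "\<bar>x\<bar> \<le> R" "norm (\<Phi> x) \<le> R" by auto
    obtain n where n: "x = lat n" using Zb_lat[OF x(1)] by blast
    define a :: "real ^ 'n option" where "a = (\<chi> k. of_int (n k))"
    have "\<bar>\<Lambda> a $ k\<bar> \<le> \<bar>R\<bar>" for k
    proof (cases k)
      case None
      then show ?thesis using x(2) \<Lambda>_lat(1)[of n] by (simp add: a_def n)
    next
      case (Some i)
      have "\<bar>\<Phi> x $ i\<bar> \<le> norm (\<Phi> x)" by (rule component_le_norm_cart)
      then show ?thesis using x(3) \<Lambda>_lat(2)[of n i] Some by (simp add: a_def n)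
    qed
    then have "norm (\<Lambda> a) \<le> (\<Sum>k\<in>(UNIV::'n option set). \<bar>R\<bar>)"
      by (intro order_trans[OF norm_le_l1_cart] sum_mono)
    then have "B * norm a \<le> of_nat (CARD('n option)) * \<bar>R\<bar>" using B(2)[of a] by simp
    then have na: "norm a \<le> of_nat (CARD('n option)) * \<bar>R\<bar> / B" using B(1) by (simp add: field_simps)
    have "\<bar>n k\<bar> \<le> m" for k
    proof -
      have "\<bar>a $ k\<bar> \<le> norm a" by (rule component_le_norm_cart)
      then have "real_of_int \<bar>n k\<bar> \<le> of_nat (CARD('n option)) * \<bar>R\<bar> / B" using na by (simp add: a_def)
      then show ?thesis unfolding m_def by linarith
    qed
    then have "- m \<le> n k \<and> n k \<le> m" for k by (meson abs_le_iff minus_le_iff)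
    then have "n \<in> S" by (simp add: S_def)
    then show "x \<in> lat ` S" using n by blast
  qed
  ultimately show ?thesis using finite_surj by blast
qed

text \<open>\<Lambda> is bijective: solve for real coefficients and round them.\<close>

lemma \<Phi>_dense_slab:
  obtains R where "R > 0" "\<And>t z. \<exists>x\<in>int_adjoin \<beta>. \<bar>t - x\<bar> \<le> R \<and> norm (z - \<Phi> x) \<le> R"
proof -
  obtain B where B: "B > 0" "\<And>a. norm (\<Lambda> a) \<le> B * norm a" using linear_bounded_pos[OF linear_\<Lambda>] by metis
  define R0 where "R0 = B * CARD('n option)"
  have R0: "R0 > 0" using B by (simp add: R0_def)
  have "\<exists>x\<in>int_adjoin \<beta>. \<bar>t - x\<bar> \<le> R0 \<and> norm (z - \<Phi> x) \<le> CARD('n) * R0" for t z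
  proof -
    define v :: "real ^ 'n option" where "v = (\<chi> k. case k of None \<Rightarrow> t | Some i \<Rightarrow> z $ i)"
    obtain a where a: "v = \<Lambda> a" using linear_inj_imp_surj[OF linear_\<Lambda> inj_\<Lambda>] unfolding surj_def by blast
    define n where "n k = \<lfloor>a $ k\<rfloor>" for k
    define x where "x = lat n"
    have "\<bar>(a - (\<chi> k. of_int (n k))) $ k\<bar> \<le> 1" for k
      unfolding n_def by (simp, linarith)
    then have "norm (a - (\<chi> k. of_int (n k))) \<le> (\<Sum>k\<in>(UNIV::'n option set). 1)"
      by (intro order_trans[OF norm_le_l1_cart] sum_mono)
    then have "B * norm (a - (\<chi> k. of_int (n k))) \<le> R0" using B(1) by (simp add: R0_def)
    then have d: "norm (v - \<Lambda> (\<chi> k. of_int (n k))) \<le> R0"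
      using B(2)[of "a - (\<chi> k. of_int (n k))"] by (simp add: a linear_diff[OF linear_\<Lambda>])
    have comp: "\<bar>(v - \<Lambda> (\<chi> k. of_int (n k))) $ k\<bar> \<le> R0" for k
      using component_le_norm_cart[of "v - \<Lambda> (\<chi> k. of_int (n k))" k] d by linarith
    have "\<bar>t - x\<bar> \<le> R0" using comp[of None] by (simp add: v_def \<Lambda>_lat x_def)
    moreover have "\<bar>(z - \<Phi> x) $ i\<bar> \<le> R0" for i using comp[of "Some i"] by (simp add: v_def \<Lambda>_lat x_def)
    then have "norm (z - \<Phi> x) \<le> (\<Sum>i\<in>(UNIV::'n set). R0)"
      by (intro order_trans[OF norm_le_l1_cart] sum_mono)
    ultimately show ?thesis using lat_in_Zb by (auto simp: x_def)
  qed
  note slab = this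
  show ?thesis
  proof (rule that[of "max R0 (CARD('n) * R0)"])
    show "\<exists>x\<in>int_adjoin \<beta>. \<bar>t - x\<bar> \<le> max R0 (CARD('n) * R0) \<and> norm (z - \<Phi> x) \<le> max R0 (CARD('n) * R0)" for t z
      using slab[of t z] by (meson le_max_iff_disj)
  qed (use R0 in auto)
qed

lemma \<Phi>_pow: "x \<in> int_adjoin \<beta> \<Longrightarrow> \<Phi> (\<beta> ^ n * x) = (M ^^ n) (\<Phi> x)"
proof (induction n)
  case (Suc n)
  then show ?case using \<Phi>_beta[of "\<beta> ^ n * x"] by (simp add: mult.assoc)
qed simp

lemma M_pow_linear_inj: "linear (M ^^ n) \<and> inj (M ^^ n)"
proof (induction n)
  case 0
  show ?case by (simp add: linear_iff)
next
  case (Suc n)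
  then show ?case unfolding funpow.simps using linear_compose linear_M inj_compose inj_M by blast
qed

text \<open>Multiplication by \<open>q ^ n\<close> squeezes the real coordinate of the slab below
  \<epsilon> and stretches the conjugate space only by the inverse of \<open>M ^^ n\<close>. The
  slab is centred at \<open>t = R\<close>, so that \<open>x\<close>, and with it \<open>v\<close>,
  is nonnegative.\<close>

lemma \<Phi>_dense:
  assumes "\<epsilon> > 0"
  shows "\<exists>R. \<forall>z. \<exists>v\<in>int_adjoin \<beta>. 0 \<le> v \<and> v < \<epsilon> \<and> norm (z - \<Phi> v) \<le> R"
proof -
  obtain R where R: "R > 0" "\<And>t z. \<exists>x\<in>int_adjoin \<beta>. \<bar>t - x\<bar> \<le> R \<and> norm (z - \<Phi> x) \<le> R"
    using \<Phi>_dense_slab by metis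
  have "\<epsilon> / (2 * R) > 0" using assms R by simp
  then obtain n where n: "q ^ n < \<epsilon> / (2 * R)" using q_pow_small by blast
  obtain B where B: "B > 0" "\<And>a. B * norm a \<le> norm ((M ^^ n) a)"
    using linear_inj_bounded_below_pos M_pow_linear_inj by metis
  have "\<exists>v\<in>int_adjoin \<beta>. 0 \<le> v \<and> v < \<epsilon> \<and> norm (z - \<Phi> v) \<le> R / B" for z
  proof -
    obtain x where x: "x \<in> int_adjoin \<beta>" "\<bar>R - x\<bar> \<le> R" "norm ((M ^^ n) z - \<Phi> x) \<le> R" using R(2) by blast
    define v where "v = q ^ n * x"
    have v: "v \<in> int_adjoin \<beta>" using x(1) by (simp add: v_def)
    have "0 \<le> v" using x(2) q_pow_pos[of n] by (simp add: v_def)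
    have "v \<le> q ^ n * (2 * R)" unfolding v_def using x(2) q_pow_pos[of n] by (intro mult_left_mono) auto
    also have "\<dots> < \<epsilon>" using n R(1) by (simp add: field_simps)
    finally have "v < \<epsilon>" .
    have "x = \<beta> ^ n * v" using beta_pow_q[of n] by (simp add: v_def flip: mult.assoc)
    then have "(M ^^ n) (z - \<Phi> v) = (M ^^ n) z - \<Phi> x"
      using \<Phi>_pow[OF v] linear_diff[of "M ^^ n" z "\<Phi> v"] M_pow_linear_inj by simp
    then have "B * norm (z - \<Phi> v) \<le> R" using B(2)[of "z - \<Phi> v"] x(3) by simp
    then show ?thesis using v \<open>0 \<le> v\<close> \<open>v < \<epsilon>\<close> B(1) by (auto simp: field_simps)
  qed
  then show ?thesis by blast
qed

text \<open>The factor maps \<open>L\<close> into Z[\<beta>]. It is also the slope of the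
  conjugation \<psi>, so the arguments of \<Phi> for \<open>u\<close> and for
  \<open>\<psi> u\<close> differ by 0 or 1.\<close>

definition \<phi> :: "real \<Rightarrow> real ^ 'n" where "\<phi> u = \<Phi> ((\<beta> - 1) * u)"

text \<open>On Z[\<beta>] the map \<phi> is \<Phi> followed by \<open>M - id\<close>, which is
  bijective because \<open>M\<close> is a strict contraction.\<close>

lemma \<phi>_dense:
  assumes "\<epsilon> > 0"
  shows "\<exists>R. \<forall>z. \<exists>v\<in>int_adjoin \<beta>. 0 \<le> v \<and> v < \<epsilon> \<and> norm (z - \<phi> v) \<le> R"
proof -
  obtain R where R: "\<And>z. \<exists>v\<in>int_adjoin \<beta>. 0 \<le> v \<and> v < \<epsilon> \<and> norm (z - \<Phi> v) \<le> R"
    using \<Phi>_dense[OF assms] by blast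
  define g where "g z = M z - z" for z
  have lg: "linear g" unfolding g_def using linear_compose_sub[OF linear_M linear_ident] by simp
  have "inj g" unfolding linear_injective_0[OF lg]
  proof (intro allI impI)
    fix z assume "g z = 0"
    then have "norm z \<le> \<rho> * norm z" using norm_M[of z] by (simp add: g_def)
    then have "norm z * (1 - \<rho>) \<le> 0" by (simp add: algebra_simps)
    then show "z = 0" using \<rho>_bounds by (simp add: mult_le_0_iff)
  qed
  then have "surj g" using linear_inj_imp_surj lg by blast
  obtain B where B: "B > 0" "\<And>a. norm (g a) \<le> B * norm a" using linear_bounded_pos[OF lg] by metis
  have "\<exists>v\<in>int_adjoin \<beta>. 0 \<le> v \<and> v < \<epsilon> \<and> norm (z - \<phi> v) \<le> B * R" for z
  proof -
    obtain y where y: "z = g y" using \<open>surj g\<close> by (auto simp: surj_def)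
    obtain v where v: "v \<in> int_adjoin \<beta>" "0 \<le> v" "v < \<epsilon>" "norm (y - \<Phi> v) \<le> R" using R by blast
    have "\<Phi> ((\<beta> - 1) * v) + \<Phi> v = \<Phi> ((\<beta> - 1) * v + v)" using v(1) by (intro \<Phi>_add[symmetric]) auto
    also have "\<dots> = M (\<Phi> v)" using \<Phi>_beta[OF v(1)] by (simp add: algebra_simps)
    finally have "\<phi> v = g (\<Phi> v)" by (simp add: \<phi>_def g_def algebra_simps)
    then have "norm (z - \<phi> v) \<le> B * norm (y - \<Phi> v)" using B(2)[of "y - \<Phi> v"] by (simp add: y linear_diff[OF lg])
    also have "\<dots> \<le> B * R" using v(4) B(1) by (intro mult_left_mono) auto
    finally show ?thesis using v by blast
  qed
  then show ?thesis by blast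
qed

lemma \<phi>_discrete: "finite {u \<in> L. \<bar>u\<bar> \<le> R \<and> norm (\<phi> u) \<le> R}"
proof (rule finite_subset)
  show "finite ((\<lambda>x. x / (\<beta> - 1)) ` {x \<in> int_adjoin \<beta>. \<bar>x\<bar> \<le> \<bar>R\<bar> \<and> norm (\<Phi> x) \<le> \<bar>R\<bar>})"
    by (intro finite_imageI \<Phi>_discrete)
  show "{u \<in> L. \<bar>u\<bar> \<le> R \<and> norm (\<phi> u) \<le> R} \<subseteq> (\<lambda>x. x / (\<beta> - 1)) ` {x \<in> int_adjoin \<beta>. \<bar>x\<bar> \<le> \<bar>R\<bar> \<and> norm (\<Phi> x) \<le> \<bar>R\<bar>}"
  proof
    fix u assume "u \<in> {u \<in> L. \<bar>u\<bar> \<le> R \<and> norm (\<phi> u) \<le> R}"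
    then have u: "(\<beta> - 1) * u \<in> int_adjoin \<beta>" "\<bar>u\<bar> \<le> R" "norm (\<Phi> ((\<beta> - 1) * u)) \<le> R" by (auto simp: L_def \<phi>_def)
    have "\<bar>(\<beta> - 1) * u\<bar> \<le> 1 * \<bar>u\<bar>" unfolding abs_mult using b1 b2 by (intro mult_right_mono) auto
    then show "u \<in> (\<lambda>x. x / (\<beta> - 1)) ` {x \<in> int_adjoin \<beta>. \<bar>x\<bar> \<le> \<bar>R\<bar> \<and> norm (\<Phi> x) \<le> \<bar>R\<bar>}"
      using u b1 by (intro image_eqI[of _ _ "(\<beta> - 1) * u"]) auto
  qed
qed

sublocale geo: rauzy_geometry d \<beta> \<phi> M \<rho>
proof
  show "\<phi> (u + v) = \<phi> u + \<phi> v" if "u \<in> L" "v \<in> L" for u v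
    using that by (simp add: \<phi>_def distrib_left \<Phi>_add L_def)
  show "\<phi> (\<beta> * u) = M (\<phi> u)" if "u \<in> L" for u
    using that \<Phi>_beta[of "(\<beta> - 1) * u"] by (simp add: \<phi>_def L_def mult.left_commute)
qed (use linear_add[OF linear_M] linear_cmul[OF linear_M] inj_M norm_M \<rho>_bounds \<phi>_discrete \<phi>_dense in auto)

end

section \<open>Transfer to the symmetric transformation\<close>

lemma hausdorff_dist_le:
  fixes A B :: "'a::metric_space set"
  assumes "A \<noteq> {}" "B \<noteq> {}" "\<And>a. a \<in> A \<Longrightarrow> \<exists>b\<in>B. dist a b \<le> r" "\<And>b. b \<in> B \<Longrightarrow> \<exists>a\<in>A. dist b a \<le> r"
  shows "hausdorff_dist A B \<le> r"
proof -
  have "(SUP x\<in>A. infdist x B) \<le> r"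
    using assms(1,3) by (intro cSUP_least) (auto intro: infdist_le2)
  moreover have "(SUP y\<in>B. infdist y A) \<le> r"
    using assms(2,4) by (intro cSUP_least) (auto intro: infdist_le2)
  ultimately show ?thesis by (simp add: hausdorff_dist_def)
qed

text \<open>Compactness bounds the distances, so that the real suprema are genuine upper
  bounds.\<close>

lemma infdist_le_hausdorff_dist:
  fixes A K :: "'a::metric_space set"
  assumes "compact A" "compact K" "A \<noteq> {}" "K \<noteq> {}"
  shows "\<And>x. x \<in> A \<Longrightarrow> infdist x K \<le> hausdorff_dist A K" "\<And>y. y \<in> K \<Longrightarrow> infdist y A \<le> hausdorff_dist A K"
proof -
  have bdd: "bdd_above ((\<lambda>x. infdist x B) ` S)" if "compact S" for S B :: "'a set"
  proof -
    have "compact ((\<lambda>x. infdist x B) ` S)"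
      using that by (intro compact_continuous_image continuous_on_infdist continuous_on_id)
    then show ?thesis by (rule bounded_imp_bdd_above[OF compact_imp_bounded])
  qed
  show "infdist x K \<le> hausdorff_dist A K" if "x \<in> A" for x
    using cSUP_upper[OF that bdd[OF assms(1), of K]] by (simp add: hausdorff_dist_def)
  show "infdist y A \<le> hausdorff_dist A K" if "y \<in> K" for y
    using cSUP_upper[OF that bdd[OF assms(2), of A]] by (simp add: hausdorff_dist_def)
qed

text \<open>Supplies the uniqueness behind the definite description: a point of one limit is close
  to \<open>S n\<close>, hence to the other limit, which is closed.\<close>

lemma hausdorff_lim_eqI:
  fixes S :: "nat \<Rightarrow> 'a::heine_borel set"
  assumes S: "\<And>n. finite (S n)" "\<And>n. S n \<noteq> {}"
    and K: "compact K" "K \<noteq> {}" "(\<lambda>n. hausdorff_dist (S n) K) \<longlonglongrightarrow> 0"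
  shows "hausdorff_lim S = K"
proof -
  have cS: "compact (S n)" for n using S(1) by (rule finite_imp_compact)
  have sub: "K1 \<subseteq> K2"
    if 1: "compact K1" "K1 \<noteq> {}" "(\<lambda>n. hausdorff_dist (S n) K1) \<longlonglongrightarrow> 0"
    and 2: "compact K2" "K2 \<noteq> {}" "(\<lambda>n. hausdorff_dist (S n) K2) \<longlonglongrightarrow> 0" for K1 K2
  proof
    fix k assume k: "k \<in> K1"
    have le: "infdist k K2 \<le> hausdorff_dist (S n) K1 + hausdorff_dist (S n) K2" for n
    proof -
      obtain s where s: "s \<in> S n" "infdist k (S n) = dist k s"
        using infdist_attains_inf[OF compact_imp_closed[OF cS[of n]] S(2)] by metis
      have "infdist k K2 \<le> infdist s K2 + dist k s" by (rule infdist_triangle)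
      moreover have "infdist s K2 \<le> hausdorff_dist (S n) K2"
        by (rule infdist_le_hausdorff_dist(1)[OF cS 2(1) S(2) 2(2) s(1)])
      moreover have "infdist k (S n) \<le> hausdorff_dist (S n) K1"
        by (rule infdist_le_hausdorff_dist(2)[OF cS 1(1) S(2) 1(2) k])
      ultimately show ?thesis using s(2) by linarith
    qed
    have "(\<lambda>n. hausdorff_dist (S n) K1 + hausdorff_dist (S n) K2) \<longlonglongrightarrow> 0 + 0"
      by (intro tendsto_add 1 2)
    then have "infdist k K2 \<le> 0" using le by (intro LIMSEQ_le_const[of _ "0"]) auto
    then have "infdist k K2 = 0" using infdist_nonneg[of k K2] by simp
    then show "k \<in> K2" using in_closed_iff_infdist_zero[OF compact_imp_closed[OF 2(1)] 2(2)] by blast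
  qed
  show ?thesis unfolding hausdorff_lim_def
    by (rule the_equality) (use K sub in blast)+
qed

context dbonacci
begin

text \<open>The inverse of \<open>x \<mapsto> (x + of_bool (x < 0)) / (\<beta> - 1)\<close>.\<close>

definition \<psi> :: "real \<Rightarrow> real" where "\<psi> u = (\<beta> - 1) * u - of_bool (c \<le> u)"

lemma scale_c: "(\<beta> - 1) * c = 1 / 2" "(\<beta> - 1) * (c - 1/2) = 1 - \<beta> / 2" "(\<beta> - 1) * (c + 1/2) = \<beta> / 2"
proof -
  show 1: "(\<beta> - 1) * c = 1 / 2" using beta_c by (simp add: left_diff_distrib)
  have "(\<beta> - 1) * (c - 1/2) = (\<beta> - 1) * c - (\<beta> - 1) / 2" by (simp add: right_diff_distrib)
  also have "\<dots> = 1 - \<beta> / 2" unfolding 1 by (simp add: diff_divide_distrib)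
  finally show "(\<beta> - 1) * (c - 1/2) = 1 - \<beta> / 2" .
  have "(\<beta> - 1) * (c + 1/2) = (\<beta> - 1) * c + (\<beta> - 1) / 2" by (simp add: distrib_left)
  also have "\<dots> = \<beta> / 2" unfolding 1 by (simp add: diff_divide_distrib)
  finally show "(\<beta> - 1) * (c + 1/2) = \<beta> / 2" .
qed

lemma scale_less: "(\<beta> - 1) * u < (\<beta> - 1) * v \<longleftrightarrow> u < v" and scale_le: "(\<beta> - 1) * u \<le> (\<beta> - 1) * v \<longleftrightarrow> u \<le> v"
  using b1 by auto

lemma scale_X:
  assumes "u \<in> X"
  shows "1 - \<beta> / 2 \<le> (\<beta> - 1) * u" "(\<beta> - 1) * u < \<beta> / 2" "(\<beta> - 1) * u < 1 / 2 \<longleftrightarrow> u < c"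
proof -
  have u: "c - 1/2 \<le> u" "u < c + 1/2" using assms by (auto simp: X_def)
  show "1 - \<beta> / 2 \<le> (\<beta> - 1) * u" using u(1) unfolding scale_le[of "c - 1/2" u, symmetric] scale_c .
  show "(\<beta> - 1) * u < \<beta> / 2" using u(2) unfolding scale_less[of u "c + 1/2", symmetric] scale_c .
  show "(\<beta> - 1) * u < 1 / 2 \<longleftrightarrow> u < c" using scale_less[of u c] unfolding scale_c(1) .
qed

lemma \<psi>_in_X_S: "u \<in> X \<Longrightarrow> \<psi> u \<in> X_S \<beta>"
proof -
  assume "u \<in> X"
  from scale_X[OF this] show ?thesis by (cases "u < c") (auto simp: \<psi>_def X_S_def)
qed

lemma \<psi>_surj:
  assumes "x \<in> X_S \<beta>"
  obtains u where "u \<in> X" "\<psi> u = x"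
proof -
  define u where "u = (x + of_bool (x < 0)) / (\<beta> - 1)"
  have u: "(\<beta> - 1) * u = x + of_bool (x < 0)" using b1 by (simp add: u_def)
  have x: "- (1/2) \<le> x \<and> x < \<beta>/2 - 1 \<and> x < 0 \<or> 1 - \<beta>/2 \<le> x \<and> x < 1/2 \<and> \<not> x < 0"
    using assms b1 b2 by (auto simp: X_S_def)
  have "(\<beta> - 1) * (c - 1/2) \<le> (\<beta> - 1) * u" "(\<beta> - 1) * u < (\<beta> - 1) * (c + 1/2)"
    unfolding scale_c u using x b1 b2 by auto
  then have "u \<in> X" unfolding scale_le scale_less by (simp add: X_def)
  moreover have "(\<beta> - 1) * u < (\<beta> - 1) * c \<longleftrightarrow> \<not> x < 0" unfolding scale_c u using x by auto
  then have "\<psi> u = x" unfolding scale_less using u by (auto simp: \<psi>_def)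
  ultimately show ?thesis using that by blast
qed

lemma \<psi>_inj: "inj_on \<psi> X"
proof (rule inj_onI)
  fix u v assume uv: "u \<in> X" "v \<in> X" "\<psi> u = \<psi> v"
  have "(\<beta> - 1) * u = (\<beta> - 1) * v"
    using scale_X[OF uv(1)] scale_X[OF uv(2)] uv(3) b2 by (auto simp: \<psi>_def split: if_splits simp: of_bool_def)
  then show "u = v" using b1 by simp
qed

lemma \<psi>_Zb_iff: "\<psi> u \<in> int_adjoin \<beta> \<longleftrightarrow> u \<in> L"
proof
  assume "\<psi> u \<in> int_adjoin \<beta>"
  then have "\<psi> u + of_bool (c \<le> u) \<in> int_adjoin \<beta>" by (intro int_adjoin_add) auto
  then show "u \<in> L" by (simp add: \<psi>_def L_def)
next
  assume "u \<in> L"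
  then show "\<psi> u \<in> int_adjoin \<beta>" unfolding \<psi>_def L_def by (intro int_adjoin_diff) auto
qed

lemma bij_betw_\<psi>: "bij_betw \<psi> (X \<inter> L) (int_adjoin \<beta> \<inter> X_S \<beta>)"
  unfolding bij_betw_def
proof
  show "inj_on \<psi> (X \<inter> L)" using \<psi>_inj by (rule inj_on_subset) simp
  show "\<psi> ` (X \<inter> L) = int_adjoin \<beta> \<inter> X_S \<beta>"
  proof (intro subset_antisym subsetI)
    fix x assume "x \<in> int_adjoin \<beta> \<inter> X_S \<beta>"
    then obtain u where "u \<in> X" "\<psi> u = x" "x \<in> int_adjoin \<beta>" using \<psi>_surj by blast
    then show "x \<in> \<psi> ` (X \<inter> L)" using \<psi>_Zb_iff[of u] by blast
  qed (auto simp: \<psi>_Zb_iff \<psi>_in_X_S)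
qed

lemma T_S_\<psi>:
  assumes u: "u \<in> X"
  shows "T_S \<beta> (\<psi> u) = \<psi> (T u)"
proof -
  have eq: "\<beta> * \<psi> u = (\<beta> - 1) * T u - of_bool (c \<le> u)" by (simp add: \<psi>_def T_def algebra_simps)
  note t = scale_X[OF T_in_X[OF u]]
  have Tu: "c \<le> T u \<longleftrightarrow> 1 / 2 \<le> (\<beta> - 1) * T u" using t(3) by linarith
  \<comment> \<open>The scaled point \<open>(\<beta> - 1) * T u\<close> lies in
    \<open>[1 - \<beta>/2, \<beta>/2)\<close>, within \<open>(0, 1)\<close>; rounding it up or not
    is the choice of the branch of \<psi> at \<open>T u\<close>.\<close>
  have "\<lfloor>\<beta> * \<psi> u + 1/2\<rfloor> = of_bool (c \<le> T u) - of_bool (c \<le> u)"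
    unfolding eq floor_eq_iff Tu using t b2 by auto
  then show ?thesis unfolding T_S_def eq by (simp add: \<psi>_def[of "T u"])
qed

lemma T_S_pow_\<psi>: "u \<in> X \<Longrightarrow> (T_S \<beta> ^^ n) (\<psi> u) = \<psi> ((T ^^ n) u)"
  by (induction n) (simp_all add: T_S_\<psi> T_pow_in_X)

lemma T_S_preimages_\<psi>:
  assumes u: "u \<in> X"
  shows "T_S_preimages \<beta> n (\<psi> u) = \<psi> ` preimgs n u"
proof (intro subset_antisym subsetI)
  fix y assume "y \<in> T_S_preimages \<beta> n (\<psi> u)"
  then have y: "y \<in> X_S \<beta>" "(T_S \<beta> ^^ n) y = \<psi> u" by (auto simp: T_S_preimages_def)
  obtain v where v: "v \<in> X" "\<psi> v = y" using \<psi>_surj[OF y(1)] by blast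
  then have "\<psi> ((T ^^ n) v) = \<psi> u" using T_S_pow_\<psi>[OF v(1), of n] y(2) by simp
  then have "(T ^^ n) v = u" using \<psi>_inj T_pow_in_X[OF v(1)] u by (auto dest: inj_onD)
  then show "y \<in> \<psi> ` preimgs n u" using v by (auto simp: preimgs_def)
next
  fix y assume "y \<in> \<psi> ` preimgs n u"
  then show "y \<in> T_S_preimages \<beta> n (\<psi> u)"
    by (auto simp: preimgs_def T_S_preimages_def T_S_pow_\<psi> \<psi>_in_X_S)
qed

section \<open>Residues modulo \<open>\<beta> - 1\<close>\<close>

lemma Zb_mod_beta_minus_1:
  assumes "x \<in> int_adjoin \<beta>"
  shows "\<exists>m y. y \<in> int_adjoin \<beta> \<and> x = of_int m + (\<beta> - 1) * y"
  using assms
proof (induction rule: int_adjoin_induct)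
  case zero
  show ?case by (intro exI[of _ 0]) simp
next
  case (step y k)
  then obtain m y' where y': "y' \<in> int_adjoin \<beta>" "y = of_int m + (\<beta> - 1) * y'" by blast
  have "of_int k + \<beta> * y = of_int k + ((\<beta> - 1) * y + y)" by (simp add: algebra_simps)
  also have "\<dots> = of_int k + ((\<beta> - 1) * y + (of_int m + (\<beta> - 1) * y'))"
    using y'(2) by (simp only:)
  also have "\<dots> = of_int (k + m) + (\<beta> - 1) * (y + y')" by (simp add: distrib_left)
  finally show ?case using step(1) y'(1) int_adjoin_add by blast
qed

text \<open>Every power of \<beta> is congruent to 1, so the defining relation reads
  \<open>1 = d\<close> modulo \<open>\<beta> - 1\<close>.\<close>

lemma d_minus_1_multiple: "\<exists>s\<in>int_adjoin \<beta>. real (d - 1) = (\<beta> - 1) * s"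
proof -
  have pow: "\<beta> ^ i = 1 + (\<beta> - 1) * (\<Sum>j<i. \<beta> ^ j)" for i
  proof (induction i)
    case (Suc i)
    have "\<beta> ^ Suc i = \<beta> ^ i + (\<beta> - 1) * \<beta> ^ i" by (simp add: left_diff_distrib)
    also have "\<dots> = (1 + (\<beta> - 1) * (\<Sum>j<i. \<beta> ^ j)) + (\<beta> - 1) * \<beta> ^ i" using Suc by (simp only:)
    finally show ?case by (simp add: distrib_left)
  qed simp
  define s where "s = (\<Sum>j<d. \<beta> ^ j) - (\<Sum>i<d. \<Sum>j<i. \<beta> ^ j)"
  have "1 + (\<beta> - 1) * (\<Sum>j<d. \<beta> ^ j) = (\<Sum>i<d. 1 + (\<beta> - 1) * (\<Sum>j<i. \<beta> ^ j))"
    using bd unfolding pow[of d] by (simp flip: pow)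
  also have "\<dots> = real d + (\<beta> - 1) * (\<Sum>i<d. \<Sum>j<i. \<beta> ^ j)"
    by (simp add: sum.distrib sum_distrib_left)
  finally have "real d - 1 = (\<beta> - 1) * s" by (simp add: s_def right_diff_distrib)
  moreover have "real (d - 1) = real d - 1" using d2 by simp
  moreover have "s \<in> int_adjoin \<beta>" unfolding s_def by (intro int_adjoin_diff int_adjoin_sum) auto
  ultimately show ?thesis by auto
qed

lemma coset_cover:
  assumes "u \<in> L"
  shows "\<exists>k<d - 1. u - real k / (\<beta> - 1) \<in> int_adjoin \<beta>"
proof -
  obtain m y where y: "y \<in> int_adjoin \<beta>" "(\<beta> - 1) * u = of_int m + (\<beta> - 1) * y"
    using Zb_mod_beta_minus_1[of "(\<beta> - 1) * u"] assms by (auto simp: L_def)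
  obtain s where s: "s \<in> int_adjoin \<beta>" "real (d - 1) = (\<beta> - 1) * s" using d_minus_1_multiple by blast
  define D where "D = int (d - 1)"
  have D: "D > 0" using d2 by (simp add: D_def)
  define k where "k = nat (m mod D)"
  have kd: "k < d - 1" using D pos_mod_bound[OF D, of m] by (simp add: k_def D_def nat_less_iff)
  have "m = int k + D * (m div D)" using D by (simp add: k_def)
  then have "real_of_int m = real k + real (d - 1) * of_int (m div D)"
    by (metis D_def of_int_add of_int_mult of_int_of_nat_eq)
  moreover have "(\<beta> - 1) * (s * of_int (m div D) + y) = real (d - 1) * of_int (m div D) + (\<beta> - 1) * y"
    unfolding s(2) by (simp add: distrib_left mult.assoc)
  ultimately have "(\<beta> - 1) * u = real k + (\<beta> - 1) * (s * of_int (m div D) + y)"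
    using y(2) by linarith
  then have "u - real k / (\<beta> - 1) = s * of_int (m div D) + y" using b1 by (simp add: field_simps)
  moreover have "s * of_int (m div D) + y \<in> int_adjoin \<beta>" using s(1) y(1) by simp
  ultimately show ?thesis using kd by metis
qed

end

context rauzy_setting
begin

lemma int_lin_indep:
  fixes m :: "nat \<Rightarrow> int"
  assumes "(\<Sum>i<d. of_int (m i) * \<beta> ^ i) = 0" "i < d"
  shows "m i = 0"
proof -
  define p :: "rat poly" where "p = (\<Sum>i<d. monom (of_int (m i)) i)"
  have "rat_eval p \<beta> = 0" using assms(1) by (simp add: p_def rat_eval_sum rat_eval_monom)
  then have dvd: "min_poly \<beta> dvd p" by (rule min_poly_beta(4))
  have "degree (min_poly \<beta>) = d" using card_gal finite_galois_conjugates(2) degree_min_poly_le by simp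
  moreover have "degree p < d"
    unfolding p_def using d2 by (intro degree_sum_less) (auto intro: le_less_trans[OF degree_monom_le])
  ultimately have "p = 0" using dvd_imp_degree_le[OF dvd] by fastforce
  moreover have "coeff p i = of_int (m i)" using assms(2) by (simp add: p_def coeff_sum)
  ultimately show ?thesis by simp
qed

text \<open>The sum of the coordinates in the basis \<open>\<beta> ^ i\<close>, taken modulo
  \<open>d - 1\<close>, vanishes on multiples of \<open>\<beta> - 1\<close>: reducing
  \<open>\<beta> ^ d\<close> replaces one coefficient by \<open>d\<close> copies of it. Comparing
  sums shows that \<open>k - k'\<close> is divisible by \<open>d - 1\<close>.\<close>

lemma coset_disjoint:
  assumes "k < d - 1" "k' < d - 1" "real k / (\<beta> - 1) - real k' / (\<beta> - 1) \<in> int_adjoin \<beta>"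
  shows "k = k'"
proof -
  obtain n :: "nat \<Rightarrow> int" where n: "real k / (\<beta> - 1) - real k' / (\<beta> - 1) = (\<Sum>i<d. of_int (n i) * \<beta> ^ i)"
    using Zb_basis_sum[OF assms(3)] by blast
  obtain m where m: "d = Suc m" using d2 by (cases d) auto
  define r where "r i = n m + (if i = 0 then - (int k - int k') else n (i - 1)) - n i" for i
  have "real k - real k' = (\<beta> - 1) * (\<Sum>i<d. of_int (n i) * \<beta> ^ i)"
    unfolding n[symmetric] using b1 by (simp add: right_diff_distrib)
  also have "\<dots> = \<beta> * (\<Sum>i<d. of_int (n i) * \<beta> ^ i) - (\<Sum>i<d. of_int (n i) * \<beta> ^ i)"
    by (simp add: algebra_simps)
  also have "\<beta> * (\<Sum>i<d. of_int (n i) * \<beta> ^ i) = (\<Sum>i<m. of_int (n i) * \<beta> ^ Suc i) + of_int (n m) * \<beta> ^ d"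
    by (simp add: m sum_distrib_left distrib_left mult_ac)
  also have "of_int (n m) * \<beta> ^ d = (\<Sum>i<d. of_int (n m) * \<beta> ^ i)" by (simp add: bd sum_distrib_left)
  finally have "0 = - (real k - real k') + (\<Sum>i<m. of_int (n i) * \<beta> ^ Suc i)
      + (\<Sum>i<d. of_int (n m) * \<beta> ^ i) - (\<Sum>i<d. of_int (n i) * \<beta> ^ i)" by simp
  also have "- (real k - real k') + (\<Sum>i<m. of_int (n i) * \<beta> ^ Suc i)
      = (\<Sum>i<d. of_int (if i = 0 then - (int k - int k') else n (i - 1)) * \<beta> ^ i)"
    unfolding m by (simp only: sum.lessThan_Suc_shift) simp
  finally have "(\<Sum>i<d. of_int (r i) * \<beta> ^ i) = 0"
    by (simp add: r_def sum.distrib sum_subtractf left_diff_distrib distrib_right)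
  then have r0: "r i = 0" if "i < d" for i using int_lin_indep that by blast
  have "0 = (\<Sum>i<d. r i)" using r0 by simp
  also have "\<dots> = int d * n m + (\<Sum>i<d. if i = 0 then - (int k - int k') else n (i - 1)) - (\<Sum>i<d. n i)"
    by (simp add: r_def sum.distrib sum_subtractf)
  also have "(\<Sum>i<d. if i = 0 then - (int k - int k') else n (i - 1)) = - (int k - int k') + (\<Sum>i<m. n i)"
    unfolding m by (subst sum.lessThan_Suc_shift) simp
  finally have "int k - int k' = int (d - 1) * n m" using m by (simp add: algebra_simps)
  moreover have "\<bar>int k - int k'\<bar> < int (d - 1)" using assms by auto
  ultimately have "n m = 0"
    by (metis abs_mult abs_of_nat int_one_le_iff_zero_less mult.right_neutral mult_left_mono not_less of_nat_0_le_iff zero_less_abs_iff)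
  then show ?thesis using \<open>int k - int k' = int (d - 1) * n m\<close> by simp
qed

lemma card_tiles:
  assumes "\<And>k. k < d - 1 \<Longrightarrow> card (geo.C (real k / (\<beta> - 1)) z) = 1"
  shows "card {u \<in> X \<inter> L. z \<in> geo.K u} = d - 1"
proof -
  define w where "w k = real k / (\<beta> - 1)" for k :: nat
  have wL: "w k \<in> L" for k using b1 by (simp add: w_def L_def)
  have "{u \<in> X \<inter> L. z \<in> geo.K u} = (\<Union>k<d-1. geo.C (w k) z)"
  proof (intro subset_antisym subsetI)
    fix u assume u: "u \<in> {u \<in> X \<inter> L. z \<in> geo.K u}"
    then obtain k where "k < d - 1" "u - w k \<in> int_adjoin \<beta>" using coset_cover by (auto simp: w_def)
    then show "u \<in> (\<Union>k<d-1. geo.C (w k) z)" using u by (auto simp: geo.C_def)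
  next
    fix u assume "u \<in> (\<Union>k<d-1. geo.C (w k) z)"
    then show "u \<in> {u \<in> X \<inter> L. z \<in> geo.K u}" using geo.C_subset[OF wL] by (auto simp: geo.C_def)
  qed
  moreover have "card (\<Union>k<d-1. geo.C (w k) z) = (\<Sum>k<d-1. card (geo.C (w k) z))"
  proof (rule card_UN_disjoint)
    show "\<forall>k\<in>{..<d-1}. finite (geo.C (w k) z)" using geo.finite_C[OF wL] by blast
    show "\<forall>k\<in>{..<d-1}. \<forall>k'\<in>{..<d-1}. k \<noteq> k' \<longrightarrow> geo.C (w k) z \<inter> geo.C (w k') z = {}"
    proof (intro ballI impI)
      fix k k' assume kk: "k \<in> {..<d-1}" "k' \<in> {..<d-1}" "k \<noteq> k'"
      have False if "u \<in> geo.C (w k) z" "u \<in> geo.C (w k') z" for u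
      proof -
        have "(u - w k') - (u - w k) \<in> int_adjoin \<beta>"
        proof (rule int_adjoin_diff)
          show "u - w k' \<in> int_adjoin \<beta>" "u - w k \<in> int_adjoin \<beta>" using that by (simp_all add: geo.C_def)
        qed
        then have "w k - w k' \<in> int_adjoin \<beta>" by simp
        then show False using coset_disjoint[of k k'] kk by (simp add: w_def)
      qed
      then show "geo.C (w k) z \<inter> geo.C (w k') z = {}" by blast
    qed
  qed simp
  ultimately show ?thesis using assms by (simp add: w_def)
qed

text \<open>The level sets for \<open>\<psi> u\<close> and those for \<open>u\<close> differ by
  \<open>\<Phi> (\<beta> ^ n)\<close> at most, which tends to 0, so both have the limit
  \<open>K u\<close>. The constant \<open>B\<close> adds this difference to the error
  \<open>E\<close> of the tiles.\<close>

lemma rauzy_fractal_\<psi>: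
  assumes u: "u \<in> X" "u \<in> L"
  shows "rauzy_fractal \<beta> \<Phi> (\<psi> u) = geo.K u"
  unfolding rauzy_fractal_def T_S_preimages_\<psi>[OF u(1)]
proof (rule hausdorff_lim_eqI)
  define S where "S n = \<Phi> ` (\<lambda>y. \<beta> ^ n * y) ` \<psi> ` preimgs n u" for n
  define B where "B = geo.E + norm (\<Phi> 1)"
  show "finite (\<Phi> ` (\<lambda>y. \<beta> ^ n * y) ` \<psi> ` preimgs n u)" for n using finite_preimgs by simp
  have ne: "preimgs n u \<noteq> {}" for n
  proof -
    obtain z where "z \<in> geo.K u" using geo.K_nonempty[OF u] by blast
    then show ?thesis by (auto simp: geo.K_def)
  qed
  then show "\<Phi> ` (\<lambda>y. \<beta> ^ n * y) ` \<psi> ` preimgs n u \<noteq> {}" for n by simp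
  show K: "compact (geo.K u)" "geo.K u \<noteq> {}" using geo.compact_K geo.K_nonempty u by auto
  have near: "norm (\<phi> (\<beta> ^ n * y) - \<Phi> (\<beta> ^ n * \<psi> y)) \<le> norm (\<Phi> 1) * \<rho> ^ n" if "y \<in> L" for y n
  proof -
    have y: "(\<beta> - 1) * y \<in> int_adjoin \<beta>" using that by (simp add: L_def)
    have \<psi>y: "\<psi> y \<in> int_adjoin \<beta>" using that by (simp add: \<psi>_Zb_iff)
    have "(\<beta> - 1) * (\<beta> ^ n * y) = \<beta> ^ n * \<psi> y + \<beta> ^ n * of_bool (c \<le> y)" by (simp add: \<psi>_def algebra_simps)
    then have "\<phi> (\<beta> ^ n * y) = \<Phi> (\<beta> ^ n * \<psi> y) + \<Phi> (\<beta> ^ n * of_bool (c \<le> y))"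
      unfolding \<phi>_def using \<psi>y by (simp add: \<Phi>_add)
    then have "\<phi> (\<beta> ^ n * y) - \<Phi> (\<beta> ^ n * \<psi> y) = (M ^^ n) (\<Phi> (of_bool (c \<le> y)))"
      by (simp add: \<Phi>_pow)
    then have "norm (\<phi> (\<beta> ^ n * y) - \<Phi> (\<beta> ^ n * \<psi> y)) \<le> \<rho> ^ n * norm (\<Phi> (of_bool (c \<le> y)))"
      using geo.norm_M_pow by simp
    also have "\<Phi> 0 = 0" using \<Phi>_add[of 0 0] by simp
    then have "norm (\<Phi> (of_bool (c \<le> y))) \<le> norm (\<Phi> 1)" by simp
    then have "\<rho> ^ n * norm (\<Phi> (of_bool (c \<le> y))) \<le> \<rho> ^ n * norm (\<Phi> 1)"
      using geo.rho_pow[of n] by (intro mult_left_mono) auto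
    finally show ?thesis by (simp add: mult.commute)
  qed
  have le: "hausdorff_dist (S n) (geo.K u) \<le> B * \<rho> ^ n" for n
  proof (rule hausdorff_dist_le)
    show "S n \<noteq> {}" using ne by (simp add: S_def)
    show "geo.K u \<noteq> {}" by (rule K(2))
    show "\<exists>z\<in>geo.K u. dist a z \<le> B * \<rho> ^ n" if a: "a \<in> S n" for a
    proof -
      obtain y where y: "y \<in> preimgs n u" "a = \<Phi> (\<beta> ^ n * \<psi> y)" using a by (auto simp: S_def)
      obtain z where z: "z \<in> geo.K u" "norm (z - \<phi> (\<beta> ^ n * y)) \<le> geo.E * \<rho> ^ n"
        using geo.K_approx[OF u y(1)] by blast
      have "dist a z \<le> norm (z - \<phi> (\<beta> ^ n * y)) + norm (\<phi> (\<beta> ^ n * y) - a)"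
        unfolding dist_norm by (subst norm_minus_commute) (rule norm_diff_triangle_ineq[of z "\<phi> (\<beta> ^ n * y)" "\<phi> (\<beta> ^ n * y)" a, simplified])
      then have "dist a z \<le> B * \<rho> ^ n"
        using z(2) near[OF preimgs_L[OF u(2) y(1)], of n] y(2) by (simp add: B_def distrib_right)
      then show ?thesis using z(1) by blast
    qed
    show "\<exists>a\<in>S n. dist z a \<le> B * \<rho> ^ n" if z: "z \<in> geo.K u" for z
    proof -
      obtain y where y: "y \<in> preimgs n u" "norm (z - \<phi> (\<beta> ^ n * y)) \<le> geo.E * \<rho> ^ n"
        using z by (auto simp: geo.K_def)
      define a where "a = \<Phi> (\<beta> ^ n * \<psi> y)"
      have "dist z a \<le> norm (z - \<phi> (\<beta> ^ n * y)) + norm (\<phi> (\<beta> ^ n * y) - a)"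
        unfolding dist_norm by (rule norm_diff_triangle_ineq[of z "\<phi> (\<beta> ^ n * y)" "\<phi> (\<beta> ^ n * y)" a, simplified])
      then have "dist z a \<le> B * \<rho> ^ n"
        using y(2) near[OF preimgs_L[OF u(2) y(1)], of n] by (simp add: B_def distrib_right a_def)
      then show ?thesis using y(1) by (auto simp: S_def a_def)
    qed
  qed
  have "(\<lambda>n. hausdorff_dist (S n) (geo.K u)) \<longlonglongrightarrow> 0"
  proof (rule tendsto_sandwich[of "\<lambda>_. 0" _ _ "\<lambda>n. B * \<rho> ^ n"])
    have "0 \<le> hausdorff_dist (S n) (geo.K u)" for n
    proof -
      obtain z where z: "z \<in> geo.K u" using K(2) by blast
      have "compact (S n)" "S n \<noteq> {}" using finite_preimgs ne by (auto simp: S_def intro!: finite_imp_compact)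
      then show ?thesis
        using infdist_le_hausdorff_dist(2)[OF _ K(1) _ K(2) z, of "S n"] infdist_nonneg[of z "S n"] by linarith
    qed
    then show "\<forall>\<^sub>F n in sequentially. 0 \<le> hausdorff_dist (S n) (geo.K u)" by simp
    show "\<forall>\<^sub>F n in sequentially. hausdorff_dist (S n) (geo.K u) \<le> B * \<rho> ^ n" using le by simp
    have "(\<lambda>n. B * \<rho> ^ n) \<longlonglongrightarrow> B * 0"
      using \<rho>_bounds by (intro tendsto_intros LIMSEQ_power_zero) auto
    then show "(\<lambda>n. B * \<rho> ^ n) \<longlonglongrightarrow> 0" by simp
  qed simp
  then show "(\<lambda>n. hausdorff_dist (\<Phi> ` (\<lambda>y. \<beta> ^ n * y) ` \<psi> ` preimgs n u) (geo.K u)) \<longlonglongrightarrow> 0"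
    by (simp add: S_def)
qed

lemma covering_degree:
  "has_covering_degree (int_adjoin \<beta> \<inter> X_S \<beta>) (rauzy_fractal \<beta> \<Phi>) (d - 1)"
  unfolding has_covering_degree_def
proof
  show "1 \<le> d - 1" using d2 by simp
  have "AE z in lebesgue. \<forall>k\<in>{..<d-1}. card (geo.C (real k / (\<beta> - 1)) z) = 1"
    using b1 by (intro AE_finite_allI geo.AE_card_C) (auto simp: L_def)
  then show "AE z in lebesgue. card {i \<in> int_adjoin \<beta> \<inter> X_S \<beta>. z \<in> rauzy_fractal \<beta> \<Phi> i} = d - 1"
  proof (eventually_elim)
    case (elim z)
    have I: "int_adjoin \<beta> \<inter> X_S \<beta> = \<psi> ` (X \<inter> L)" using bij_betw_\<psi> by (simp add: bij_betw_def)
    have "{i \<in> int_adjoin \<beta> \<inter> X_S \<beta>. z \<in> rauzy_fractal \<beta> \<Phi> i} = \<psi> ` {u \<in> X \<inter> L. z \<in> rauzy_fractal \<beta> \<Phi> (\<psi> u)}"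
      unfolding I by blast
    also have "{u \<in> X \<inter> L. z \<in> rauzy_fractal \<beta> \<Phi> (\<psi> u)} = {u \<in> X \<inter> L. z \<in> geo.K u}"
      by (rule Collect_cong) (auto simp: rauzy_fractal_\<psi>)
    finally have "{i \<in> int_adjoin \<beta> \<inter> X_S \<beta>. z \<in> rauzy_fractal \<beta> \<Phi> i} = \<psi> ` {u \<in> X \<inter> L. z \<in> geo.K u}" .
    moreover have "inj_on \<psi> {u \<in> X \<inter> L. z \<in> geo.K u}" using \<psi>_inj by (rule inj_on_subset) auto
    ultimately show ?case using card_tiles[of z] elim by (simp add: card_image)
  qed
qed

theorem rauzy_multiple_tiling:
  "multiple_tiling (int_adjoin \<beta> \<inter> X_S \<beta>) (rauzy_fractal \<beta> \<Phi>)"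
proof -
  let ?I = "int_adjoin \<beta> \<inter> X_S \<beta>" and ?R = "rauzy_fractal \<beta> \<Phi>"
  have I: "?I = \<psi> ` (X \<inter> L)" using bij_betw_\<psi> by (simp add: bij_betw_def)
  have "\<exists>F. finite F \<and> (\<forall>i\<in>?I. \<exists>S\<in>F. \<exists>v. ?R i = (\<lambda>z. v + z) ` S)"
    unfolding I using geo.K_finite_shapes by (simp add: rauzy_fractal_\<psi>)
  moreover have "finite {i \<in> ?I. ?R i \<inter> B \<noteq> {}}" if "bounded B" for B
  proof -
    have "{i \<in> ?I. ?R i \<inter> B \<noteq> {}} = \<psi> ` {u \<in> X \<inter> L. ?R (\<psi> u) \<inter> B \<noteq> {}}"
      unfolding I by blast
    also have "{u \<in> X \<inter> L. ?R (\<psi> u) \<inter> B \<noteq> {}} = {u \<in> X \<inter> L. geo.K u \<inter> B \<noteq> {}}"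
      by (rule Collect_cong) (auto simp: rauzy_fractal_\<psi>)
    finally have "{i \<in> ?I. ?R i \<inter> B \<noteq> {}} = \<psi> ` {u \<in> X \<inter> L. geo.K u \<inter> B \<noteq> {}}" .
    then show ?thesis using geo.K_locally_finite[OF that] by simp
  qed
  moreover have "(\<Union>i\<in>?I. ?R i) = UNIV"
  proof -
    have "z \<in> (\<Union>u\<in>X \<inter> L. geo.K u)" for z
      using geo.K_covering[OF L_0, of z] geo.C_subset[OF L_0, of z] by (force simp: geo.C_def)
    then show ?thesis unfolding I by (auto simp: rauzy_fractal_\<psi>)
  qed
  moreover have "\<forall>i\<in>?I. closure (interior (?R i)) = ?R i"
    unfolding I using geo.closure_interior_K by (auto simp: rauzy_fractal_\<psi>)
  ultimately show ?thesis unfolding multiple_tiling_def using covering_degree by blast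
qed

end

theorem theorem1:
  fixes d e :: nat
    and \<beta> :: real
    and b :: "nat \<Rightarrow> complex"
    and \<sigma> :: "nat \<Rightarrow> real \<Rightarrow> complex"
    and \<iota> :: "'n::finite \<Rightarrow> nat"
  assumes "d \<ge> 2"
    and "1 < \<beta>" "\<beta> < 2" and "\<beta> ^ d = (\<Sum>i<d. \<beta> ^ i)"
    and "galois_conjugates \<beta> - \<real> = b ` {1..e} \<union> cnj ` b ` {1..e}"
    and "card (galois_conjugates \<beta> - \<real>) = 2 * e"
    and "galois_conjugates \<beta> \<inter> \<real> - {of_real \<beta>} = b ` {e+1..d-e-1}"
    and "card (galois_conjugates \<beta> \<inter> \<real> - {of_real \<beta>}) = d - 2 * e - 1"
    and "\<And>j. j \<in> {1..d-e-1} \<Longrightarrow>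
           field_iso_on (\<sigma> j) (rat_adjoin \<beta>) (rat_adjoin (b j)) \<and> \<sigma> j \<beta> = b j"
    and "CARD('n) = d - 1" and "bij_betw \<iota> UNIV {1..d-1}"
  shows "multiple_tiling (int_adjoin \<beta> \<inter> X_S \<beta>)
             (rauzy_fractal \<beta> (Phi d e \<sigma> \<iota> :: real \<Rightarrow> real ^ 'n)) \<and>
         has_covering_degree (int_adjoin \<beta> \<inter> X_S \<beta>)
             (rauzy_fractal \<beta> (Phi d e \<sigma> \<iota> :: real \<Rightarrow> real ^ 'n)) (d - 1)"
proof -
  interpret rauzy_setting d \<beta> e b \<sigma> \<iota>
    by unfold_locales (fact assms)+
  show ?thesis using rauzy_multiple_tiling covering_degree by blast
qed

end
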